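(* Let $G$ be $Sp(2n)$, $SO(2n+1)$ or $SO(2n)$, and let $\lambda$ be a partition with at most $n-1$ nonzero parts (at most $n-2$ when $G=SO(2n)$). Let $W_G(\lambda)$ be the representation $W_{Sp}(\lambda)$ if $G=Sp(2n)$, and $W_O(\lambda)$ if $G$ is orthogonal, as defined in the context. (1) If $V_G(\mu)$ appears in $W_G(\lambda)$ (i.e. with nonzero multiplicity), then $\mu\subseteq\lambda$ (containment of Young diagrams). In particular, if moreover $\mu\neq\lambda$, then $|\mu|<|\lambda|$; this is equivalent to saying that, when the weight $\lambda-\mu$ is written as a linear combination of the simple roots $\alpha_1,\dots,\alpha_n$, the coefficient of $\alpha_n$ is nonzero (and, for $SO(2n)$, the coefficient of $\alpha_{n-1}$ is nonzero also). (2) The trivial representation $V_G(0)=\mathbf{C}$ appears in $W_O(\lambda)$ if and only if all columns of the Young diagram of $\lambda$ have even height, and it appears in $W_{Sp}(\lambda)$ if and only if all rows of the Young diagram of $\lambda$ have even length. Moreover, if it does appear, it has multiplicity $1$.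
   Context: Partitions $\lambda=\langle\lambda_1\ge\lambda_2\ge\cdots\ge 0\rangle$ are identified with Young diagrams (rows of lengths $\lambda_i$), and $|\lambda|=\sum_i\lambda_i$. A partition $\lambda$ is identified with the dominant weight in which the coefficient of the fundamental weight $\omega_k$ is $\lambda_k-\lambda_{k+1}$ (the number of columns of height exactly $k$). Simple roots $\alpha_1,\dots,\alpha_n$ are numbered in the standard (Bourbaki/Humphreys) way, so that $\alpha_n$ is the long simple root for $Sp(2n)$, the short simple root for $SO(2n+1)$, and $\alpha_{n-1},\alpha_n$ are the spin nodes for $SO(2n)$. $V_G(\mu)$ denotes the irreducible representation of $G$ with highest weight $\mu$. Let $c^\lambda_{\mu\nu}$ be the Littlewood--Richardson numbers, defined by $s_\mu s_\nu=\sum_\lambda c^\lambda_{\mu\nu}s_\lambda$ for Schur functions $s_\lambda$. Define $$W_{Sp}(\lambda)=\bigoplus_\mu\Big(\sum_{\nu}c^\lambda_{\mu\nu}\Big)V_{Sp}(\mu),\quad \nu \text{ ranging over partitions all of whose rows have even length},$$ $$W_{O}(\lambda)=\bigoplus_\mu\Big(\sum_{\nu}c^\lambda_{\mu\nu}\Big)V_{O}(\mu),\quad \nu \text{ ranging over partitions all of whose columns have even height},$$ where the sums over $\mu$ run over all partitions and the integers in parentheses are multiplicities. Here $V_{Sp}(\mu)$ means $V_{Sp(2n)}(\mu)$, and $V_O(\mu)$ means $V_{SO(2n+1)}(\mu)$ or $V_{SO(2n)}(\mu)$. *)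

theory Defs
  imports
    "HOL-Library.FuncSet"
    "HOL-Library.Poly_Mapping"
    "HOL-Library.Groups_Big_Fun"
    "Jordan_Normal_Form.VS_Connect"
begin

section \<open>Partitions\<close>

text \<open>Parts are indexed from 0: \<open>part \<mu> i\<close> is the \<open>(i+1)\<close>-st part.\<close>

typedef partition = "{f :: nat \<Rightarrow> nat. antimono f \<and> finite {i. f i \<noteq> 0}}"
  morphisms part Abs_partition
  by (rule exI[of _ "\<lambda>_. 0"]) (simp add: antimono_def)

definition empty_partition :: partition where
  "empty_partition = Abs_partition (\<lambda>_. 0)"

definition num_parts :: "partition \<Rightarrow> nat" where
  "num_parts \<mu> = card {i. part \<mu> i \<noteq> 0}"

definition partition_size :: "partition \<Rightarrow> nat" where
  "partition_size \<mu> = Sum_any (part \<mu>)"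

definition diagram :: "partition \<Rightarrow> (nat \<times> nat) set" where
  "diagram \<mu> = {(i, j). j < part \<mu> i}"

definition column_height :: "partition \<Rightarrow> nat \<Rightarrow> nat" where
  "column_height \<mu> j = card {i. (i, j) \<in> diagram \<mu>}"

definition even_rows :: "partition \<Rightarrow> bool" where
  "even_rows \<mu> \<longleftrightarrow> (\<forall>i. even (part \<mu> i))"

definition even_columns :: "partition \<Rightarrow> bool" where
  "even_columns \<mu> \<longleftrightarrow> (\<forall>j. even (column_height \<mu> j))"

section \<open>Schur functions and Littlewood--Richardson numbers\<close>

text \<open>A symmetric function in the variables \<open>x\<^sub>0, x\<^sub>1, \<dots>\<close> is represented by its coefficient
  function on monomials; a monomial is its finitely supported exponent vector.\<close>

type_synonym sym_series = "(nat \<Rightarrow>\<^sub>0 nat) \<Rightarrow> int"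

definition ssyt :: "partition \<Rightarrow> (nat \<times> nat \<Rightarrow> nat) set" where
  "ssyt \<mu> = {T \<in> extensional (diagram \<mu>).
     (\<forall>i j j'. j < j' \<and> (i, j') \<in> diagram \<mu> \<longrightarrow> T (i, j) \<le> T (i, j')) \<and>
     (\<forall>i i' j. i < i' \<and> (i', j) \<in> diagram \<mu> \<longrightarrow> T (i, j) < T (i', j))}"

definition schur :: "partition \<Rightarrow> sym_series" where
  "schur \<mu> m = int (card {T \<in> ssyt \<mu>. \<forall>k. card {b \<in> diagram \<mu>. T b = k} = Poly_Mapping.lookup m k})"

definition series_mult :: "sym_series \<Rightarrow> sym_series \<Rightarrow> sym_series" where
  "series_mult f g m = (\<Sum>(a, b) \<in> {(a, b). a + b = m}. f a * g b)"

text \<open>\<open>lr_number \<lambda> \<mu> \<nu>\<close> is \<open>c\<^sup>\<lambda>\<close> with lower indices \<open>\<mu>\<close>, \<open>\<nu>\<close>: the coefficient of \<open>s\<^sub>\<lambda>\<close> in the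
  (unique, finite) expansion of \<open>s\<^sub>\<mu> s\<^sub>\<nu>\<close>.\<close>

definition lr_number :: "partition \<Rightarrow> partition \<Rightarrow> partition \<Rightarrow> int" where
  "lr_number lam \<mu> \<nu> = Poly_Mapping.lookup
     (THE c :: partition \<Rightarrow>\<^sub>0 int. series_mult (schur \<mu>) (schur \<nu>) =
        (\<lambda>m. \<Sum>\<kappa> \<in> Poly_Mapping.keys c. Poly_Mapping.lookup c \<kappa> * schur \<kappa> m)) lam"

section \<open>The groups, as complex matrix groups\<close>

datatype classical_type = Sp | SO_odd | SO_even

fun matrix_size :: "classical_type \<Rightarrow> nat \<Rightarrow> nat" where
  "matrix_size Sp n = 2 * n"
| "matrix_size SO_odd n = 2 * n + 1"
| "matrix_size SO_even n = 2 * n"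

text \<open>The block form pairing the basis vectors \<open>i\<close> and \<open>n + i\<close> (indices from 0), alternating for
  \<open>Sp\<close> and symmetric otherwise; in odd size the last basis vector is a unit vector orthogonal to
  the rest.  With this choice the diagonal matrices in the group form a maximal torus.\<close>

definition form_matrix :: "classical_type \<Rightarrow> nat \<Rightarrow> complex mat" where
  "form_matrix t n = mat (matrix_size t n) (matrix_size t n) (\<lambda>(i, j).
     if i < n \<and> j = n + i then 1
     else if j < n \<and> i = n + j then (if t = Sp then -1 else 1)
     else if i = 2 * n \<and> j = 2 * n then 1
     else 0)"

definition classical_group :: "classical_type \<Rightarrow> nat \<Rightarrow> complex mat set" where
  "classical_group t n = {g \<in> carrier_mat (matrix_size t n) (matrix_size t n).
     transpose_mat g * form_matrix t n * g = form_matrix t n \<and> (t \<noteq> Sp \<longrightarrow> det g = 1)}"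

definition torus_element :: "classical_type \<Rightarrow> nat \<Rightarrow> (nat \<Rightarrow> complex) \<Rightarrow> complex mat" where
  "torus_element t n z = mat_diag (matrix_size t n)
     (\<lambda>i. if i < n then z (i + 1) else if i < 2 * n then inverse (z (i - n + 1)) else 1)"

section \<open>Rational representations\<close>

text \<open>A representation consists of its dimension \<open>d\<close> and a map from the group to \<open>d \<times> d\<close> matrices.\<close>

type_synonym rep = "nat \<times> (complex mat \<Rightarrow> complex mat)"

inductive_set polynomial_functions :: "nat \<Rightarrow> (complex mat \<Rightarrow> complex) set" for N where
  const: "(\<lambda>_. c) \<in> polynomial_functions N"
| entry: "i < N \<Longrightarrow> j < N \<Longrightarrow> (\<lambda>g. g $$ (i, j)) \<in> polynomial_functions N"
| add: "p \<in> polynomial_functions N \<Longrightarrow> q \<in> polynomial_functions N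
    \<Longrightarrow> (\<lambda>g. p g + q g) \<in> polynomial_functions N"
| mult: "p \<in> polynomial_functions N \<Longrightarrow> q \<in> polynomial_functions N
    \<Longrightarrow> (\<lambda>g. p g * q g) \<in> polynomial_functions N"

text \<open>Rational representations: the matrix coefficients are regular functions on the group.  All
  groups considered consist of matrices of determinant 1, so regular functions are restrictions
  of polynomials in the matrix entries.\<close>

definition is_rep :: "classical_type \<Rightarrow> nat \<Rightarrow> rep \<Rightarrow> bool" where
  "is_rep t n = (\<lambda>(d, \<rho>).
     (\<forall>g \<in> classical_group t n. \<rho> g \<in> carrier_mat d d) \<and>
     \<rho> (1\<^sub>m (matrix_size t n)) = 1\<^sub>m d \<and>
     (\<forall>g \<in> classical_group t n. \<forall>h \<in> classical_group t n. \<rho> (g * h) = \<rho> g * \<rho> h) \<and>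
     (\<forall>i < d. \<forall>j < d. \<exists>p \<in> polynomial_functions (matrix_size t n).
        \<forall>g \<in> classical_group t n. \<rho> g $$ (i, j) = p g))"

definition irreducible_rep :: "classical_type \<Rightarrow> nat \<Rightarrow> rep \<Rightarrow> bool" where
  "irreducible_rep t n = (\<lambda>(d, \<rho>).
     is_rep t n (d, \<rho>) \<and> d > 0 \<and>
     (\<forall>S. VectorSpace.subspace class_ring S (module_vec TYPE(complex) d) \<and>
          (\<forall>g \<in> classical_group t n. \<forall>v \<in> S. \<rho> g *\<^sub>v v \<in> S)
        \<longrightarrow> S = {0\<^sub>v d} \<or> S = carrier_vec d))"

definition intertwiner :: "classical_type \<Rightarrow> nat \<Rightarrow> rep \<Rightarrow> rep \<Rightarrow> complex mat \<Rightarrow> bool" where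
  "intertwiner t n U W A \<longleftrightarrow> A \<in> carrier_mat (fst W) (fst U) \<and>
     (\<forall>g \<in> classical_group t n. A * snd U g = snd W g * A)"

definition rep_iso :: "classical_type \<Rightarrow> nat \<Rightarrow> rep \<Rightarrow> rep \<Rightarrow> bool" where
  "rep_iso t n U W \<longleftrightarrow> (\<exists>A. intertwiner t n U W A \<and>
     bij_betw (\<lambda>v. A *\<^sub>v v) (carrier_vec (fst U)) (carrier_vec (fst W)))"

definition rep_embeds :: "classical_type \<Rightarrow> nat \<Rightarrow> rep \<Rightarrow> rep \<Rightarrow> bool" where
  "rep_embeds t n U W \<longleftrightarrow> (\<exists>A. intertwiner t n U W A \<and>
     inj_on (\<lambda>v. A *\<^sub>v v) (carrier_vec (fst U)))"

definition trivial_rep :: rep where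
  "trivial_rep = (1, \<lambda>_. 1\<^sub>m 1)"

definition direct_sum :: "rep list \<Rightarrow> rep" where
  "direct_sum Us = (sum_list (map fst Us), \<lambda>g. diag_block_mat (map (\<lambda>U. snd U g) Us))"

text \<open>The multiplicity of an irreducible \<open>U\<close> in a (completely reducible) \<open>W\<close>: the largest number of
  copies of \<open>U\<close> whose direct sum is a subrepresentation of \<open>W\<close>.\<close>

definition multiplicity_in :: "classical_type \<Rightarrow> nat \<Rightarrow> rep \<Rightarrow> rep \<Rightarrow> nat" where
  "multiplicity_in t n U W = Max {m. rep_embeds t n (direct_sum (replicate m U)) W}"

definition appears_in :: "classical_type \<Rightarrow> nat \<Rightarrow> rep \<Rightarrow> rep \<Rightarrow> bool" where
  "appears_in t n U W \<longleftrightarrow> multiplicity_in t n U W \<noteq> 0"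

section \<open>Weights\<close>

text \<open>Weights are given by their coordinates \<open>1, \<dots>, n\<close> with respect to the usual orthonormal basis
  \<open>\<epsilon>\<^sub>1, \<dots>, \<epsilon>\<^sub>n\<close>, where \<open>\<epsilon>\<^sub>i\<close> is the \<open>i\<close>-th coordinate of the torus.  They are rational because of
  the spin weights.  Values outside \<open>1, \<dots>, n\<close> are irrelevant.\<close>

type_synonym weight = "nat \<Rightarrow> rat"

definition epsilon :: "nat \<Rightarrow> weight" where
  "epsilon i = (\<lambda>j. if j = i then 1 else 0)"

definition simple_root :: "classical_type \<Rightarrow> nat \<Rightarrow> nat \<Rightarrow> weight" where
  "simple_root t n k = (\<lambda>j.
     if k < n then epsilon k j - epsilon (k + 1) j
     else case t of
       Sp \<Rightarrow> 2 * epsilon n j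
     | SO_odd \<Rightarrow> epsilon n j
     | SO_even \<Rightarrow> epsilon (n - 1) j + epsilon n j)"

definition fundamental_weight :: "classical_type \<Rightarrow> nat \<Rightarrow> nat \<Rightarrow> weight" where
  "fundamental_weight t n k = (\<lambda>j.
     if t = SO_odd \<and> k = n \<or> t = SO_even \<and> k = n then 1 / 2
     else if t = SO_even \<and> k = n - 1 then (if j = n then - 1 / 2 else 1 / 2)
     else if j \<le> k then 1 else 0)"

text \<open>The coefficient of the \<open>k\<close>-th fundamental weight is \<open>\<mu>\<^sub>k - \<mu>\<^sub>k\<^sub>+\<^sub>1\<close>.\<close>

definition partition_weight :: "classical_type \<Rightarrow> nat \<Rightarrow> partition \<Rightarrow> weight" where
  "partition_weight t n \<mu> = (\<lambda>j. \<Sum>k = 1..n.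
     (of_nat (part \<mu> (k - 1)) - of_nat (part \<mu> k)) * fundamental_weight t n k j)"

definition has_weight :: "classical_type \<Rightarrow> nat \<Rightarrow> rep \<Rightarrow> weight \<Rightarrow> bool" where
  "has_weight t n U x \<longleftrightarrow> (\<exists>(a :: nat \<Rightarrow> int) v.
     (\<forall>j \<in> {1..n}. x j = of_int (a j)) \<and> v \<in> carrier_vec (fst U) \<and> v \<noteq> 0\<^sub>v (fst U) \<and>
     (\<forall>z. (\<forall>j \<in> {1..n}. z j \<noteq> 0) \<longrightarrow>
        snd U (torus_element t n z) *\<^sub>v v = (\<Prod>j = 1..n. z j powi a j) \<cdot>\<^sub>v v))"

text \<open>\<open>x\<close> is a weight, and every weight is obtained from \<open>x\<close> by subtracting a nonnegative integer
  combination of simple roots.\<close>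

definition highest_weight :: "classical_type \<Rightarrow> nat \<Rightarrow> rep \<Rightarrow> weight \<Rightarrow> bool" where
  "highest_weight t n U x \<longleftrightarrow> has_weight t n U x \<and>
     (\<forall>y. has_weight t n U y \<longrightarrow> (\<exists>c :: nat \<Rightarrow> nat. \<forall>j \<in> {1..n}.
        x j - y j = (\<Sum>k = 1..n. of_nat (c k) * simple_root t n k j)))"

text \<open>The partitions \<open>\<mu>\<close> that define a (dominant) weight of the rank \<open>n\<close> group itself rather than
  of the spin group, i.e. for which \<open>V\<^sub>G(\<mu>)\<close> makes sense.\<close>

definition group_weight :: "classical_type \<Rightarrow> nat \<Rightarrow> partition \<Rightarrow> bool" where
  "group_weight t n \<mu> \<longleftrightarrow> num_parts \<mu> \<le> n \<and> (\<forall>j \<in> {1..n}. partition_weight t n \<mu> j \<in> \<int>)"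

text \<open>\<open>V\<close> is a choice, for each such \<open>\<mu>\<close>, of the irreducible representation with highest weight
  \<open>\<mu>\<close> (which is unique up to isomorphism).  The last clause is the standard identification of
  \<open>V\<^sub>G(0)\<close> with the trivial representation \<open>\<complex>\<close>.\<close>

definition irrep_family :: "classical_type \<Rightarrow> nat \<Rightarrow> (partition \<Rightarrow> rep) \<Rightarrow> bool" where
  "irrep_family t n V \<longleftrightarrow>
     (\<forall>\<mu>. group_weight t n \<mu> \<longrightarrow>
        irreducible_rep t n (V \<mu>) \<and> highest_weight t n (V \<mu>) (partition_weight t n \<mu>)) \<and>
     rep_iso t n (V empty_partition) trivial_rep"

text \<open>\<open>c\<close> are the coefficients of \<open>x\<close> in the simple roots (which form a basis).\<close>

definition root_coefficients :: "classical_type \<Rightarrow> nat \<Rightarrow> weight \<Rightarrow> (nat \<Rightarrow> rat) \<Rightarrow> bool" where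
  "root_coefficients t n x c \<longleftrightarrow> (\<forall>j \<in> {1..n}. x j = (\<Sum>k = 1..n. c k * simple_root t n k j))"

section \<open>The representations \<open>W\<^sub>G(\<lambda>)\<close>\<close>

text \<open>The coefficient of \<open>V\<^sub>G(\<mu>)\<close>.  Only finitely many terms are nonzero.\<close>

definition W_coefficient :: "classical_type \<Rightarrow> partition \<Rightarrow> partition \<Rightarrow> int" where
  "W_coefficient t lam \<mu> = Sum_any (\<lambda>\<nu>.
     if (if t = Sp then even_rows \<nu> else even_columns \<nu>) then lr_number lam \<mu> \<nu> else 0)"

text \<open>The list of summands contains each \<open>\<mu>\<close> with its coefficient; its order only affects the
  direct sum up to isomorphism.\<close>

definition is_W :: "classical_type \<Rightarrow> (partition \<Rightarrow> rep) \<Rightarrow> partition \<Rightarrow> rep \<Rightarrow> bool" where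
  "is_W t V lam W \<longleftrightarrow> (\<exists>ps. (\<forall>\<mu>. int (count_list ps \<mu>) = W_coefficient t lam \<mu>) \<and>
     W = direct_sum (map V ps))"

end

theory Submission
  imports Defs
begin

text \<open>Let \<open>e\<^sub>j\<close> denote the elementary symmetric function.  By the Pieri rule,
  \<open>e\<^sub>j s\<^sub>\<mu>\<close> is a sum of \<open>s\<^sub>\<nu>\<close> with \<open>\<mu> \<subseteq> \<nu>\<close>, so the span of the \<open>s\<^sub>\<kappa>\<close> with
  \<open>\<mu> \<subseteq> \<kappa>\<close> is stable under multiplication by every \<open>e\<^sub>j\<close>.  Removing the last column of \<open>\<nu>\<close>
  expresses \<open>s\<^sub>\<nu>\<close> through products \<open>e\<^sub>j s\<^sub>\<kappa>\<close> and smaller Schur functions, so this span is stable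
  under every \<open>s\<^sub>\<nu>\<close> as well, and linear independence of Schur functions shows that a nonzero
  Littlewood--Richardson number forces \<open>\<mu> \<subseteq> \<lambda>\<close>.  The Pieri rule itself is proved by induction on the
  number of variables: peeling off the last variable removes a horizontal strip from a tableau, and
  the induction step reduces to exchanging a horizontal with a vertical strip.

  For the representations, a nonzero equivariant map between two irreducible representations is
  bijective and identifies the highest weights, which determine the partitions in the given range.
  Hence only the listed summands appear, and the invariant vectors of the direct sum live in the
  trivial summands, of which there is exactly one or none because \<open>s\<^sub>0 = 1\<close>.\<close>

section \<open>Partitions\<close>

text \<open>Containment only concerns which coefficients can be nonzero, which is why a stable span
  is the right object rather than a formula for the coefficients. The delicate point is the descent:
  if \<kappa> is \<nu> without its last column, of height k, then e_k s_\<kappa> also contains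
  shapes of the same size as \<nu>, so size alone does not decrease. Those shapes have a shorter
  first row, or as long a first row attained by fewer rows, and this supplies a lexicographic order.
  Since \<open>lr_number\<close> is a definite description, an expansion and its uniqueness both
  come before any statement about it; uniqueness is the triangularity of Kostka numbers for
  dominance. Multiplicity is a maximum over embeddings, and comparing dimensions keeps it finite.
  \<open>V\<close> is prescribed also for partitions with up to n parts, whose orthogonal weights
  involve spin weights; the bound on \<open>lam\<close> keeps the summands away from the spin nodes,
  and one coordinate shows that no other partition shares the weight of a summand. The claim on
  simple roots rests on one functional: the sum of coordinates vanishes on every simple root but the
  last and turns partitions into their sizes.\<close>

lemma part_antimono: "i \<le> j \<Longrightarrow> part \<mu> j \<le> part \<mu> i"
  using part[of \<mu>] by (auto simp: antimono_def)

lemma finite_part: "finite {i. part \<mu> i \<noteq> 0}"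
  using part[of \<mu>] by auto

lemma partition_eqI: "(\<And>i. part \<mu> i = part \<nu> i) \<Longrightarrow> \<mu> = \<nu>"
  by (metis ext part_inject)

lemma part_Abs:
  assumes "\<And>i. f (Suc i) \<le> f i" "finite {i. f i \<noteq> 0}"
  shows "part (Abs_partition f) = f"
  using assms by (intro Abs_partition_inverse) (auto simp: antimono_iff_le_Suc)

lemma part_empty [simp]: "part empty_partition i = 0"
  unfolding empty_partition_def by (subst part_Abs) auto

lemma mem_diagram: "(i, j) \<in> diagram \<mu> \<longleftrightarrow> j < part \<mu> i"
  by (simp add: diagram_def)

lemma diagram_subset_iff: "diagram \<mu> \<subseteq> diagram \<nu> \<longleftrightarrow> (\<forall>i. part \<mu> i \<le> part \<nu> i)"
proof
  assume sub: "diagram \<mu> \<subseteq> diagram \<nu>"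
  show "\<forall>i. part \<mu> i \<le> part \<nu> i"
  proof (rule allI, rule ccontr)
    fix i assume "\<not> part \<mu> i \<le> part \<nu> i"
    then have "(i, part \<nu> i) \<in> diagram \<mu>" by (simp add: mem_diagram)
    with sub have "(i, part \<nu> i) \<in> diagram \<nu>" by blast
    then show False by (simp add: mem_diagram)
  qed
next
  assume "\<forall>i. part \<mu> i \<le> part \<nu> i"
  then show "diagram \<mu> \<subseteq> diagram \<nu>" unfolding diagram_def using less_le_trans by blast
qed

lemma diagram_eq_Sigma: "diagram \<mu> = (SIGMA i:{i. part \<mu> i \<noteq> 0}. {..<part \<mu> i})"
  by (auto simp: diagram_def)

lemma finite_diagram [simp]: "finite (diagram \<mu>)"
  unfolding diagram_eq_Sigma using finite_part by auto

lemma partition_size_eq_card: "partition_size \<mu> = card (diagram \<mu>)"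
  unfolding diagram_eq_Sigma partition_size_def Sum_any.expand_set
  using finite_part by (subst card_SigmaI) auto

lemma partition_size_eq_sum:
  assumes "\<And>i. i \<ge> N \<Longrightarrow> part \<mu> i = 0"
  shows "partition_size \<mu> = (\<Sum>i<N. part \<mu> i)"
  unfolding partition_size_def
proof (rule Sum_any.expand_superset)
  show "{i. part \<mu> i \<noteq> 0} \<subseteq> {..<N}" using assms by (metis (mono_tags) lessThan_iff linorder_not_le mem_Collect_eq subsetI)
qed simp

text \<open>The nonzero rows form an initial segment of the indices, so their number is at most N
  exactly when row N, counted from 0, is already empty.\<close>

lemma num_parts_le_iff: "num_parts \<mu> \<le> N \<longleftrightarrow> part \<mu> N = 0"
proof -
  define S where "S = {i. part \<mu> i \<noteq> 0}"
  have fin: "finite S" unfolding S_def by (rule finite_part)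
  have down: "i \<in> S" if "j \<in> S" "i \<le> j" for i j
    using that part_antimono[of i j \<mu>] by (auto simp: S_def)
  show ?thesis
  proof
    assume "num_parts \<mu> \<le> N"
    then have "card S \<le> N" by (simp add: num_parts_def S_def)
    show "part \<mu> N = 0"
    proof (rule ccontr)
      assume "part \<mu> N \<noteq> 0"
      then have "{..N} \<subseteq> S" using down[of N] by (auto simp: S_def)
      from card_mono[OF fin this] \<open>card S \<le> N\<close> show False by simp
    qed
  next
    assume "part \<mu> N = 0"
    then have "S \<subseteq> {..<N}" using down[of _ N] by (auto simp: S_def intro: leI)
    from card_mono[OF _ this] show "num_parts \<mu> \<le> N" by (simp add: num_parts_def S_def)
  qed
qed

lemma part_eq_0: "num_parts \<mu> \<le> i \<Longrightarrow> part \<mu> i = 0"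
  by (simp add: num_parts_le_iff)

lemma partition_size_mono: "diagram \<mu> \<subseteq> diagram \<nu> \<Longrightarrow> partition_size \<mu> \<le> partition_size \<nu>"
  unfolding partition_size_eq_card by (intro card_mono) auto

lemma diagram_inject: "diagram \<mu> = diagram \<nu> \<Longrightarrow> \<mu> = \<nu>"
  by (rule partition_eqI) (metis diagram_subset_iff order_antisym order_refl)

lemma partition_size_strict_mono:
  "diagram \<mu> \<subseteq> diagram \<nu> \<Longrightarrow> \<mu> \<noteq> \<nu> \<Longrightarrow> partition_size \<mu> < partition_size \<nu>"
  unfolding partition_size_eq_card using diagram_inject by (intro psubset_card_mono) auto

lemma partition_size_eq_0_iff: "partition_size \<mu> = 0 \<longleftrightarrow> \<mu> = empty_partition"
proof -
  have "diagram empty_partition = {}" by (auto simp: diagram_def)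
  then show ?thesis
    unfolding partition_size_eq_card by (metis card_0_eq card.empty diagram_inject finite_diagram)
qed

text \<open>A box in row i and column j forces i + 1 boxes in column 0 and j + 1 boxes in row i, so
  all diagrams with at most B boxes lie in a B by B square. The sums over shapes below rely on this:
  over an infinite set they would default to 0.\<close>

lemma finite_partitions_size_le: "finite {\<mu>. partition_size \<mu> \<le> B}"
proof (rule inj_on_finite[of diagram])
  show "inj_on diagram {\<mu>. partition_size \<mu> \<le> B}"
    using diagram_inject by (auto intro: inj_onI)
  have bnd: "i < B \<and> j < B" if "partition_size \<mu> \<le> B" "j < part \<mu> i" for i j \<mu>
  proof -
    have "(\<lambda>i'. (i', 0)) ` {..i} \<union> (\<lambda>j'. (i, j')) ` {..j} \<subseteq> diagram \<mu>"
      using that part_antimono[of _ i \<mu>] by (force simp: diagram_def)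
    then have sub: "(\<lambda>i'. (i', 0)) ` {..i} \<subseteq> diagram \<mu>" "(\<lambda>j'. (i, j')) ` {..j} \<subseteq> diagram \<mu>"
      by auto
    from card_mono[OF finite_diagram sub(1)] card_mono[OF finite_diagram sub(2)]
    show ?thesis using that unfolding partition_size_eq_card
      by (auto simp: card_image inj_on_def)
  qed
  show "diagram ` {\<mu>. partition_size \<mu> \<le> B} \<subseteq> Pow ({..<B} \<times> {..<B})"
    using bnd unfolding diagram_def by blast
qed simp

section \<open>Kostka numbers\<close>

text \<open>The content is an arbitrary function rather than a finitely supported map, so that
  deleting a variable by \<open>f(n := 0)\<close> and lowering exponents pointwise stay plain
  operations on functions.\<close>

definition tableaux :: "partition \<Rightarrow> (nat \<Rightarrow> nat) \<Rightarrow> (nat \<times> nat \<Rightarrow> nat) set" where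
  "tableaux \<mu> f = {T \<in> ssyt \<mu>. \<forall>k. card {b \<in> diagram \<mu>. T b = k} = f k}"

definition kostka :: "partition \<Rightarrow> (nat \<Rightarrow> nat) \<Rightarrow> nat" where
  "kostka \<mu> f = card (tableaux \<mu> f)"

lemma schur_eq_kostka: "schur \<mu> m = int (kostka \<mu> (Poly_Mapping.lookup m))"
  by (simp add: schur_def kostka_def tableaux_def)

lemma tableaux_content:
  assumes "T \<in> tableaux \<mu> f" "b \<in> diagram \<mu>"
  shows "f (T b) \<noteq> 0"
proof
  assume "f (T b) = 0"
  with assms(1) have "card {c \<in> diagram \<mu>. T c = T b} = 0" by (auto simp: tableaux_def)
  then have "{c \<in> diagram \<mu>. T c = T b} = {}" using finite_diagram[of \<mu>] by simp
  then show False using assms(2) by blast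
qed

lemma tableaux_bound:
  assumes "T \<in> tableaux \<mu> f" "\<And>k. k \<ge> n \<Longrightarrow> f k = 0" "b \<in> diagram \<mu>"
  shows "T b < n"
  using tableaux_content[OF assms(1,3)] assms(2)[of "T b"] by (metis leI)

lemma finite_tableaux:
  assumes "finite {k. f k \<noteq> 0}"
  shows "finite (tableaux \<mu> f)"
proof (rule finite_subset)
  show "tableaux \<mu> f \<subseteq> PiE (diagram \<mu>) (\<lambda>_. {k. f k \<noteq> 0})"
  proof
    fix T assume T: "T \<in> tableaux \<mu> f"
    then have "T \<in> extensional (diagram \<mu>)" by (simp add: tableaux_def ssyt_def)
    then show "T \<in> PiE (diagram \<mu>) (\<lambda>_. {k. f k \<noteq> 0})"
      using tableaux_content[OF T] by (simp add: PiE_def Pi_def)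
  qed
  show "finite (PiE (diagram \<mu>) (\<lambda>_. {k. f k \<noteq> 0}))"
    using assms by (intro finite_PiE) auto
qed

text \<open>Smaller shape first. The second inequality places every new box of row i + 1 under a box
  of the smaller shape, so no column receives two new boxes.\<close>

definition hstrip :: "partition \<Rightarrow> partition \<Rightarrow> bool" where
  "hstrip \<rho> \<mu> \<longleftrightarrow> (\<forall>i. part \<rho> i \<le> part \<mu> i \<and> part \<mu> (Suc i) \<le> part \<rho> i)"

definition vstrip :: "partition \<Rightarrow> partition \<Rightarrow> bool" where
  "vstrip \<rho> \<mu> \<longleftrightarrow> (\<forall>i. part \<rho> i \<le> part \<mu> i \<and> part \<mu> i \<le> Suc (part \<rho> i))"

lemma hstrip_subset: "hstrip \<rho> \<mu> \<Longrightarrow> diagram \<rho> \<subseteq> diagram \<mu>"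
  by (simp add: hstrip_def diagram_subset_iff)

lemma vstrip_subset: "vstrip \<rho> \<mu> \<Longrightarrow> diagram \<rho> \<subseteq> diagram \<mu>"
  by (simp add: vstrip_def diagram_subset_iff)

lemma lessThan_card_downclosed:
  fixes S :: "nat set"
  assumes "finite S" "\<And>i j. j \<in> S \<Longrightarrow> i \<le> j \<Longrightarrow> i \<in> S"
  shows "S = {..<card S}"
proof (cases "S = {}")
  case False
  then have "S = {..Max S}"
    using assms(2)[OF Max_in[OF assms(1) False]] Max_ge[OF assms(1)] by blast
  then have "card S = Suc (Max S)" by (metis card_atMost)
  with \<open>S = {..Max S}\<close> show ?thesis by (simp add: lessThan_Suc_atMost)
qed auto

text \<open>Inverse of deleting the entries n. The value \<open>undefined\<close> off the larger
  diagram keeps the result extensional, as \<open>ssyt\<close> demands.\<close>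

definition extend_tableau :: "nat \<Rightarrow> partition \<Rightarrow> partition \<times> (nat \<times> nat \<Rightarrow> nat) \<Rightarrow> nat \<times> nat \<Rightarrow> nat" where
  "extend_tableau n \<mu> = (\<lambda>(\<rho>, T) b. if b \<in> diagram \<rho> then T b else if b \<in> diagram \<mu> then n else undefined)"

text \<open>The entries n occupy a horizontal strip: columns increase strictly, so each contains n
  at most once, and rows increase weakly, so these entries stand at row ends.\<close>

lemma tableaux_peel:
  fixes \<mu> :: partition and f :: "nat \<Rightarrow> nat"
  assumes f: "\<And>k. k > n \<Longrightarrow> f k = 0"
  defines "X \<equiv> {\<rho>. hstrip \<rho> \<mu> \<and> partition_size \<mu> = partition_size \<rho> + f n}"
  shows "extend_tableau n \<mu> ` (SIGMA \<rho>:X. tableaux \<rho> (f(n := 0))) = tableaux \<mu> f"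
proof (intro equalityI subsetI)
  fix T assume "T \<in> extend_tableau n \<mu> ` (SIGMA \<rho>:X. tableaux \<rho> (f(n := 0)))"
  then obtain \<rho> T' where T: "T = extend_tableau n \<mu> (\<rho>, T')" and \<rho>: "\<rho> \<in> X"
    and T': "T' \<in> tableaux \<rho> (f(n := 0))" by auto
  have hs: "hstrip \<rho> \<mu>" and sz: "partition_size \<mu> = partition_size \<rho> + f n"
    using \<rho> by (auto simp: X_def)
  note sub = hstrip_subset[OF hs]
  have lt: "T' b < n" if "b \<in> diagram \<rho>" for b
    using tableaux_bound[OF T' _ that] f by simp
  have le: "T b \<le> n" if "b \<in> diagram \<mu>" for b
    using that lt[of b] by (auto simp: T extend_tableau_def)
  have in_\<rho>: "T b = T' b" if "b \<in> diagram \<rho>" for b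
    using that by (simp add: T extend_tableau_def)
  have out: "T b = n" if "b \<in> diagram \<mu>" "b \<notin> diagram \<rho>" for b
    using that by (simp add: T extend_tableau_def)
  have row: "T (i, j) \<le> T (i, j')" if "j < j'" "(i, j') \<in> diagram \<mu>" for i j j'
  proof (cases "(i, j') \<in> diagram \<rho>")
    case True
    then have "(i, j) \<in> diagram \<rho>" using that by (simp add: mem_diagram)
    then show ?thesis using T' True that(1) by (simp add: in_\<rho> tableaux_def ssyt_def)
  next
    case False
    moreover have "(i, j) \<in> diagram \<mu>" using that by (simp add: mem_diagram)
    ultimately show ?thesis using out[OF that(2)] le by simp
  qed
  \<comment> \<open>By interlacing the upper box lies in the smaller shape, so its entry is less
    than n even when the lower box carries n.\<close>
  have col: "T (i, j) < T (i', j)" if "i < i'" "(i', j) \<in> diagram \<mu>" for i i' j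
  proof -
    have "part \<mu> i' \<le> part \<mu> (Suc i)" using that(1) by (intro part_antimono) auto
    also have "\<dots> \<le> part \<rho> i" using hs by (simp add: hstrip_def)
    finally have ij: "(i, j) \<in> diagram \<rho>" using that by (simp add: mem_diagram)
    show ?thesis
    proof (cases "(i', j) \<in> diagram \<rho>")
      case True
      then show ?thesis using T' that(1) by (simp add: ij in_\<rho> tableaux_def ssyt_def)
    next
      case False
      then show ?thesis using out[OF that(2)] lt[OF ij] in_\<rho>[OF ij] by simp
    qed
  qed
  have cont: "card {b \<in> diagram \<mu>. T b = k} = f k" for k
  proof (cases "k = n")
    case True
    have "{b \<in> diagram \<mu>. T b = n} = diagram \<mu> - diagram \<rho>"
      using out in_\<rho> lt by fastforce
    then show ?thesis using sz sub True
      by (simp add: card_Diff_subset finite_subset[OF sub] partition_size_eq_card)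
  next
    case False
    have "{b \<in> diagram \<mu>. T b = k} = {b \<in> diagram \<rho>. T' b = k}"
      using out in_\<rho> sub False by (intro Collect_cong) (metis subsetD)
    then show ?thesis using T' False by (simp add: tableaux_def)
  qed
  have "T \<in> extensional (diagram \<mu>)"
    using sub by (auto simp: extensional_def T extend_tableau_def)
  then show "T \<in> tableaux \<mu> f"
    using row col cont by (simp add: tableaux_def ssyt_def)
next
  fix T assume T: "T \<in> tableaux \<mu> f"
  have row: "j < j' \<Longrightarrow> j' < part \<mu> i \<Longrightarrow> T (i, j) \<le> T (i, j')"
    and col: "i < i' \<Longrightarrow> j < part \<mu> i' \<Longrightarrow> T (i, j) < T (i', j)" for i i' j j'
    using T by (auto simp: tableaux_def ssyt_def mem_diagram)
  have cont: "card {b \<in> diagram \<mu>. T b = k} = f k" for k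
    using T by (auto simp: tableaux_def)
  have le: "T (i, j) \<le> n" if "j < part \<mu> i" for i j
    using tableaux_bound[OF T, of "Suc n" "(i, j)"] f that by (simp add: mem_diagram)
  \<comment> \<open>The smaller shape consists of the boxes with entries below n; weakly increasing
    rows make each \<open>S i\<close> an initial segment, so its cardinality is a row
    length.\<close>
  define S where "S i = {j. j < part \<mu> i \<and> T (i, j) < n}" for i
  define r where "r i = card (S i)" for i
  have S: "S i = {..<r i}" for i
    unfolding r_def
  proof (rule lessThan_card_downclosed)
    show "finite (S i)" by (auto simp: S_def)
    show "j \<in> S i" if "j' \<in> S i" "j \<le> j'" for j j'
      using that row[of j j' i] by (cases "j = j'") (auto simp: S_def)
  qed
  have r_iff: "j < r i \<longleftrightarrow> j < part \<mu> i \<and> T (i, j) < n" for i j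
    using S[of i] by (auto simp: S_def)
  have r_le: "r i \<le> part \<mu> i" for i
    using r_iff[of "part \<mu> i" i] by auto
  \<comment> \<open>Otherwise the box below \<open>(i, r i)\<close> exists and holds an entry at
    most n, so \<open>(i, r i)\<close> holds one less than n, against the choice of
    \<open>r i\<close>.\<close>
  have r_ge: "part \<mu> (Suc i) \<le> r i" for i
  proof (rule ccontr)
    assume "\<not> part \<mu> (Suc i) \<le> r i"
    then have j: "r i < part \<mu> (Suc i)" by simp
    then have "T (i, r i) < n" using col[of i "Suc i" "r i"] le[of "r i" "Suc i"] by simp
    moreover have "r i < part \<mu> i" using j part_antimono[of i "Suc i" \<mu>] by simp
    ultimately show False using r_iff[of "r i" i] by simp
  qed
  define \<rho> where "\<rho> = Abs_partition r"
  have part_\<rho>: "part \<rho> i = r i" for i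
    unfolding \<rho>_def
  proof (subst part_Abs)
    show "r (Suc i) \<le> r i" for i using r_le[of "Suc i"] r_ge[of i] by simp
    show "finite {i. r i \<noteq> 0}"
    proof (rule finite_subset[OF subsetI finite_part[of \<mu>]])
      show "i \<in> {i. part \<mu> i \<noteq> 0}" if "i \<in> {i. r i \<noteq> 0}" for i
        using that r_le[of i] by simp
    qed
  qed simp
  have hs: "hstrip \<rho> \<mu>" using r_le r_ge by (simp add: hstrip_def part_\<rho>)
  note sub = hstrip_subset[OF hs]
  have mem_\<rho>: "(i, j) \<in> diagram \<rho> \<longleftrightarrow> (i, j) \<in> diagram \<mu> \<and> T (i, j) < n" for i j
    by (simp add: mem_diagram part_\<rho> r_iff)
  have "{b \<in> diagram \<mu>. T b = n} = diagram \<mu> - diagram \<rho>"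
    using mem_\<rho> le by (force simp: mem_diagram)
  then have "f n = card (diagram \<mu> - diagram \<rho>)" using cont[of n] by simp
  then have sz: "partition_size \<mu> = partition_size \<rho> + f n"
    using sub card_mono[OF finite_diagram sub]
    by (simp add: card_Diff_subset finite_subset[OF sub] partition_size_eq_card)
  define T' where "T' = restrict T (diagram \<rho>)"
  have "T' \<in> tableaux \<rho> (f(n := 0))"
  proof -
    have "card {b \<in> diagram \<rho>. T' b = k} = (f(n := 0)) k" for k
    proof (cases "k < n")
      case True
      then have "{b \<in> diagram \<rho>. T' b = k} = {b \<in> diagram \<mu>. T b = k}"
        using mem_\<rho> by (auto simp: T'_def)
      then show ?thesis using cont True by simp
    next
      case False
      then have "{b \<in> diagram \<rho>. T' b = k} = {}"
        using mem_\<rho> by (auto simp: T'_def)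
      then show ?thesis using f False by (metis card.empty fun_upd_apply linorder_neqE_nat)
    qed
    moreover have "T' \<in> ssyt \<rho>"
    proof -
      have "T' (i, j) \<le> T' (i, j')" if "j < j'" "(i, j') \<in> diagram \<rho>" for i j j'
        using that row[of j j' i] sub by (auto simp: T'_def mem_diagram) (use mem_\<rho> mem_diagram in auto)
      moreover have "T' (i, j) < T' (i', j)" if "i < i'" "(i', j) \<in> diagram \<rho>" for i i' j
      proof -
        have "(i, j) \<in> diagram \<rho>"
          using that part_antimono[of i i' \<rho>] by (auto simp: mem_diagram)
        then show ?thesis using that col[of i i' j] sub by (auto simp: T'_def) (use mem_\<rho> mem_diagram in auto)
      qed
      ultimately show ?thesis by (auto simp: ssyt_def T'_def)
    qed
    ultimately show ?thesis by (simp add: tableaux_def)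
  qed
  moreover have "T = extend_tableau n \<mu> (\<rho>, T')"
  proof
    fix b
    have "T \<in> extensional (diagram \<mu>)" using T by (auto simp: tableaux_def ssyt_def)
    then show "T b = extend_tableau n \<mu> (\<rho>, T') b"
      using mem_\<rho> le by (cases b) (force simp: extend_tableau_def T'_def extensional_def mem_diagram)
  qed
  ultimately show "T \<in> extend_tableau n \<mu> ` (SIGMA \<rho>:X. tableaux \<rho> (f(n := 0)))"
    using hs sz by (auto simp: X_def)
qed

text \<open>The smaller shape can be read off the filled diagram as the boxes with entry less than
  n, and the smaller tableau is then a restriction.\<close>

lemma inj_on_extend_tableau:
  fixes \<mu> :: partition and f :: "nat \<Rightarrow> nat"
  assumes f: "\<And>k. k > n \<Longrightarrow> f k = 0"
  defines "X \<equiv> {\<rho>. hstrip \<rho> \<mu> \<and> partition_size \<mu> = partition_size \<rho> + f n}"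
  shows "inj_on (extend_tableau n \<mu>) (SIGMA \<rho>:X. tableaux \<rho> (f(n := 0)))"
proof -
  have diag: "diagram \<rho> = {b \<in> diagram \<mu>. extend_tableau n \<mu> (\<rho>, T) b < n}"
    if "\<rho> \<in> X" "T \<in> tableaux \<rho> (f(n := 0))" for \<rho> T
  proof -
    have "T b < n" if "b \<in> diagram \<rho>" for b
      using tableaux_bound[OF \<open>T \<in> _\<close> _ that] f by simp
    moreover have "diagram \<rho> \<subseteq> diagram \<mu>" using that hstrip_subset by (auto simp: X_def)
    ultimately show ?thesis by (auto simp: extend_tableau_def)
  qed
  show ?thesis
  proof (rule inj_onI, clarify)
    fix \<rho> T \<rho>' T'
    assume *: "\<rho> \<in> X" "T \<in> tableaux \<rho> (f(n := 0))" "\<rho>' \<in> X" "T' \<in> tableaux \<rho>' (f(n := 0))"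
      and eq: "extend_tableau n \<mu> (\<rho>, T) = extend_tableau n \<mu> (\<rho>', T')"
    have "diagram \<rho> = diagram \<rho>'" using diag[OF *(1,2)] diag[OF *(3,4)] eq by simp
    then have \<rho>: "\<rho> = \<rho>'" by (rule diagram_inject)
    have "T b = T' b" for b
    proof (cases "b \<in> diagram \<rho>")
      case True
      then show ?thesis using fun_cong[OF eq, of b] by (simp add: extend_tableau_def \<rho>)
    next
      case False
      moreover have "T \<in> extensional (diagram \<rho>)" "T' \<in> extensional (diagram \<rho>)"
        using * \<rho> by (simp_all add: tableaux_def ssyt_def)
      ultimately show ?thesis using extensional_arb[of T _ b] extensional_arb[of T' _ b] by metis
    qed
    then show "\<rho> = \<rho>' \<and> T = T'" using \<rho> by auto
  qed
qed

text \<open>Branching rule for one variable, read coefficientwise: s_\<mu> in the variables up to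
  x_n is the sum of s_\<rho> in the earlier variables times x_n to the number of removed
  boxes.\<close>

lemma kostka_peel:
  assumes f: "\<And>k. k > n \<Longrightarrow> f k = 0"
  shows "kostka \<mu> f = (\<Sum>\<rho> | hstrip \<rho> \<mu> \<and> partition_size \<mu> = partition_size \<rho> + f n. kostka \<rho> (f(n := 0)))"
proof -
  let ?X = "{\<rho>. hstrip \<rho> \<mu> \<and> partition_size \<mu> = partition_size \<rho> + f n}"
  have fin: "finite ?X"
    by (rule finite_subset[OF _ finite_partitions_size_le[of "partition_size \<mu>"]]) auto
  have "finite {k. (f(n := 0)) k \<noteq> 0}"
    by (rule finite_subset[of _ "{..n}"]) (use f in \<open>auto intro: leI\<close>)
  then have "card (SIGMA \<rho>:?X. tableaux \<rho> (f(n := 0))) = (\<Sum>\<rho>\<in>?X. kostka \<rho> (f(n := 0)))"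
    using fin by (subst card_SigmaI) (auto simp: kostka_def intro: finite_tableaux)
  moreover have "card (tableaux \<mu> f) = card (SIGMA \<rho>:?X. tableaux \<rho> (f(n := 0)))"
    using card_image[OF inj_on_extend_tableau[of n f \<mu>]] tableaux_peel[of n f \<mu>] f by simp
  ultimately show ?thesis by (simp add: kostka_def)
qed

lemma tableaux_size:
  assumes "tableaux \<mu> f \<noteq> {}" "\<And>k. k \<ge> n \<Longrightarrow> f k = 0"
  shows "partition_size \<mu> = (\<Sum>k<n. f k)"
proof -
  obtain T where T: "T \<in> tableaux \<mu> f" using assms by auto
  have "diagram \<mu> = (\<Union>k\<in>{..<n}. {b \<in> diagram \<mu>. T b = k})"
    using tableaux_bound[OF T assms(2)] by auto
  then have "card (diagram \<mu>) = card (\<Union>k\<in>{..<n}. {b \<in> diagram \<mu>. T b = k})" by simp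
  also have "\<dots> = (\<Sum>k<n. card {b \<in> diagram \<mu>. T b = k})"
    by (rule card_UN_disjoint) auto
  finally show ?thesis using T by (simp add: tableaux_def partition_size_eq_card)
qed

lemma kostka_zero: "kostka \<mu> (\<lambda>_. 0) = (if \<mu> = empty_partition then 1 else 0)"
proof (cases "\<mu> = empty_partition")
  case True
  have "diagram \<mu> = {}" using True by (auto simp: diagram_def)
  then have "tableaux \<mu> (\<lambda>_. 0) = {\<lambda>_. undefined}"
    by (auto simp: tableaux_def ssyt_def)
  then show ?thesis using True by (simp add: kostka_def)
next
  case False
  then have "tableaux \<mu> (\<lambda>_. 0) = {}"
    using tableaux_size[of \<mu> "\<lambda>_. 0" 0] by (auto simp: partition_size_eq_0_iff)
  then show ?thesis using False by (simp add: kostka_def)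
qed

section \<open>Strips\<close>

text \<open>Removing P identifies these sets with the subsets of C - P of size j - card P; the
  conditional guards against truncated subtraction.\<close>

lemma card_subsets_between:
  assumes "finite C" "P \<subseteq> C"
  shows "card {L. P \<subseteq> L \<and> L \<subseteq> C \<and> card L = j} =
    (if card P \<le> j then (card C - card P) choose (j - card P) else 0)"
proof (cases "card P \<le> j")
  case True
  have finP: "finite P" and fin: "finite (C - P)" using assms finite_subset by auto
  have card_Un: "card (M \<union> P) = card M + card P" if "M \<subseteq> C - P" for M
    using that finP finite_subset[OF that fin] by (intro card_Un_disjoint) auto
  have "{L. P \<subseteq> L \<and> L \<subseteq> C \<and> card L = j} = (\<lambda>M. M \<union> P) ` {M. M \<subseteq> C - P \<and> card M = j - card P}"
  proof (intro equalityI subsetI)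
    fix L assume L: "L \<in> {L. P \<subseteq> L \<and> L \<subseteq> C \<and> card L = j}"
    then have "L = (L - P) \<union> P" "L - P \<subseteq> C - P" by auto
    moreover have "card (L - P) = j - card P" using L finP by (simp add: card_Diff_subset)
    ultimately show "L \<in> (\<lambda>M. M \<union> P) ` {M. M \<subseteq> C - P \<and> card M = j - card P}" by blast
  next
    fix L assume "L \<in> (\<lambda>M. M \<union> P) ` {M. M \<subseteq> C - P \<and> card M = j - card P}"
    then show "L \<in> {L. P \<subseteq> L \<and> L \<subseteq> C \<and> card L = j}"
      using card_Un True assms by auto
  qed
  moreover have "inj_on (\<lambda>M. M \<union> P) {M. M \<subseteq> C - P \<and> card M = j - card P}"
    by (rule inj_onI) blast
  ultimately have "card {L. P \<subseteq> L \<and> L \<subseteq> C \<and> card L = j} = card {M. M \<subseteq> C - P \<and> card M = j - card P}"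
    by (simp add: card_image)
  then show ?thesis
    using True n_subsets[OF fin, of "j - card P"] assms finP by (simp add: card_Diff_subset)
next
  case False
  have "{L. P \<subseteq> L \<and> L \<subseteq> C \<and> card L = j} = {}"
    using False card_mono[of _ P] finite_subset[OF _ assms(1)] by fastforce
  then show ?thesis using False by (metis card.empty)
qed

text \<open>Pascal's rule. C and C' enter the counts only through their sizes, so C' may be a
  shifted copy of C with one extra element. Writing \<open>Suc (card L) = j\<close> leaves the last
  set empty for j = 0.\<close>

lemma card_subsets_between_Suc:
  assumes "finite C" "P \<subseteq> C" "finite C'" "P \<subseteq> C'" "card C' = Suc (card C)"
  shows "card {L. P \<subseteq> L \<and> L \<subseteq> C' \<and> card L = j} =
    card {L. P \<subseteq> L \<and> L \<subseteq> C \<and> card L = j} + card {L. P \<subseteq> L \<and> L \<subseteq> C \<and> Suc (card L) = j}"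
proof (cases j)
  case 0
  then show ?thesis using assms by (simp add: card_subsets_between)
next
  case (Suc i)
  have le: "card P \<le> card C" by (intro card_mono assms)
  show ?thesis
  proof (cases "card P \<le> i")
    case True
    then show ?thesis using assms le
      by (simp add: Suc card_subsets_between Suc_diff_le)
  next
    case False
    then show ?thesis using assms le
      by (auto simp: Suc card_subsets_between)
  qed
qed

lemma card_Collect_inj_image:
  assumes "inj_on g U" "g ` U = S"
  shows "card {x \<in> U. Q (g x)} = card {y \<in> S. Q y}"
proof -
  have "{y \<in> S. Q y} = g ` {x \<in> U. Q (g x)}" using assms(2) by auto
  moreover have "inj_on g {x \<in> U. Q (g x)}" by (rule inj_on_subset[OF assms(1)]) blast
  ultimately show ?thesis by (simp add: card_image)
qed

text \<open>A vertical strip is determined by the rows it meets, which turns counts of strips into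
  counts of subsets.\<close>

definition strip_rows :: "partition \<Rightarrow> partition \<Rightarrow> nat set" where
  "strip_rows \<mu> \<nu> = {i. part \<mu> i \<noteq> part \<nu> i}"

lemma finite_strip_rows [simp]: "finite (strip_rows \<mu> \<nu>)"
  by (rule finite_subset[of _ "{i. part \<mu> i \<noteq> 0} \<union> {i. part \<nu> i \<noteq> 0}"])
    (use finite_part[of \<mu>] finite_part[of \<nu>] in \<open>auto simp: strip_rows_def\<close>)

lemma vstrip_part: "vstrip \<mu> \<nu> \<Longrightarrow> part \<nu> i = part \<mu> i + of_bool (i \<in> strip_rows \<mu> \<nu>)"
  by (auto simp: vstrip_def strip_rows_def le_Suc_eq dest: spec[of _ i])

lemma common_bound: obtains N where "\<And>i. i \<ge> N \<Longrightarrow> part \<mu> i = 0" "\<And>i. i \<ge> N \<Longrightarrow> part \<nu> i = 0"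
  using that[of "max (num_parts \<mu>) (num_parts \<nu>)"] part_eq_0 by simp

lemma vstrip_size:
  assumes "vstrip \<mu> \<nu>"
  shows "partition_size \<nu> = partition_size \<mu> + card (strip_rows \<mu> \<nu>)"
proof -
  obtain N where N: "\<And>i. i \<ge> N \<Longrightarrow> part \<mu> i = 0" "\<And>i. i \<ge> N \<Longrightarrow> part \<nu> i = 0"
    using common_bound[of \<mu> \<nu>] by blast
  have "strip_rows \<mu> \<nu> \<subseteq> {..<N}"
  proof
    fix i assume "i \<in> strip_rows \<mu> \<nu>"
    then show "i \<in> {..<N}" using N[of i] by (cases "i < N") (auto simp: strip_rows_def)
  qed
  then have "(\<Sum>i<N. of_bool (i \<in> strip_rows \<mu> \<nu>)) = card (strip_rows \<mu> \<nu>)"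
    by (simp add: of_bool_def sum.If_cases inf.absorb2)
  moreover have "(\<Sum>i<N. part \<nu> i) = (\<Sum>i<N. part \<mu> i) + (\<Sum>i<N. of_bool (i \<in> strip_rows \<mu> \<nu>))"
    by (simp only: vstrip_part[OF assms] sum.distrib)
  ultimately show ?thesis
    using N by (simp only: partition_size_eq_sum[of N])
qed

lemma inj_on_strip_rows_right: "inj_on (strip_rows \<mu>) {\<nu>. vstrip \<mu> \<nu>}"
  by (rule inj_onI, rule partition_eqI) (simp add: vstrip_part)

lemma inj_on_strip_rows_left: "inj_on (\<lambda>\<mu>. strip_rows \<mu> \<nu>) {\<mu>. vstrip \<mu> \<nu>}"
proof (rule inj_onI, rule partition_eqI)
  fix \<mu> \<mu>' i
  assume *: "\<mu> \<in> {\<mu>. vstrip \<mu> \<nu>}" "\<mu>' \<in> {\<mu>. vstrip \<mu> \<nu>}" "strip_rows \<mu> \<nu> = strip_rows \<mu>' \<nu>"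
  then have v: "vstrip \<mu> \<nu>" "vstrip \<mu>' \<nu>" by auto
  from vstrip_part[OF v(1), of i] vstrip_part[OF v(2), of i] *(3)
  show "part \<mu> i = part \<mu>' i" by simp
qed

lemma part_Abs_add_rows:
  assumes "finite L" "\<And>i. part \<mu> (Suc i) + of_bool (Suc i \<in> L) \<le> part \<mu> i + of_bool (i \<in> L)"
  shows "part (Abs_partition (\<lambda>i. part \<mu> i + of_bool (i \<in> L))) = (\<lambda>i. part \<mu> i + of_bool (i \<in> L))"
proof (rule part_Abs)
  show "finite {i. part \<mu> i + of_bool (i \<in> L) \<noteq> 0}"
    by (rule finite_subset[of _ "{i. part \<mu> i \<noteq> 0} \<union> L"]) (use assms finite_part in auto)
qed (use assms in auto)

text \<open>Both sides count choices of rows between two sets: the rows that must and those that may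
  change.  Adding a strip to \<open>\<mu>\<close> has one more row to choose from than removing one from \<open>\<kappa>\<close>,
  and Pascal's rule is the claim.\<close>

lemma card_strips_exchange:
  "card {\<nu>. vstrip \<mu> \<nu> \<and> hstrip \<kappa> \<nu> \<and> partition_size \<nu> = partition_size \<mu> + j} =
   card {\<rho>. hstrip \<rho> \<mu> \<and> vstrip \<rho> \<kappa> \<and> partition_size \<kappa> = partition_size \<rho> + j} +
   card {\<rho>. hstrip \<rho> \<mu> \<and> vstrip \<rho> \<kappa> \<and> Suc (partition_size \<kappa>) = partition_size \<rho> + j}"
\<comment> \<open>Either order of the two strips squeezes \<kappa> between these bounds, so outside
  them all three sets are empty.\<close>
proof (cases "\<forall>i. part \<mu> (Suc i) \<le> part \<kappa> i \<and> part \<kappa> i \<le> Suc (part \<mu> i)")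
  case False
  then obtain i where i: "part \<kappa> i < part \<mu> (Suc i) \<or> Suc (part \<mu> i) < part \<kappa> i"
    by (auto simp: not_le)
  have "\<not> (vstrip \<mu> \<nu> \<and> hstrip \<kappa> \<nu>)" for \<nu>
  proof
    assume "vstrip \<mu> \<nu> \<and> hstrip \<kappa> \<nu>"
    then have "part \<mu> (Suc i) \<le> part \<nu> (Suc i)" "part \<nu> (Suc i) \<le> part \<kappa> i"
      "part \<kappa> i \<le> part \<nu> i" "part \<nu> i \<le> Suc (part \<mu> i)"
      by (auto simp: vstrip_def hstrip_def)
    with i show False by linarith
  qed
  moreover have "\<not> (hstrip \<rho> \<mu> \<and> vstrip \<rho> \<kappa>)" for \<rho>
  proof
    assume "hstrip \<rho> \<mu> \<and> vstrip \<rho> \<kappa>"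
    then have "part \<mu> (Suc i) \<le> part \<rho> i" "part \<rho> i \<le> part \<kappa> i"
      "part \<kappa> i \<le> Suc (part \<rho> i)" "part \<rho> i \<le> part \<mu> i"
      by (auto simp: vstrip_def hstrip_def)
    with i show False by linarith
  qed
  ultimately have "{\<nu>. vstrip \<mu> \<nu> \<and> hstrip \<kappa> \<nu> \<and> partition_size \<nu> = partition_size \<mu> + j} = {}"
    "{\<rho>. hstrip \<rho> \<mu> \<and> vstrip \<rho> \<kappa> \<and> partition_size \<kappa> = partition_size \<rho> + j} = {}"
    "{\<rho>. hstrip \<rho> \<mu> \<and> vstrip \<rho> \<kappa> \<and> Suc (partition_size \<kappa>) = partition_size \<rho> + j} = {}"
    by blast+
  then show ?thesis by (simp only: card.empty)
next
  case True
  then have H: "part \<mu> (Suc i) \<le> part \<kappa> i" "part \<kappa> i \<le> Suc (part \<mu> i)" for i by auto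
  \<comment> \<open>Rows in P must change: \<nu> has to reach \<kappa> from \<mu>, and \<rho> has to
    drop from \<kappa> to at most \<mu>. Row i lies in C if \<kappa> can lose a box there and still
    be at least row i + 1 of \<mu>; row i + 1 lies in C' under the same inequality, because \<mu>
    can gain a box there and stay within row i of \<kappa>. Row 0 is always free, which is the extra
    element.\<close>
  define P where "P = {i. part \<mu> i < part \<kappa> i}"
  define C where "C = {i. part \<mu> (Suc i) < part \<kappa> i}"
  define C' where "C' = insert 0 (Suc ` C)"
  have finC: "finite C"
    by (rule finite_subset[OF _ finite_part[of \<kappa>]]) (auto simp: C_def)
  have PC: "P \<subseteq> C"
  proof
    fix i assume "i \<in> P"
    then show "i \<in> C" using part_antimono[of i "Suc i" \<mu>] by (simp add: P_def C_def)
  qed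
  have PC': "P \<subseteq> C'"
  proof
    fix i assume i: "i \<in> P"
    show "i \<in> C'"
    proof (cases i)
      case 0 then show ?thesis by (simp add: C'_def)
    next
      case (Suc i')
      then have "part \<mu> (Suc i') < part \<kappa> i'"
        using i part_antimono[of i' "Suc i'" \<kappa>] by (simp add: P_def)
      then show ?thesis by (simp add: C'_def C_def Suc)
    qed
  qed
  have cardC': "card C' = Suc (card C)"
    using finC by (simp add: C'_def card_image image_iff)
  have finP: "finite L" if "L \<subseteq> C \<or> L \<subseteq> C'" for L
    using that finC finite_subset by (auto simp: C'_def)
  have Suc_C': "Suc i \<in> C' \<longleftrightarrow> i \<in> C" for i by (auto simp: C'_def)
  define U where "U = {\<nu>. vstrip \<mu> \<nu> \<and> hstrip \<kappa> \<nu>}"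
  define D where "D = {\<rho>. hstrip \<rho> \<mu> \<and> vstrip \<rho> \<kappa>}"
  have U: "strip_rows \<mu> ` U = {L. P \<subseteq> L \<and> L \<subseteq> C'}"
  proof (intro equalityI subsetI)
    fix L assume "L \<in> strip_rows \<mu> ` U"
    then obtain \<nu> where L: "L = strip_rows \<mu> \<nu>" and v: "vstrip \<mu> \<nu>" and h: "hstrip \<kappa> \<nu>"
      by (auto simp: U_def)
    have \<nu>: "part \<nu> i = part \<mu> i + of_bool (i \<in> L)" "part \<kappa> i \<le> part \<nu> i"
      "part \<nu> (Suc i) \<le> part \<kappa> i" for i
      using vstrip_part[OF v] h by (auto simp: L hstrip_def)
    have "i \<in> L" if "i \<in> P" for i using \<nu>(1)[of i] \<nu>(2)[of i] that by (cases "i \<in> L") (simp_all add: P_def)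
    moreover have "i \<in> C'" if "i \<in> L" for i
    proof (cases i)
      case 0 then show ?thesis by (simp add: C'_def)
    next
      case (Suc i')
      then show ?thesis using \<nu>(1)[of i] \<nu>(3)[of i'] that by (simp add: Suc_C' C_def)
    qed
    ultimately show "L \<in> {L. P \<subseteq> L \<and> L \<subseteq> C'}" by auto
  next
    fix L assume "L \<in> {L. P \<subseteq> L \<and> L \<subseteq> C'}"
    then have L: "P \<subseteq> L" "L \<subseteq> C'" by auto
    have le: "part \<mu> (Suc i) + of_bool (Suc i \<in> L) \<le> part \<kappa> i" for i
    proof (cases "Suc i \<in> L")
      case True
      then have "i \<in> C" using L(2) Suc_C' by blast
      then show ?thesis using True by (simp add: C_def)
    qed (use H(1)[of i] in simp)
    have ge: "part \<kappa> i \<le> part \<mu> i + of_bool (i \<in> L)" for i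
    proof (cases "i \<in> L")
      case False
      then have "i \<notin> P" using L(1) by blast
      then show ?thesis using False by (simp add: P_def)
    qed (use H(2)[of i] in simp)
    define \<nu> where "\<nu> = Abs_partition (\<lambda>i. part \<mu> i + of_bool (i \<in> L))"
    have \<nu>: "part \<nu> = (\<lambda>i. part \<mu> i + of_bool (i \<in> L))"
      unfolding \<nu>_def by (rule part_Abs_add_rows) (use finP L order_trans[OF le ge] in blast)+
    have "\<nu> \<in> U" using le ge by (auto simp: U_def vstrip_def hstrip_def \<nu>)
    moreover have "L = strip_rows \<mu> \<nu>" by (auto simp: strip_rows_def \<nu>)
    ultimately show "L \<in> strip_rows \<mu> ` U" by auto
  qed
  have D: "(\<lambda>\<rho>. strip_rows \<rho> \<kappa>) ` D = {L. P \<subseteq> L \<and> L \<subseteq> C}"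
  proof (intro equalityI subsetI)
    fix L assume "L \<in> (\<lambda>\<rho>. strip_rows \<rho> \<kappa>) ` D"
    then obtain \<rho> where L: "L = strip_rows \<rho> \<kappa>" and v: "vstrip \<rho> \<kappa>" and h: "hstrip \<rho> \<mu>"
      by (auto simp: D_def)
    have \<rho>: "part \<kappa> i = part \<rho> i + of_bool (i \<in> L)" "part \<rho> i \<le> part \<mu> i"
      "part \<mu> (Suc i) \<le> part \<rho> i" for i
      using vstrip_part[OF v] h by (auto simp: L hstrip_def)
    have "i \<in> L" if "i \<in> P" for i using \<rho>(1)[of i] \<rho>(2)[of i] that by (cases "i \<in> L") (simp_all add: P_def)
    moreover have "i \<in> C" if "i \<in> L" for i using \<rho>(1)[of i] \<rho>(3)[of i] that by (simp add: C_def)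
    ultimately show "L \<in> {L. P \<subseteq> L \<and> L \<subseteq> C}" by auto
  next
    fix L assume "L \<in> {L. P \<subseteq> L \<and> L \<subseteq> C}"
    then have L: "P \<subseteq> L" "L \<subseteq> C" by auto
    define r where "r i = part \<kappa> i - of_bool (i \<in> L)" for i
    have pos: "part \<mu> (Suc i) < part \<kappa> i" if "i \<in> L" for i
      using that L(2) by (auto simp: C_def)
    have r: "part \<kappa> i = r i + of_bool (i \<in> L)" for i
      using pos[of i] by (cases "i \<in> L") (simp_all add: r_def)
    have ge: "part \<mu> (Suc i) \<le> r i" for i
      using pos[of i] H(1)[of i] by (cases "i \<in> L") (simp_all add: r_def)
    have le: "r i \<le> part \<mu> i" for i
    proof (cases "i \<in> L")
      case False
      then have "i \<notin> P" using L(1) by blast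
      then show ?thesis using False by (simp add: r_def P_def)
    qed (use H(2)[of i] in \<open>simp add: r_def\<close>)
    define \<rho> where "\<rho> = Abs_partition r"
    have \<rho>: "part \<rho> = r"
      unfolding \<rho>_def
    proof (rule part_Abs)
      show "r (Suc i) \<le> r i" for i using le[of "Suc i"] ge[of i] by simp
      show "finite {i. r i \<noteq> 0}"
        by (rule finite_subset[OF _ finite_part[of \<kappa>]]) (auto simp: r_def)
    qed
    have "\<rho> \<in> D" using le ge by (auto simp: D_def vstrip_def hstrip_def \<rho> r)
    moreover have "L = strip_rows \<rho> \<kappa>" by (auto simp: strip_rows_def \<rho> r)
    ultimately show "L \<in> (\<lambda>\<rho>. strip_rows \<rho> \<kappa>) ` D" by auto
  qed
  have injU: "inj_on (strip_rows \<mu>) U"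
    by (rule inj_on_subset[OF inj_on_strip_rows_right]) (auto simp: U_def)
  have injD: "inj_on (\<lambda>\<rho>. strip_rows \<rho> \<kappa>) D"
    by (rule inj_on_subset[OF inj_on_strip_rows_left]) (auto simp: D_def)
  have cU: "card {\<nu> \<in> U. Q (card (strip_rows \<mu> \<nu>))} = card {L. P \<subseteq> L \<and> L \<subseteq> C' \<and> Q (card L)}" for Q
    using card_Collect_inj_image[OF injU U, of "\<lambda>L. Q (card L)"] by (simp add: conj_assoc)
  have cD: "card {\<rho> \<in> D. Q (card (strip_rows \<rho> \<kappa>))} = card {L. P \<subseteq> L \<and> L \<subseteq> C \<and> Q (card L)}" for Q
    using card_Collect_inj_image[OF injD D, of "\<lambda>L. Q (card L)"] by (simp add: conj_assoc)
  have "{\<nu>. vstrip \<mu> \<nu> \<and> hstrip \<kappa> \<nu> \<and> partition_size \<nu> = partition_size \<mu> + j} =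
      {\<nu> \<in> U. card (strip_rows \<mu> \<nu>) = j}"
    by (auto simp: U_def vstrip_size)
  moreover have "{\<rho>. hstrip \<rho> \<mu> \<and> vstrip \<rho> \<kappa> \<and> partition_size \<kappa> = partition_size \<rho> + j} =
      {\<rho> \<in> D. card (strip_rows \<rho> \<kappa>) = j}"
    by (auto simp: D_def vstrip_size)
  moreover have "{\<rho>. hstrip \<rho> \<mu> \<and> vstrip \<rho> \<kappa> \<and> Suc (partition_size \<kappa>) = partition_size \<rho> + j} =
      {\<rho> \<in> D. Suc (card (strip_rows \<rho> \<kappa>)) = j}"
    by (auto simp: D_def vstrip_size)
  ultimately show ?thesis
    using card_subsets_between_Suc[OF finC PC _ PC' cardC', of j] finP[of C'] cU[of "\<lambda>c. c = j"]
      cD[of "\<lambda>c. c = j"] cD[of "\<lambda>c. Suc c = j"] by simp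
qed

section \<open>The Pieri rule\<close>

lemma sum_sum_Collect_swap:
  fixes g :: "'b \<Rightarrow> nat"
  assumes "finite A" "finite F" "\<And>x y. x \<in> A \<Longrightarrow> R x y \<Longrightarrow> y \<in> F"
  shows "(\<Sum>x\<in>A. \<Sum>y | R x y. g y) = (\<Sum>y\<in>F. card {x \<in> A. R x y} * g y)"
proof -
  have "(\<Sum>x\<in>A. \<Sum>y | R x y. g y) = (\<Sum>x\<in>A. \<Sum>y | y \<in> F \<and> R x y. g y)"
    using assms(3) by (intro sum.cong arg_cong2[where f = sum]) auto
  also have "\<dots> = (\<Sum>y\<in>F. \<Sum>x | x \<in> A \<and> R x y. g y)"
    by (rule sum.swap_restrict) (use assms in auto)
  finally show ?thesis by simp
qed

text \<open>The subsets S are split by whether they contain n, and the largest entry is then peeled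
  off. For n in S the strip loses one box and S - {n} has one element less; if f n = 0, no
  admissible S contains n.\<close>

lemma kostka_elementary_rec:
  fixes f :: "nat \<Rightarrow> nat"
  assumes f: "\<And>k. k > n \<Longrightarrow> f k = 0"
  shows "(\<Sum>S | S \<subseteq> {k. f k \<noteq> 0} \<and> card S = j. kostka \<mu> (\<lambda>k. f k - of_bool (k \<in> S))) =
    (\<Sum>\<rho> | hstrip \<rho> \<mu> \<and> partition_size \<mu> = partition_size \<rho> + f n.
      \<Sum>S | S \<subseteq> {k. (f(n := 0)) k \<noteq> 0} \<and> card S = j. kostka \<rho> (\<lambda>k. (f(n := 0)) k - of_bool (k \<in> S))) +
    (if f n = 0 then 0 else
      (\<Sum>\<rho> | hstrip \<rho> \<mu> \<and> partition_size \<mu> = partition_size \<rho> + (f n - 1).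
      \<Sum>S | S \<subseteq> {k. (f(n := 0)) k \<noteq> 0} \<and> Suc (card S) = j. kostka \<rho> (\<lambda>k. (f(n := 0)) k - of_bool (k \<in> S))))"
proof -
  let ?f' = "f(n := 0)"
  let ?P = "{S. S \<subseteq> {k. ?f' k \<noteq> 0} \<and> card S = j}"
  let ?Q = "{S. S \<subseteq> {k. ?f' k \<noteq> 0} \<and> Suc (card S) = j}"
  let ?K = "\<lambda>S. kostka \<mu> (\<lambda>k. f k - of_bool (k \<in> S))"
  have fin: "finite {k. ?f' k \<noteq> 0}"
    by (rule finite_subset[of _ "{..n}"]) (use f in \<open>auto simp: not_less[symmetric]\<close>)
  have finP: "finite ?P" and finQ: "finite ?Q"
    by (rule finite_subset[of _ "Pow {k. ?f' k \<noteq> 0}"]; use fin in auto)+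
  have peel: "?K S = (\<Sum>\<rho> | hstrip \<rho> \<mu> \<and> partition_size \<mu> = partition_size \<rho> + (f n - of_bool (n \<in> S)).
      kostka \<rho> (\<lambda>k. ?f' k - of_bool (k \<in> S)))" for S
  proof -
    have "(\<lambda>k. f k - of_bool (k \<in> S))(n := 0) = (\<lambda>k. ?f' k - of_bool (k \<in> S))" by auto
    then show ?thesis using f by (subst kostka_peel[of n]) auto
  qed
  have P: "sum ?K ?P = (\<Sum>\<rho> | hstrip \<rho> \<mu> \<and> partition_size \<mu> = partition_size \<rho> + f n.
      \<Sum>S\<in>?P. kostka \<rho> (\<lambda>k. ?f' k - of_bool (k \<in> S)))"
  proof (subst sum.swap, rule sum.cong)
    fix S assume "S \<in> ?P"
    then have "n \<notin> S" by auto
    then show "?K S = (\<Sum>\<rho> | hstrip \<rho> \<mu> \<and> partition_size \<mu> = partition_size \<rho> + f n.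
        kostka \<rho> (\<lambda>k. ?f' k - of_bool (k \<in> S)))" using peel[of S] by simp
  qed simp
  show ?thesis
  proof (cases "f n = 0")
    case True
    then have "{S. S \<subseteq> {k. f k \<noteq> 0} \<and> card S = j} = ?P" by (metis fun_upd_triv)
    then show ?thesis using P True by simp
  next
    case False
    have ins: "card (insert n S) = Suc (card S)" if "S \<subseteq> {k. ?f' k \<noteq> 0}" for S
      using that finite_subset[OF that fin] by (subst card_insert_disjoint) auto
    have "{S. S \<subseteq> {k. f k \<noteq> 0} \<and> card S = j} = ?P \<union> insert n ` ?Q"
    proof (intro equalityI subsetI)
      fix S assume S: "S \<in> {S. S \<subseteq> {k. f k \<noteq> 0} \<and> card S = j}"
      show "S \<in> ?P \<union> insert n ` ?Q"
      proof (cases "n \<in> S")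
        case True
        have sub: "S - {n} \<subseteq> {k. ?f' k \<noteq> 0}" using S by auto
        have "insert n (S - {n}) = S" using True by auto
        then have "S - {n} \<in> ?Q" using ins[OF sub] S sub by simp
        then have "insert n (S - {n}) \<in> insert n ` ?Q" by (rule imageI)
        then show ?thesis using True by (simp only: insert_Diff UnI2)
      next
        case False
        then have "S \<in> ?P" using S by auto
        then show ?thesis by blast
      qed
    next
      fix S assume "S \<in> ?P \<union> insert n ` ?Q"
      then show "S \<in> {S. S \<subseteq> {k. f k \<noteq> 0} \<and> card S = j}"
      proof
        assume "S \<in> ?P" then show ?thesis by (auto split: if_splits)
      next
        assume "S \<in> insert n ` ?Q"
        then obtain S' where "S = insert n S'" "S' \<in> ?Q" by auto
        then show ?thesis using ins[of S'] False by (auto split: if_splits)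
      qed
    qed
    moreover have "?P \<inter> insert n ` ?Q = {}" by auto
    ultimately have "sum ?K {S. S \<subseteq> {k. f k \<noteq> 0} \<and> card S = j} = sum ?K ?P + sum ?K (insert n ` ?Q)"
      using finP finQ by (simp add: sum.union_disjoint)
    moreover have "sum ?K (insert n ` ?Q) = (\<Sum>S\<in>?Q. ?K (insert n S))"
    proof (subst sum.reindex)
      show "inj_on (insert n) ?Q"
      proof (rule inj_onI)
        fix S T assume "S \<in> ?Q" "T \<in> ?Q" "insert n S = insert n T"
        moreover from this have "n \<notin> S" "n \<notin> T" by auto
        ultimately show "S = T" by (metis insert_ident)
      qed
    qed simp
    moreover have "(\<Sum>S\<in>?Q. ?K (insert n S)) =
        (\<Sum>\<rho> | hstrip \<rho> \<mu> \<and> partition_size \<mu> = partition_size \<rho> + (f n - 1).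
          \<Sum>S\<in>?Q. kostka \<rho> (\<lambda>k. ?f' k - of_bool (k \<in> S)))"
    proof (subst sum.swap, rule sum.cong)
      fix S assume "S \<in> ?Q"
      have "(\<lambda>k. ?f' k - of_bool (k \<in> insert n S)) = (\<lambda>k. ?f' k - of_bool (k \<in> S))" by auto
      then show "?K (insert n S) = (\<Sum>\<rho> | hstrip \<rho> \<mu> \<and> partition_size \<mu> = partition_size \<rho> + (f n - 1).
        kostka \<rho> (\<lambda>k. ?f' k - of_bool (k \<in> S)))" using peel[of "insert n S"] by simp
    qed simp
    ultimately show ?thesis using P False by simp
  qed
qed

lemma finite_size_Collect: "finite {\<nu>. Q \<nu> \<and> partition_size \<nu> = B}" "finite {\<nu>. Q \<nu> \<and> B = partition_size \<nu> + c}"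
  by (rule finite_subset[OF _ finite_partitions_size_le[of B]]; auto)+

text \<open>The left side is the coefficient of the monomial with exponents f in e_j s_\<mu>.
  Peeling the last variable on both sides leaves, for each \<kappa>, two routes from \<mu> to
  \<kappa>: add a vertical strip and then remove a horizontal one, or remove first and add
  afterwards. \<open>card_strips_exchange\<close> compares their numbers.\<close>

lemma kostka_pieri:
  assumes "\<And>k. k \<ge> n \<Longrightarrow> f k = 0"
  shows "(\<Sum>S | S \<subseteq> {k. f k \<noteq> 0} \<and> card S = j. kostka \<mu> (\<lambda>k. f k - of_bool (k \<in> S))) =
    (\<Sum>\<nu> | vstrip \<mu> \<nu> \<and> partition_size \<nu> = partition_size \<mu> + j. kostka \<nu> f)"
  using assms
proof (induction n arbitrary: f j \<mu>)
  case 0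
  then have f: "f = (\<lambda>_. 0)" by auto
  show ?case
  proof (cases j)
    case 0
    have "{\<nu>. vstrip \<mu> \<nu> \<and> partition_size \<nu> = partition_size \<mu>} = {\<mu>}"
    proof (intro equalityI subsetI)
      fix \<nu> assume \<nu>: "\<nu> \<in> {\<nu>. vstrip \<mu> \<nu> \<and> partition_size \<nu> = partition_size \<mu>}"
      then have "\<not> partition_size \<mu> < partition_size \<nu>" "diagram \<mu> \<subseteq> diagram \<nu>"
        using vstrip_subset by auto
      then show "\<nu> \<in> {\<mu>}" using partition_size_strict_mono[of \<mu> \<nu>] by blast
    qed (simp add: vstrip_def)
    moreover have "{S :: nat set. S = {} \<and> card S = 0} = {{}}" by auto
    ultimately show ?thesis by (simp add: f 0)
  next
    case (Suc i)
    have "(\<Sum>\<nu> | vstrip \<mu> \<nu> \<and> partition_size \<nu> = partition_size \<mu> + j. kostka \<nu> f) = 0"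
    proof (intro sum.neutral ballI)
      fix \<nu> assume "\<nu> \<in> {\<nu>. vstrip \<mu> \<nu> \<and> partition_size \<nu> = partition_size \<mu> + j}"
      then have "partition_size \<nu> \<noteq> 0" using Suc by auto
      then show "kostka \<nu> f = 0" by (simp add: f kostka_zero partition_size_eq_0_iff)
    qed
    moreover have "{S :: nat set. S = {} \<and> card S = j} = {}" using Suc by auto
    ultimately show ?thesis by (simp add: f)
  qed
next
  case (Suc n)
  let ?f' = "f(n := 0)"
  \<comment> \<open>A common finite index set for every \<kappa> reached along either route, as the
    interchange of sums requires.\<close>
  define F where "F = {\<kappa>. partition_size \<kappa> \<le> partition_size \<mu> + j}"
  have finF: "finite F" unfolding F_def by (rule finite_partitions_size_le)
  have f: "f k = 0" if "k > n" for k using Suc.prems[of k] that by simp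
  have f': "?f' k = 0" if "k \<ge> n" for k using f[of k] that by (cases "k = n") auto
  note IH = Suc.IH[of ?f', OF f']
  have IH': "(\<Sum>S | S \<subseteq> {k. ?f' k \<noteq> 0} \<and> Suc (card S) = j. kostka \<rho> (\<lambda>k. ?f' k - of_bool (k \<in> S))) =
    (\<Sum>\<kappa> | vstrip \<rho> \<kappa> \<and> Suc (partition_size \<kappa>) = partition_size \<rho> + j. kostka \<kappa> ?f')" for \<rho>
  proof (cases j)
    case 0
    have "{\<kappa>. vstrip \<rho> \<kappa> \<and> Suc (partition_size \<kappa>) = partition_size \<rho> + j} = {}"
      using partition_size_mono[OF vstrip_subset] 0 by fastforce
    from this[THEN arg_cong, of "sum (\<lambda>\<kappa>. kostka \<kappa> ?f')"] show ?thesis using 0 by simp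
  next
    case (Suc i)
    show ?thesis by (simp only: Suc nat.inject add_Suc_right IH)
  qed
  let ?X = "\<lambda>a. {\<rho>. hstrip \<rho> \<mu> \<and> partition_size \<mu> = partition_size \<rho> + a}"
  have hs: "partition_size \<rho> \<le> partition_size \<mu>" if "hstrip \<rho> \<mu>" for \<rho> \<mu>
    using that by (intro partition_size_mono hstrip_subset)
  have one: "(\<Sum>\<rho>\<in>?X (f n). \<Sum>\<kappa> | vstrip \<rho> \<kappa> \<and> partition_size \<kappa> = partition_size \<rho> + j. kostka \<kappa> ?f') =
    (\<Sum>\<kappa>\<in>F. card {\<rho> \<in> ?X (f n). vstrip \<rho> \<kappa> \<and> partition_size \<kappa> = partition_size \<rho> + j} * kostka \<kappa> ?f')"
    by (rule sum_sum_Collect_swap) (use finF hs in \<open>auto simp: F_def finite_size_Collect\<close>)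
  have two: "(\<Sum>\<rho>\<in>?X (f n - 1). \<Sum>\<kappa> | vstrip \<rho> \<kappa> \<and> Suc (partition_size \<kappa>) = partition_size \<rho> + j. kostka \<kappa> ?f') =
    (\<Sum>\<kappa>\<in>F. card {\<rho> \<in> ?X (f n - 1). vstrip \<rho> \<kappa> \<and> Suc (partition_size \<kappa>) = partition_size \<rho> + j} * kostka \<kappa> ?f')"
    by (rule sum_sum_Collect_swap) (use finF in \<open>auto simp: F_def finite_size_Collect\<close>)
  have rhs: "(\<Sum>\<nu> | vstrip \<mu> \<nu> \<and> partition_size \<nu> = partition_size \<mu> + j. kostka \<nu> f) =
    (\<Sum>\<nu> | vstrip \<mu> \<nu> \<and> partition_size \<nu> = partition_size \<mu> + j.
      \<Sum>\<kappa> | hstrip \<kappa> \<nu> \<and> partition_size \<nu> = partition_size \<kappa> + f n. kostka \<kappa> ?f')"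
    by (simp add: kostka_peel[of n f] f)
  also have "\<dots> = (\<Sum>\<kappa>\<in>F. card {\<nu> \<in> {\<nu>. vstrip \<mu> \<nu> \<and> partition_size \<nu> = partition_size \<mu> + j}.
      hstrip \<kappa> \<nu> \<and> partition_size \<nu> = partition_size \<kappa> + f n} * kostka \<kappa> ?f')"
    by (rule sum_sum_Collect_swap) (use finF hs in \<open>auto simp: F_def finite_size_Collect\<close>)
  also have "\<dots> = (\<Sum>\<kappa>\<in>F. (card {\<rho> \<in> ?X (f n). vstrip \<rho> \<kappa> \<and> partition_size \<kappa> = partition_size \<rho> + j} +
      (if f n = 0 then 0 else
        card {\<rho> \<in> ?X (f n - 1). vstrip \<rho> \<kappa> \<and> Suc (partition_size \<kappa>) = partition_size \<rho> + j})) * kostka \<kappa> ?f')"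
  proof (intro sum.cong refl arg_cong2[where f = "(*)"])
    fix \<kappa>
    let ?L = "{\<nu> \<in> {\<nu>. vstrip \<mu> \<nu> \<and> partition_size \<nu> = partition_size \<mu> + j}.
      hstrip \<kappa> \<nu> \<and> partition_size \<nu> = partition_size \<kappa> + f n}"
    let ?R1 = "{\<rho> \<in> ?X (f n). vstrip \<rho> \<kappa> \<and> partition_size \<kappa> = partition_size \<rho> + j}"
    let ?R2 = "{\<rho> \<in> ?X (f n - 1). vstrip \<rho> \<kappa> \<and> Suc (partition_size \<kappa>) = partition_size \<rho> + j}"
    show "card ?L = card ?R1 + (if f n = 0 then 0 else card ?R2)"
    \<comment> \<open>Sizes along either route force this equation; when it fails, every count that
      enters is 0.\<close>
    proof (cases "partition_size \<mu> + j = partition_size \<kappa> + f n")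
      case True
      have "?L = {\<nu>. vstrip \<mu> \<nu> \<and> hstrip \<kappa> \<nu> \<and> partition_size \<nu> = partition_size \<mu> + j}"
        using True by auto
      moreover have "?R1 = {\<rho>. hstrip \<rho> \<mu> \<and> vstrip \<rho> \<kappa> \<and> partition_size \<kappa> = partition_size \<rho> + j}"
        using True by auto
      moreover have "{\<rho>. hstrip \<rho> \<mu> \<and> vstrip \<rho> \<kappa> \<and> Suc (partition_size \<kappa>) = partition_size \<rho> + j} =
          (if f n = 0 then {} else ?R2)"
      proof (cases "f n = 0")
        case f0: True
        \<comment> \<open>With f n = 0 the sizes would make \<rho> one box larger than \<mu>,
          although it is obtained by removing boxes.\<close>
        have False if "hstrip \<rho> \<mu>" "Suc (partition_size \<kappa>) = partition_size \<rho> + j" for \<rho>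
          using hs[OF that(1)] that(2) True f0 by simp
        then show ?thesis using f0 by auto
      next
        case fn: False
        have "partition_size \<mu> = partition_size \<rho> + (f n - 1) \<longleftrightarrow> Suc (partition_size \<kappa>) = partition_size \<rho> + j"
          if "Suc (partition_size \<kappa>) = partition_size \<rho> + j" for \<rho>
          using True fn that by linarith
        then show ?thesis using fn by auto
      qed
      ultimately show ?thesis using card_strips_exchange[of \<mu> \<kappa> j] by (auto split: if_splits)
    next
      case False
      then have "?L = {}" "?R1 = {}" "f n = 0 \<or> ?R2 = {}" by auto
      then show ?thesis by (elim disjE) (simp_all only: card.empty simp_thms if_True if_cancel add_0_right)
    qed
  qed
  also have "\<dots> = (\<Sum>S | S \<subseteq> {k. f k \<noteq> 0} \<and> card S = j. kostka \<mu> (\<lambda>k. f k - of_bool (k \<in> S)))"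
  proof -
    have "(\<Sum>S | S \<subseteq> {k. f k \<noteq> 0} \<and> card S = j. kostka \<mu> (\<lambda>k. f k - of_bool (k \<in> S))) =
      (\<Sum>\<rho>\<in>?X (f n). \<Sum>\<kappa> | vstrip \<rho> \<kappa> \<and> partition_size \<kappa> = partition_size \<rho> + j. kostka \<kappa> ?f') +
      (if f n = 0 then 0 else (\<Sum>\<rho>\<in>?X (f n - 1). \<Sum>\<kappa> | vstrip \<rho> \<kappa> \<and> Suc (partition_size \<kappa>) = partition_size \<rho> + j. kostka \<kappa> ?f'))"
      by (subst kostka_elementary_rec[of n f, OF f]) (simp_all only: IH IH')
    then show ?thesis unfolding one two
      by (cases "f n = 0") (simp_all only: simp_thms if_True if_False add_0_right sum.distrib[symmetric] add_mult_distrib)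
  qed
  finally show ?case by simp
qed

section \<open>Schur expansions\<close>

lemma finite_le_poly_mapping: "finite {a :: nat \<Rightarrow>\<^sub>0 nat. \<forall>k. Poly_Mapping.lookup a k \<le> Poly_Mapping.lookup m k}"
proof (rule inj_on_finite[of Poly_Mapping.lookup])
  let ?B = "\<Union>k\<in>Poly_Mapping.keys m. {..Poly_Mapping.lookup m k}"
  show "inj_on Poly_Mapping.lookup {a. \<forall>k. Poly_Mapping.lookup a k \<le> Poly_Mapping.lookup m k}"
    by (rule inj_onI) (simp add: poly_mapping.lookup_inject)
  show "Poly_Mapping.lookup ` {a. \<forall>k. Poly_Mapping.lookup a k \<le> Poly_Mapping.lookup m k} \<subseteq>
      {f. \<forall>x. (x \<in> Poly_Mapping.keys m \<longrightarrow> f x \<in> ?B) \<and> (x \<notin> Poly_Mapping.keys m \<longrightarrow> f x = 0)}"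
  proof clarify
    fix a x assume a: "\<forall>k. Poly_Mapping.lookup a k \<le> Poly_Mapping.lookup m k"
    show "(x \<in> Poly_Mapping.keys m \<longrightarrow> Poly_Mapping.lookup a x \<in> ?B) \<and>
        (x \<notin> Poly_Mapping.keys m \<longrightarrow> Poly_Mapping.lookup a x = 0)"
      using a[rule_format, of x] by (auto simp: in_keys_iff)
  qed
  show "finite {f. \<forall>x. (x \<in> Poly_Mapping.keys m \<longrightarrow> f x \<in> ?B) \<and> (x \<notin> Poly_Mapping.keys m \<longrightarrow> f x = (0 :: nat))}"
    by (rule finite_set_of_finite_funs) auto
qed

text \<open>Both factors of a decomposition are bounded by m pointwise. Over an infinite index set
  the sum in \<open>series_mult\<close> would collapse to 0.\<close>

lemma finite_add_decompositions: "finite {(a, b :: nat \<Rightarrow>\<^sub>0 nat). a + b = m}"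
proof (rule finite_subset)
  let ?D = "{a. \<forall>k. Poly_Mapping.lookup a k \<le> Poly_Mapping.lookup m k}"
  show "{(a, b). a + b = m} \<subseteq> ?D \<times> ?D" by (auto simp: lookup_add)
  show "finite (?D \<times> ?D)" using finite_le_poly_mapping by simp
qed

section \<open>Ring laws for the product of series\<close>

lemma series_mult_commute: "series_mult f g = series_mult g f"
proof
  fix m
  show "series_mult f g m = series_mult g f m"
    unfolding series_mult_def
    by (rule sum.reindex_bij_witness[of _ prod.swap prod.swap]) (auto simp: add.commute)
qed

lemma series_mult_assoc: "series_mult (series_mult f g) h = series_mult f (series_mult g h)"
proof
  fix m
  have "series_mult (series_mult f g) h m =
      (\<Sum>((a, b), (c, d)) \<in> (SIGMA p:{(a, b). a + b = m}. {(c, d). c + d = fst p}). f c * g d * h b)"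
    unfolding series_mult_def sum_distrib_right
    by (subst sum.Sigma[symmetric]) (auto simp: finite_add_decompositions intro!: sum.cong)
  also have "\<dots> = (\<Sum>((a, b), (c, d)) \<in> (SIGMA p:{(a, b). a + b = m}. {(c, d). c + d = snd p}). f a * (g c * h d))"
    by (rule sum.reindex_bij_witness[of _ "\<lambda>((a, b), (c, d)). ((a + c, d), (a, c))"
          "\<lambda>((a, b), (c, d)). ((c, d + b), (d, b))"]) (auto simp: add.assoc)
  also have "\<dots> = series_mult f (series_mult g h) m"
    unfolding series_mult_def sum_distrib_left
    by (subst sum.Sigma[symmetric]) (auto simp: finite_add_decompositions intro!: sum.cong)
  finally show "series_mult (series_mult f g) h m = series_mult f (series_mult g h) m" .
qed

lemma series_mult_zero_right: "series_mult f (\<lambda>_. 0) = (\<lambda>_. 0)"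
  by (simp add: series_mult_def fun_eq_iff case_prod_beta)

lemma series_mult_add_right: "series_mult f (\<lambda>m. g m + h m) = (\<lambda>m. series_mult f g m + series_mult f h m)"
  by (simp add: series_mult_def fun_eq_iff case_prod_beta distrib_left sum.distrib)

lemma series_mult_smult_right: "series_mult f (\<lambda>m. c * g m) = (\<lambda>m. c * series_mult f g m)"
  by (simp add: series_mult_def fun_eq_iff case_prod_beta sum_distrib_left mult.left_commute)

lemma series_mult_diff_left: "series_mult (\<lambda>m. g m - h m) f = (\<lambda>m. series_mult g f m - series_mult h f m)"
  by (simp add: series_mult_def fun_eq_iff case_prod_beta left_diff_distrib sum_subtractf)

lemma series_mult_sum_left: "series_mult (\<lambda>m. \<Sum>x\<in>A. g x m) f = (\<lambda>m. \<Sum>x\<in>A. series_mult (g x) f m)"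
  by (simp add: series_mult_def fun_eq_iff case_prod_beta sum_distrib_right sum.swap[of _ A])

section \<open>Multiplication by elementary symmetric functions\<close>

definition elementary :: "nat \<Rightarrow> sym_series" where
  "elementary j m = (if (\<forall>k. Poly_Mapping.lookup m k \<le> 1) \<and> card (Poly_Mapping.keys m) = j then 1 else 0)"

definition indicator_monomial :: "nat set \<Rightarrow> (nat \<Rightarrow>\<^sub>0 nat)" where
  "indicator_monomial S = Abs_poly_mapping (\<lambda>k. of_bool (k \<in> S))"

lemma lookup_indicator_monomial:
  "finite S \<Longrightarrow> Poly_Mapping.lookup (indicator_monomial S) k = of_bool (k \<in> S)"
  unfolding indicator_monomial_def by (subst lookup_Abs_poly_mapping) auto

lemma keys_indicator_monomial: "finite S \<Longrightarrow> Poly_Mapping.keys (indicator_monomial S) = S"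
  by (auto simp: in_keys_iff lookup_indicator_monomial split: if_splits)

text \<open>A square-free monomial dividing m is the indicator of a subset of the support of m.
  Subtraction of exponents is truncated, which does no harm because S stays inside that
  support.\<close>

lemma elementary_mult:
  "series_mult (elementary j) f m =
    (\<Sum>S | S \<subseteq> Poly_Mapping.keys m \<and> card S = j. f (m - indicator_monomial S))"
proof -
  let ?A = "{S. S \<subseteq> Poly_Mapping.keys m \<and> card S = j}"
  let ?g = "\<lambda>S. (indicator_monomial S, m - indicator_monomial S)"
  have fin: "finite S" if "S \<in> ?A" for S using that finite_subset[of S "Poly_Mapping.keys m"] by auto
  have ind: "indicator_monomial S + (m - indicator_monomial S) = m" if "S \<in> ?A" for S
  proof (rule poly_mapping_eqI)
    fix k
    have "of_bool (k \<in> S) \<le> Poly_Mapping.lookup m k"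
      using that by (auto simp: of_bool_def in_keys_iff Suc_le_eq)
    then show "Poly_Mapping.lookup (indicator_monomial S + (m - indicator_monomial S)) k = Poly_Mapping.lookup m k"
      using fin[OF that] by (simp add: lookup_add lookup_minus lookup_indicator_monomial)
  qed
  have el: "elementary j (indicator_monomial S) = 1" if "S \<in> ?A" for S
    using that fin[OF that] by (simp add: elementary_def lookup_indicator_monomial keys_indicator_monomial)
  have "series_mult (elementary j) f m = (\<Sum>(a, b) \<in> ?g ` ?A. elementary j a * f b)"
    unfolding series_mult_def
  proof (rule sum.mono_neutral_right)
    show "?g ` ?A \<subseteq> {(a, b). a + b = m}" using ind by auto
    show "\<forall>p\<in>{(a, b). a + b = m} - ?g ` ?A. (case p of (a, b) \<Rightarrow> elementary j a * f b) = 0"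
    proof (rule ballI, rule ccontr)
      fix p assume p: "p \<in> {(a, b). a + b = m} - ?g ` ?A" "(case p of (a, b) \<Rightarrow> elementary j a * f b) \<noteq> 0"
      obtain a b where ab: "p = (a, b)" by (cases p)
      have el: "\<forall>k. Poly_Mapping.lookup a k \<le> 1" "card (Poly_Mapping.keys a) = j" and m: "m = a + b"
        using p by (auto simp: ab elementary_def split: if_splits)
      let ?S = "Poly_Mapping.keys a"
      have a: "indicator_monomial ?S = a"
      proof (rule poly_mapping_eqI)
        fix k show "Poly_Mapping.lookup (indicator_monomial ?S) k = Poly_Mapping.lookup a k"
          using el(1)[rule_format, of k] by (auto simp: lookup_indicator_monomial in_keys_iff)
      qed
      have "?S \<subseteq> Poly_Mapping.keys m" by (auto simp: m in_keys_iff lookup_add)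
      then have "?g ?S \<in> ?g ` ?A" using el(2) by blast
      moreover have "?g ?S = p" by (simp add: a m ab)
      ultimately show False using p(1) by simp
    qed
  qed (rule finite_add_decompositions)
  also have "\<dots> = (\<Sum>S\<in>?A. f (m - indicator_monomial S))"
  proof (subst sum.reindex)
    show "inj_on ?g ?A"
    proof (rule inj_onI)
      fix S T assume "S \<in> ?A" "T \<in> ?A" "?g S = ?g T"
      then show "S = T" using keys_indicator_monomial[OF fin] by (metis fst_conv)
    qed
  qed (simp add: el)
  finally show ?thesis .
qed

text \<open>A given monomial involves finitely many variables, so its coefficient is governed by the
  finite-variable count \<open>kostka_pieri\<close>.\<close>

lemma schur_pieri:
  "series_mult (elementary j) (schur \<mu>) =
    (\<lambda>m. \<Sum>\<nu> | vstrip \<mu> \<nu> \<and> partition_size \<nu> = partition_size \<mu> + j. schur \<nu> m)"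
proof
  fix m :: "nat \<Rightarrow>\<^sub>0 nat"
  let ?A = "{S. S \<subseteq> Poly_Mapping.keys m \<and> card S = j}"
  let ?f = "Poly_Mapping.lookup m"
  have "finite {k. ?f k \<noteq> 0}" by simp
  then obtain n where n: "{k. ?f k \<noteq> 0} \<subseteq> {..<n}"
    by (meson finite_nat_iff_bounded)
  have keys: "Poly_Mapping.keys m = {k. ?f k \<noteq> 0}" by (auto simp: in_keys_iff)
  have "kostka \<mu> (Poly_Mapping.lookup (m - indicator_monomial S)) = kostka \<mu> (\<lambda>k. ?f k - of_bool (k \<in> S))"
    if "S \<in> ?A" for S
  proof -
    have "finite S" using that finite_subset[of S "Poly_Mapping.keys m"] by auto
    then have "Poly_Mapping.lookup (m - indicator_monomial S) = (\<lambda>k. ?f k - of_bool (k \<in> S))"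
      by (simp add: fun_eq_iff lookup_minus lookup_indicator_monomial)
    then show ?thesis by simp
  qed
  then have "series_mult (elementary j) (schur \<mu>) m = int (\<Sum>S\<in>?A. kostka \<mu> (\<lambda>k. ?f k - of_bool (k \<in> S)))"
    by (simp add: elementary_mult schur_eq_kostka)
  also have "\<dots> = int (\<Sum>\<nu> | vstrip \<mu> \<nu> \<and> partition_size \<nu> = partition_size \<mu> + j. kostka \<nu> ?f)"
    unfolding keys by (subst kostka_pieri[of n]) (use n in \<open>auto simp: not_less[symmetric]\<close>)
  finally show "series_mult (elementary j) (schur \<mu>) m =
      (\<Sum>\<nu> | vstrip \<mu> \<nu> \<and> partition_size \<nu> = partition_size \<mu> + j. schur \<nu> m)"
    by (simp add: schur_eq_kostka)
qed

lemma schur_empty: "schur empty_partition m = (if m = 0 then 1 else 0)"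
proof (cases "m = 0")
  case True
  have "Poly_Mapping.lookup (0 :: nat \<Rightarrow>\<^sub>0 nat) = (\<lambda>_. 0)" by (simp add: fun_eq_iff)
  then show ?thesis using True by (simp add: schur_eq_kostka kostka_zero)
next
  case False
  then obtain k where k: "Poly_Mapping.lookup m k \<noteq> 0" by (metis lookup_zero poly_mapping_eqI)
  have "diagram empty_partition = {}" by (auto simp: diagram_def)
  then have "tableaux empty_partition (Poly_Mapping.lookup m) = {}"
    using k by (auto simp: tableaux_def)
  then show ?thesis using False by (simp add: schur_eq_kostka kostka_def)
qed

lemma series_mult_schur_empty: "series_mult (schur empty_partition) f = f"
proof
  fix m
  have "series_mult (schur empty_partition) f m = (\<Sum>(a, b)\<in>{(0, m)}. schur empty_partition a * f b)"
    unfolding series_mult_def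
    by (rule sum.mono_neutral_right) (auto simp: finite_add_decompositions schur_empty split: if_splits)
  then show "series_mult (schur empty_partition) f m = f m" by (simp add: schur_empty)
qed

section \<open>Integral spans of Schur functions\<close>

inductive_set schur_span :: "partition set \<Rightarrow> sym_series set" for A where
  zero: "(\<lambda>_. 0) \<in> schur_span A"
| add: "f \<in> schur_span A \<Longrightarrow> \<kappa> \<in> A \<Longrightarrow> (\<lambda>m. f m + c * schur \<kappa> m) \<in> schur_span A"

lemma schur_span_schur: "\<kappa> \<in> A \<Longrightarrow> schur \<kappa> \<in> schur_span A"
  using schur_span.add[OF schur_span.zero, of \<kappa> A 1] by simp

lemma schur_span_lincomb:
  assumes "g \<in> schur_span A" "f \<in> schur_span A"
  shows "(\<lambda>m. f m + d * g m) \<in> schur_span A"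
  using assms(1)
proof induction
  case zero
  then show ?case using assms(2) by simp
next
  case (add g \<kappa> c)
  then have "(\<lambda>m. (f m + d * g m) + (d * c) * schur \<kappa> m) \<in> schur_span A"
    by (intro schur_span.add)
  then show ?case by (simp add: algebra_simps)
qed

lemma schur_span_diff: "f \<in> schur_span A \<Longrightarrow> g \<in> schur_span A \<Longrightarrow> (\<lambda>m. f m - g m) \<in> schur_span A"
  using schur_span_lincomb[of g A f "-1"] by simp

lemma schur_span_sum:
  assumes "finite X" "\<And>x. x \<in> X \<Longrightarrow> f x \<in> schur_span A"
  shows "(\<lambda>m. \<Sum>x\<in>X. f x m) \<in> schur_span A"
  using assms
proof (induction X rule: finite_induct)
  case empty
  then show ?case using schur_span.zero by simp
next
  case (insert x X)
  then have "(\<lambda>m. f x m + 1 * (\<Sum>x\<in>X. f x m)) \<in> schur_span A"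
    by (intro schur_span_lincomb) auto
  then show ?case using insert by simp
qed

lemma sum_keys_superset:
  "finite X \<Longrightarrow> Poly_Mapping.keys c \<subseteq> X \<Longrightarrow>
    (\<Sum>\<kappa>\<in>Poly_Mapping.keys c. Poly_Mapping.lookup c \<kappa> * g \<kappa>) = (\<Sum>\<kappa>\<in>X. Poly_Mapping.lookup c \<kappa> * (g \<kappa> :: int))"
  by (rule sum.mono_neutral_left) (auto simp: in_keys_iff)

text \<open>Passes from membership in the span to a finitely supported coefficient map of the kind
  \<open>lr_number\<close> describes, keeping its support inside A.\<close>

lemma schur_span_expansion:
  assumes "f \<in> schur_span A"
  obtains c where "Poly_Mapping.keys c \<subseteq> A"
    "f = (\<lambda>m. \<Sum>\<kappa> \<in> Poly_Mapping.keys c. Poly_Mapping.lookup c \<kappa> * schur \<kappa> m)"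
  using assms
proof (induction arbitrary: thesis)
  case zero
  show ?case by (rule zero[of 0]) auto
next
  case (add f \<kappa> d)
  obtain c where c: "Poly_Mapping.keys c \<subseteq> A"
    "f = (\<lambda>m. \<Sum>\<kappa> \<in> Poly_Mapping.keys c. Poly_Mapping.lookup c \<kappa> * schur \<kappa> m)"
    by (rule add.IH)
  let ?s = "Poly_Mapping.single \<kappa> d"
  \<comment> \<open>A coefficient may cancel when a term is added, so the sums run over this
    superset of the support.\<close>
  let ?X = "insert \<kappa> (Poly_Mapping.keys c)"
  have sub: "Poly_Mapping.keys (c + ?s) \<subseteq> ?X"
    using Poly_Mapping.keys_add[of c ?s] by (auto split: if_splits)
  show ?case
  proof (rule add.prems[of "c + ?s"])
    show "Poly_Mapping.keys (c + ?s) \<subseteq> A" using sub c(1) add.hyps by auto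
    show "(\<lambda>m. f m + d * schur \<kappa> m) =
        (\<lambda>m. \<Sum>\<kappa>' \<in> Poly_Mapping.keys (c + ?s). Poly_Mapping.lookup (c + ?s) \<kappa>' * schur \<kappa>' m)"
    proof
      fix m
      have "(\<Sum>\<kappa>' \<in> Poly_Mapping.keys (c + ?s). Poly_Mapping.lookup (c + ?s) \<kappa>' * schur \<kappa>' m) =
          (\<Sum>\<kappa>' \<in> ?X. Poly_Mapping.lookup c \<kappa>' * schur \<kappa>' m) + (\<Sum>\<kappa>' \<in> ?X. Poly_Mapping.lookup ?s \<kappa>' * schur \<kappa>' m)"
        using sub by (subst sum_keys_superset[of ?X]) (auto simp: lookup_add distrib_right sum.distrib)
      also have "(\<Sum>\<kappa>' \<in> ?X. Poly_Mapping.lookup c \<kappa>' * schur \<kappa>' m) = f m"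
        unfolding c(2) by (rule sum_keys_superset[symmetric]) auto
      also have "(\<Sum>\<kappa>' \<in> ?X. Poly_Mapping.lookup ?s \<kappa>' * schur \<kappa>' m) = (\<Sum>\<kappa>' \<in> {\<kappa>}. d * schur \<kappa>' m)"
        by (rule sum.mono_neutral_cong_right) (auto simp: lookup_single)
      finally show "f m + d * schur \<kappa> m =
        (\<Sum>\<kappa>' \<in> Poly_Mapping.keys (c + ?s). Poly_Mapping.lookup (c + ?s) \<kappa>' * schur \<kappa>' m)" by simp
    qed
  qed
qed

section \<open>Littlewood--Richardson numbers\<close>

text \<open>The terms of the Pieri rule only gain boxes, so containing \<mu> is preserved.\<close>

lemma elementary_mult_schur_span:
  assumes "f \<in> schur_span {\<kappa>. diagram \<mu> \<subseteq> diagram \<kappa>}"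
  shows "series_mult (elementary j) f \<in> schur_span {\<kappa>. diagram \<mu> \<subseteq> diagram \<kappa>}"
  using assms
proof induction
  case zero
  show ?case by (simp add: series_mult_zero_right schur_span.zero)
next
  case (add f \<kappa> c)
  have "series_mult (elementary j) (schur \<kappa>) \<in> schur_span {\<kappa>. diagram \<mu> \<subseteq> diagram \<kappa>}"
    unfolding schur_pieri
  proof (rule schur_span_sum)
    show "schur \<nu> \<in> schur_span {\<kappa>. diagram \<mu> \<subseteq> diagram \<kappa>}"
      if "\<nu> \<in> {\<nu>. vstrip \<kappa> \<nu> \<and> partition_size \<nu> = partition_size \<kappa> + j}" for \<nu>
      using that add.hyps vstrip_subset[of \<kappa> \<nu>] by (intro schur_span_schur) auto
  qed (rule finite_size_Collect)
  from schur_span_lincomb[OF this add.IH, of c] show ?case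
    by (simp add: series_mult_add_right series_mult_smult_right)
qed

text \<open>With \<kappa> the shape \<nu> without its last column, of height k, the product e_k
  s_\<kappa> contains s_\<nu> once, and every other shape in it precedes \<nu> by first row length
  and then by the number of rows attaining that length. Solving for s_\<nu> leaves terms to which
  induction applies.\<close>

lemma schur_mult_schur_span:
  assumes "f \<in> schur_span {\<kappa>. diagram \<mu> \<subseteq> diagram \<kappa>}"
  shows "series_mult (schur \<nu>) f \<in> schur_span {\<kappa>. diagram \<mu> \<subseteq> diagram \<kappa>}"
proof (induction \<nu> rule: wf_induct[OF wf_measures[of
      "[partition_size, \<lambda>\<nu>. part \<nu> 0, \<lambda>\<nu>. card {i. part \<nu> i = part \<nu> 0}]"]])
  case (1 \<nu>)
  let ?U = "schur_span {\<kappa>. diagram \<mu> \<subseteq> diagram \<kappa>}"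
  note IH = 1[rule_format]
  show ?case
  proof (cases "\<nu> = empty_partition")
    case True
    then show ?thesis using assms by (simp add: series_mult_schur_empty)
  next
    case False
    define c where "c = part \<nu> 0"
    define k where "k = card {i. part \<nu> i = c}"
    have le_c: "part \<nu> i \<le> c" for i unfolding c_def by (rule part_antimono) simp
    have c: "c > 0"
    proof (rule ccontr)
      assume "\<not> c > 0"
      then have "part \<nu> i = 0" for i using le_c[of i] by simp
      then show False using False by (auto intro: partition_eqI)
    qed
    have fin_top: "finite {i. part \<tau> i = c}" for \<tau>
      by (rule finite_subset[OF _ finite_part[of \<tau>]]) (use c in auto)
    have top: "{i. part \<nu> i = c} = {..<k}"
      unfolding k_def
    proof (rule lessThan_card_downclosed[OF fin_top])
      show "i \<in> {i. part \<nu> i = c}" if "j \<in> {i. part \<nu> i = c}" "i \<le> j" for i j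
        using that part_antimono[of i j \<nu>] le_c[of i] by simp
    qed
    have top_iff: "part \<nu> i = c \<longleftrightarrow> i < k" for i using top by auto
    have k: "k > 0" using top_iff[of 0] by (simp add: c_def)
    \<comment> \<open>Lowering the k longest rows by one deletes the last column of \<nu>.\<close>
    define r where "r i = part \<nu> i - of_bool (i < k)" for i
    have r_add: "part \<nu> i = r i + of_bool (i < k)" for i
      using top_iff[of i] c by (cases "i < k") (auto simp: r_def)
    have r_le: "r i \<le> c - 1" for i
      using top_iff[of i] le_c[of i] by (cases "i < k") (auto simp: r_def)
    define \<kappa> where "\<kappa> = Abs_partition r"
    have part_\<kappa>: "part \<kappa> = r"
      unfolding \<kappa>_def
    proof (rule part_Abs)
      show "r (Suc i) \<le> r i" for i
      proof (cases "i < k")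
        case True
        then show ?thesis using r_le[of "Suc i"] top_iff[of i] by (simp add: r_def)
      next
        case False
        then show ?thesis using part_antimono[of i "Suc i" \<nu>] by (simp add: r_def)
      qed
      show "finite {i. r i \<noteq> 0}"
        by (rule finite_subset[OF _ finite_part[of \<nu>]]) (auto simp: r_def)
    qed
    have v: "vstrip \<kappa> \<nu>" by (simp add: vstrip_def part_\<kappa> r_add)
    have rows: "strip_rows \<kappa> \<nu> = {..<k}" by (auto simp: strip_rows_def part_\<kappa> r_add)
    have size_\<nu>: "partition_size \<nu> = partition_size \<kappa> + k" using vstrip_size[OF v] rows by simp
    define X where "X = {\<tau>. vstrip \<kappa> \<tau> \<and> partition_size \<tau> = partition_size \<kappa> + k}"
    have finX: "finite X" unfolding X_def by (rule finite_size_Collect)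
    have "\<nu> \<in> X" using v size_\<nu> by (simp add: X_def)
    have "schur \<nu> = (\<lambda>m. series_mult (elementary k) (schur \<kappa>) m - (\<Sum>\<tau>\<in>X - {\<nu>}. schur \<tau> m))"
      unfolding schur_pieri X_def[symmetric] using finX \<open>\<nu> \<in> X\<close> by (simp add: sum.remove[of X \<nu>])
    \<comment> \<open>Associativity moves e_k outside, so stability under e_k and smaller instances
      of the claim suffice.\<close>
    then have eq: "series_mult (schur \<nu>) f = (\<lambda>m. series_mult (elementary k) (series_mult (schur \<kappa>) f) m -
        (\<Sum>\<tau>\<in>X - {\<nu>}. series_mult (schur \<tau>) f m))"
      by (simp only: series_mult_diff_left series_mult_sum_left series_mult_assoc)
    have "series_mult (schur \<kappa>) f \<in> ?U"
      by (rule IH) (use size_\<nu> k in simp)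
    then have "series_mult (elementary k) (series_mult (schur \<kappa>) f) \<in> ?U"
      by (rule elementary_mult_schur_span)
    moreover have "series_mult (schur \<tau>) f \<in> ?U" if \<tau>: "\<tau> \<in> X - {\<nu>}" for \<tau>
    proof (rule IH)
      have vl: "vstrip \<kappa> \<tau>" and size_\<tau>: "partition_size \<tau> = partition_size \<nu>" and neq: "\<tau> \<noteq> \<nu>"
        using \<tau> size_\<nu> by (auto simp: X_def)
      let ?S = "strip_rows \<kappa> \<tau>" and ?T = "{i. part \<tau> i = c}"
      have card_S: "card ?S = k" using vstrip_size[OF vl] size_\<tau> size_\<nu> by simp
      have part_\<tau>: "part \<tau> i = r i + of_bool (i \<in> ?S)" for i
        using vstrip_part[OF vl] by (simp add: part_\<kappa>)
      have le: "part \<tau> i \<le> c" for i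
        using part_\<tau>[of i] r_le[of i] c by (cases "i \<in> ?S") simp_all
      have TS: "?T \<subseteq> ?S"
      proof
        fix i assume "i \<in> ?T"
        then show "i \<in> ?S" using part_\<tau>[of i] r_le[of i] c by (cases "i \<in> ?S") simp_all
      qed
      \<comment> \<open>If \<tau> had k rows of length c, these would be its top rows and exactly
        the rows of its strip; the strip of \<nu> is the same, whence \<tau> = \<nu>.\<close>
      have "card ?T \<noteq> k"
      proof
        assume "card ?T = k"
        then have "?T = ?S" using card_subset_eq[OF _ TS] card_S by simp
        moreover have "?T = {..<card ?T}"
        proof (rule lessThan_card_downclosed[OF fin_top])
          show "i \<in> ?T" if "j \<in> ?T" "i \<le> j" for i j
            using that part_antimono[of i j \<tau>] le[of i] by simp
        qed
        ultimately have "?S = strip_rows \<kappa> \<nu>" using \<open>card ?T = k\<close> rows by simp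
        then have "\<tau> = \<nu>" using inj_onD[OF inj_on_strip_rows_right[of \<kappa>]] vl v by blast
        then show False using neq by simp
      qed
      moreover have "card ?T \<le> k" using card_mono[OF _ TS] card_S by simp
      ultimately have "card ?T < k" by simp
      then show "(\<tau>, \<nu>) \<in> measures [partition_size, \<lambda>\<nu>. part \<nu> 0, \<lambda>\<nu>. card {i. part \<nu> i = part \<nu> 0}]"
        using size_\<tau> le[of 0] by (cases "part \<tau> 0 = c") (auto simp: c_def k_def)
    qed
    then have "(\<lambda>m. \<Sum>\<tau>\<in>X - {\<nu>}. series_mult (schur \<tau>) f m) \<in> ?U"
      using finX by (intro schur_span_sum) auto
    ultimately show ?thesis unfolding eq by (rule schur_span_diff)
  qed
qed

section \<open>Dominance and linear independence of Schur functions\<close>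

lemma tableaux_ge_row:
  assumes "T \<in> tableaux \<mu> f" "(i, j) \<in> diagram \<mu>"
  shows "i \<le> T (i, j)"
  using assms(2)
proof (induction i)
  case (Suc i)
  then have "(i, j) \<in> diagram \<mu>" using part_antimono[of i "Suc i" \<mu>] by (simp add: mem_diagram)
  moreover have "T (i, j) < T (Suc i, j)"
    using assms(1) Suc.prems by (auto simp: tableaux_def ssyt_def)
  ultimately show ?case using Suc.IH by simp
qed simp

text \<open>Columns increase strictly from an entry at least 0, so an entry less than k sits in one
  of the first k rows.\<close>

lemma tableaux_dominance:
  assumes T: "T \<in> tableaux \<mu> f"
  shows "(\<Sum>i<k. f i) \<le> (\<Sum>i<k. part \<mu> i)"
proof -
  have "(\<Sum>i<k. f i) = (\<Sum>i<k. card {b \<in> diagram \<mu>. T b = i})"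
    using T by (simp add: tableaux_def)
  also have "\<dots> = card (\<Union>i<k. {b \<in> diagram \<mu>. T b = i})"
    by (subst card_UN_disjoint) auto
  also have "\<dots> \<le> card (SIGMA i:{..<k}. {..<part \<mu> i})"
  proof (rule card_mono)
    show "(\<Union>i<k. {b \<in> diagram \<mu>. T b = i}) \<subseteq> (SIGMA i:{..<k}. {..<part \<mu> i})"
    proof
      fix b assume b: "b \<in> (\<Union>i<k. {b \<in> diagram \<mu>. T b = i})"
      obtain i j where ij: "b = (i, j)" by (cases b)
      then show "b \<in> (SIGMA i:{..<k}. {..<part \<mu> i})"
        using b tableaux_ge_row[OF T, of i j] by (auto simp: mem_diagram)
    qed
  qed auto
  also have "\<dots> = (\<Sum>i<k. part \<mu> i)" by simp
  finally show ?thesis .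
qed

text \<open>Witness that the diagonal Kostka number is nonzero, the other half of
  triangularity.\<close>

lemma tableaux_superstandard: "restrict fst (diagram \<mu>) \<in> tableaux \<mu> (part \<mu>)"
proof -
  have "card {b \<in> diagram \<mu>. restrict fst (diagram \<mu>) b = k} = part \<mu> k" for k
  proof -
    have "{b \<in> diagram \<mu>. restrict fst (diagram \<mu>) b = k} = Pair k ` {..<part \<mu> k}"
      by (auto simp: mem_diagram)
    then show ?thesis by (simp add: card_image inj_on_def)
  qed
  moreover have "restrict fst (diagram \<mu>) \<in> ssyt \<mu>"
    unfolding ssyt_def
  proof (intro CollectI conjI allI impI restrict_extensional; elim conjE)
    show "restrict fst (diagram \<mu>) (i, j) \<le> restrict fst (diagram \<mu>) (i, j')"
      if "j < j'" "(i, j') \<in> diagram \<mu>" for i j j'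
      using that by (simp add: mem_diagram)
    show "restrict fst (diagram \<mu>) (i, j) < restrict fst (diagram \<mu>) (i', j)"
      if "i < i'" "(i', j) \<in> diagram \<mu>" for i i' j
      using that part_antimono[of i i' \<mu>] by (simp add: mem_diagram)
  qed
  ultimately show ?thesis by (simp add: tableaux_def)
qed

text \<open>Among the shapes in the support choose \<tau> maximal for a numerical refinement of
  dominance and look at the monomial with exponents \<tau>: no other shape of the support
  contributes to it, and \<tau> itself does.\<close>

lemma schur_independent:
  assumes "\<And>m. (\<Sum>\<kappa> \<in> Poly_Mapping.keys c. Poly_Mapping.lookup c \<kappa> * schur \<kappa> m) = 0"
  shows "c = 0"
proof (rule ccontr)
  assume "c \<noteq> 0"
  define X where "X = Poly_Mapping.keys c"
  have X: "finite X" "X \<noteq> {}" using \<open>c \<noteq> 0\<close> by (auto simp: X_def)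
  define N where "N = Max (num_parts ` X)"
  have N: "part \<kappa> i = 0" if "\<kappa> \<in> X" "N \<le> i" for \<kappa> i
  proof (rule part_eq_0)
    have "num_parts \<kappa> \<le> N" unfolding N_def using X that by (intro Max_ge) auto
    then show "num_parts \<kappa> \<le> i" using that by simp
  qed
  \<comment> \<open>Adding up the partial sums makes \<Phi> strictly monotone for dominance: if one
    shape dominates another and the totals agree, every partial sum up to N agrees, and N bounds the
    number of parts of all shapes in X.\<close>
  define \<Phi> where "\<Phi> \<kappa> = (\<Sum>k\<le>N. \<Sum>i<k. part \<kappa> i)" for \<kappa>
  have "Max (\<Phi> ` X) \<in> \<Phi> ` X" using X by (intro Max_in) auto
  then obtain \<tau> where \<tau>: "\<tau> \<in> X" "\<Phi> \<tau> = Max (\<Phi> ` X)" by force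
  have max: "\<Phi> \<kappa> \<le> \<Phi> \<tau>" if "\<kappa> \<in> X" for \<kappa> unfolding \<tau>(2) using that X by (intro Max_ge) auto
  define m where "m = Abs_poly_mapping (part \<tau>)"
  have m: "Poly_Mapping.lookup m = part \<tau>"
    unfolding m_def using finite_part[of \<tau>] by (intro Abs_poly_mapping_inverse) simp
  have zero: "schur \<kappa> m = 0" if "\<kappa> \<in> X - {\<tau>}" for \<kappa>
  proof (rule ccontr)
    assume "schur \<kappa> m \<noteq> 0"
    then have "tableaux \<kappa> (part \<tau>) \<noteq> {}" by (auto simp: schur_eq_kostka kostka_def m)
    then obtain T where "T \<in> tableaux \<kappa> (part \<tau>)" by auto
    then have dom: "(\<Sum>i<k. part \<tau> i) \<le> (\<Sum>i<k. part \<kappa> i)" for k by (rule tableaux_dominance)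
    then have "\<Phi> \<tau> \<le> \<Phi> \<kappa>" unfolding \<Phi>_def by (rule sum_mono)
    with max[of \<kappa>] that have "\<Phi> \<tau> = \<Phi> \<kappa>" by auto
    then have eq: "(\<Sum>i<k. part \<tau> i) = (\<Sum>i<k. part \<kappa> i)" if "k \<le> N" for k
      using sum_mono_inv[of "\<lambda>k. \<Sum>i<k. part \<tau> i" "{..N}" "\<lambda>k. \<Sum>i<k. part \<kappa> i" k] dom that
      by (simp add: \<Phi>_def)
    have "part \<tau> i = part \<kappa> i" for i
    proof (cases "i < N")
      case True
      then show ?thesis using eq[of i] eq[of "Suc i"] by simp
    next
      case False
      then show ?thesis using N \<tau>(1) \<open>\<kappa> \<in> X - {\<tau>}\<close> by simp
    qed
    then have "\<kappa> = \<tau>" by (intro partition_eqI) simp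
    then show False using that by simp
  qed
  have "0 = (\<Sum>\<kappa>\<in>X. Poly_Mapping.lookup c \<kappa> * schur \<kappa> m)" using assms[of m] by (simp add: X_def)
  also have "\<dots> = (\<Sum>\<kappa>\<in>{\<tau>}. Poly_Mapping.lookup c \<kappa> * schur \<kappa> m)"
    by (rule sum.mono_neutral_right) (use X \<tau> zero in auto)
  finally have "schur \<tau> m = 0" using \<tau>(1) by (simp add: X_def in_keys_iff)
  moreover have "card (tableaux \<tau> (part \<tau>)) \<noteq> 0"
    using tableaux_superstandard[of \<tau>] finite_tableaux[OF finite_part[of \<tau>], of \<tau>]
    by (subst card_0_eq) auto
  ultimately show False by (simp add: schur_eq_kostka kostka_def m)
qed

lemma schur_expansion_unique:
  assumes "(\<lambda>m. \<Sum>\<kappa> \<in> Poly_Mapping.keys c. Poly_Mapping.lookup c \<kappa> * schur \<kappa> m) =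
    (\<lambda>m. \<Sum>\<kappa> \<in> Poly_Mapping.keys d. Poly_Mapping.lookup d \<kappa> * schur \<kappa> m)"
  shows "c = d"
proof -
  let ?X = "Poly_Mapping.keys c \<union> Poly_Mapping.keys d"
  have "(\<Sum>\<kappa> \<in> Poly_Mapping.keys (c - d). Poly_Mapping.lookup (c - d) \<kappa> * schur \<kappa> m) = 0" for m
  proof -
    have "(\<Sum>\<kappa> \<in> Poly_Mapping.keys (c - d). Poly_Mapping.lookup (c - d) \<kappa> * schur \<kappa> m) =
        (\<Sum>\<kappa>\<in>?X. Poly_Mapping.lookup c \<kappa> * schur \<kappa> m) - (\<Sum>\<kappa>\<in>?X. Poly_Mapping.lookup d \<kappa> * schur \<kappa> m)"
      by (subst sum_keys_superset[of ?X])
        (use keys_diff[of c d] in \<open>auto simp: lookup_minus left_diff_distrib sum_subtractf\<close>)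
    also have "\<dots> = 0"
      using fun_cong[OF assms, of m] sum_keys_superset[of ?X c "\<lambda>\<kappa>. schur \<kappa> m"]
        sum_keys_superset[of ?X d "\<lambda>\<kappa>. schur \<kappa> m"] by simp
    finally show ?thesis .
  qed
  then have "c - d = 0" by (rule schur_independent)
  then show ?thesis by simp
qed

text \<open>Discharges the definite description: by uniqueness, any expansion found by other means
  is the one it denotes.\<close>

lemma lr_number_eq:
  assumes "series_mult (schur \<mu>) (schur \<nu>) =
    (\<lambda>m. \<Sum>\<kappa> \<in> Poly_Mapping.keys c. Poly_Mapping.lookup c \<kappa> * schur \<kappa> m)"
  shows "lr_number lam \<mu> \<nu> = Poly_Mapping.lookup c lam"
  unfolding lr_number_def
  by (rule arg_cong[where f = "\<lambda>c. Poly_Mapping.lookup c lam"], rule the_equality)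
    (use assms schur_expansion_unique in auto)

text \<open>The factor s_\<mu> starts in the span of shapes containing \<mu> and multiplication by
  s_\<nu> stays there, so uniqueness confines the expansion to such shapes.\<close>

lemma lr_number_nonzero_subset:
  assumes "lr_number lam \<mu> \<nu> \<noteq> 0"
  shows "diagram \<mu> \<subseteq> diagram lam"
proof -
  have "series_mult (schur \<nu>) (schur \<mu>) \<in> schur_span {\<kappa>. diagram \<mu> \<subseteq> diagram \<kappa>}"
    by (intro schur_mult_schur_span schur_span_schur) simp
  then obtain c where c: "Poly_Mapping.keys c \<subseteq> {\<kappa>. diagram \<mu> \<subseteq> diagram \<kappa>}"
    "series_mult (schur \<mu>) (schur \<nu>) =
      (\<lambda>m. \<Sum>\<kappa> \<in> Poly_Mapping.keys c. Poly_Mapping.lookup c \<kappa> * schur \<kappa> m)"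
    using schur_span_expansion by (metis series_mult_commute)
  then have "lam \<in> Poly_Mapping.keys c" using assms lr_number_eq[OF c(2)] by (simp add: in_keys_iff)
  then show ?thesis using c(1) by auto
qed

lemma lr_number_empty: "lr_number lam empty_partition \<nu> = (if \<nu> = lam then 1 else 0)"
  by (subst lr_number_eq[of _ _ "Poly_Mapping.single \<nu> 1"])
    (auto simp: series_mult_schur_empty lookup_single)

lemma W_coefficient_nonzero_subset:
  assumes "W_coefficient t lam \<mu> \<noteq> 0"
  shows "diagram \<mu> \<subseteq> diagram lam"
proof (rule ccontr)
  assume "\<not> diagram \<mu> \<subseteq> diagram lam"
  then have "lr_number lam \<mu> \<nu> = 0" for \<nu> using lr_number_nonzero_subset by blast
  then have "W_coefficient t lam \<mu> = Sum_any (\<lambda>_ :: partition. 0)"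
    unfolding W_coefficient_def by (intro arg_cong[where f = Sum_any]) auto
  then show False using assms by simp
qed

text \<open>Since s_0 = 1, only \<nu> = \<open>lam\<close> can contribute, with coefficient 1, and
  the parity condition on \<nu> becomes one on \<open>lam\<close>.\<close>

lemma W_coefficient_empty:
  "W_coefficient t lam empty_partition = (if (if t = Sp then even_rows lam else even_columns lam) then 1 else 0)"
proof -
  let ?f = "\<lambda>\<nu>. if (if t = Sp then even_rows \<nu> else even_columns \<nu>) then lr_number lam empty_partition \<nu> else 0"
  have "Sum_any ?f = sum ?f {lam}"
    by (rule Sum_any.expand_superset) (auto simp: lr_number_empty)
  then show ?thesis by (simp add: W_coefficient_def lr_number_empty)
qed

section \<open>Equivariant maps\<close>

text \<open>Functions instead of matrices, so that projections, inclusions and scalings need no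
  matrix form; only values on the carrier are constrained.\<close>

definition equivariant :: "classical_type \<Rightarrow> nat \<Rightarrow> rep \<Rightarrow> rep \<Rightarrow> (complex vec \<Rightarrow> complex vec) \<Rightarrow> bool" where
  "equivariant t n U W \<phi> \<longleftrightarrow>
     (\<forall>v \<in> carrier_vec (fst U). \<phi> v \<in> carrier_vec (fst W)) \<and>
     (\<forall>v \<in> carrier_vec (fst U). \<forall>w \<in> carrier_vec (fst U). \<phi> (v + w) = \<phi> v + \<phi> w) \<and>
     (\<forall>c. \<forall>v \<in> carrier_vec (fst U). \<phi> (c \<cdot>\<^sub>v v) = c \<cdot>\<^sub>v \<phi> v) \<and>
     (\<forall>g \<in> classical_group t n. \<forall>v \<in> carrier_vec (fst U). \<phi> (snd U g *\<^sub>v v) = snd W g *\<^sub>v \<phi> v)"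

text \<open>The dimension clause of a representation, isolated because it passes to direct sums by
  itself.\<close>

definition matrices_in_dim :: "classical_type \<Rightarrow> nat \<Rightarrow> rep \<Rightarrow> bool" where
  "matrices_in_dim t n U \<longleftrightarrow> (\<forall>g \<in> classical_group t n. snd U g \<in> carrier_mat (fst U) (fst U))"

lemma equivariantD:
  assumes "equivariant t n U W \<phi>"
  shows "v \<in> carrier_vec (fst U) \<Longrightarrow> \<phi> v \<in> carrier_vec (fst W)"
    "v \<in> carrier_vec (fst U) \<Longrightarrow> w \<in> carrier_vec (fst U) \<Longrightarrow> \<phi> (v + w) = \<phi> v + \<phi> w"
    "v \<in> carrier_vec (fst U) \<Longrightarrow> \<phi> (c \<cdot>\<^sub>v v) = c \<cdot>\<^sub>v \<phi> v"
    "g \<in> classical_group t n \<Longrightarrow> v \<in> carrier_vec (fst U) \<Longrightarrow> \<phi> (snd U g *\<^sub>v v) = snd W g *\<^sub>v \<phi> v"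
  using assms by (auto simp: equivariant_def)

lemma equivariant_zero:
  assumes "equivariant t n U W \<phi>"
  shows "\<phi> (0\<^sub>v (fst U)) = 0\<^sub>v (fst W)"
proof -
  have "\<phi> (0 \<cdot>\<^sub>v 0\<^sub>v (fst U)) = 0 \<cdot>\<^sub>v \<phi> (0\<^sub>v (fst U))" by (rule equivariantD[OF assms]) simp
  moreover have "0 \<cdot>\<^sub>v \<phi> (0\<^sub>v (fst U)) = 0\<^sub>v (fst W)"
    using equivariantD(1)[OF assms, of "0\<^sub>v (fst U)"] by auto
  moreover have "0 \<cdot>\<^sub>v 0\<^sub>v (fst U) = (0\<^sub>v (fst U) :: complex vec)" by auto
  ultimately show ?thesis by simp
qed

lemma equivariant_comp:
  "equivariant t n U W \<phi> \<Longrightarrow> equivariant t n W X \<psi> \<Longrightarrow> equivariant t n U X (\<lambda>v. \<psi> (\<phi> v))"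
  by (simp add: equivariant_def)

lemma intertwiner_equivariant:
  assumes "intertwiner t n U W A" "matrices_in_dim t n U" "matrices_in_dim t n W"
  shows "equivariant t n U W (\<lambda>v. A *\<^sub>v v)"
proof -
  have A: "A \<in> carrier_mat (fst W) (fst U)" using assms(1) by (simp add: intertwiner_def)
  have "A *\<^sub>v (snd U g *\<^sub>v v) = snd W g *\<^sub>v (A *\<^sub>v v)"
    if "g \<in> classical_group t n" "v \<in> carrier_vec (fst U)" for g v
  proof -
    have g: "snd U g \<in> carrier_mat (fst U) (fst U)" "snd W g \<in> carrier_mat (fst W) (fst W)"
      using that assms(2,3) by (auto simp: matrices_in_dim_def)
    have "A *\<^sub>v (snd U g *\<^sub>v v) = (A * snd U g) *\<^sub>v v"
      using A g that by (simp add: assoc_mult_mat_vec[of _ "fst W" "fst U" _ "fst U"])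
    also have "A * snd U g = snd W g * A" using assms(1) that by (simp add: intertwiner_def)
    finally show ?thesis using A g that by (simp add: assoc_mult_mat_vec[of _ "fst W" "fst W" _ "fst U"])
  qed
  then show ?thesis using A
    by (simp add: equivariant_def mult_add_distrib_mat_vec[of _ "fst W" "fst U"] mult_mat_vec[of _ "fst W" "fst U"])
qed

section \<open>Block decomposition of direct sums\<close>

lemma direct_sum_Nil: "direct_sum [] = (0, \<lambda>g. 0\<^sub>m 0 0)"
  by (simp add: direct_sum_def)

lemma fst_direct_sum_Cons: "fst (direct_sum (U # Us)) = fst U + fst (direct_sum Us)"
  by (simp add: direct_sum_def)

lemma matrices_in_dim_direct_sum:
  "(\<And>U. U \<in> set Us \<Longrightarrow> matrices_in_dim t n U) \<Longrightarrow> matrices_in_dim t n (direct_sum Us)"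
proof (induction Us)
  case Nil
  then show ?case by (simp add: direct_sum_Nil matrices_in_dim_def)
next
  case (Cons U Us)
  then have "matrices_in_dim t n U" "matrices_in_dim t n (direct_sum Us)" by auto
  then show ?case
    by (simp add: matrices_in_dim_def direct_sum_def Let_def)
qed

lemma snd_direct_sum_Cons:
  assumes "matrices_in_dim t n U" "matrices_in_dim t n (direct_sum Us)" "g \<in> classical_group t n"
    "v \<in> carrier_vec (fst U)" "w \<in> carrier_vec (fst (direct_sum Us))"
  shows "snd (direct_sum (U # Us)) g *\<^sub>v (v @\<^sub>v w) = (snd U g *\<^sub>v v) @\<^sub>v (snd (direct_sum Us) g *\<^sub>v w)"
proof -
  let ?d = "fst U" and ?e = "fst (direct_sum Us)"
  have c: "snd U g \<in> carrier_mat ?d ?d" "snd (direct_sum Us) g \<in> carrier_mat ?e ?e"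
    using assms by (auto simp: matrices_in_dim_def)
  have "snd (direct_sum (U # Us)) g =
      four_block_mat (snd U g) (0\<^sub>m ?d ?e) (0\<^sub>m ?e ?d) (snd (direct_sum Us) g)"
    using c by (simp add: direct_sum_def Let_def)
  moreover have "snd U g *\<^sub>v v + 0\<^sub>m ?d ?e *\<^sub>v w = snd U g *\<^sub>v v"
    "0\<^sub>m ?e ?d *\<^sub>v v + snd (direct_sum Us) g *\<^sub>v w = snd (direct_sum Us) g *\<^sub>v w"
    using c assms(4,5) by auto
  ultimately show ?thesis
    using four_block_mat_mult_vec[OF c(1) _ _ c(2) assms(4,5), of "0\<^sub>m ?d ?e" "0\<^sub>m ?e ?d"] by simp
qed

lemma vec_first_append: "v \<in> carrier_vec d \<Longrightarrow> vec_first (v @\<^sub>v w) d = v"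
  unfolding vec_first_def by (intro eq_vecI) auto

lemma vec_last_append: "w \<in> carrier_vec e \<Longrightarrow> vec_last (v @\<^sub>v w) e = w"
  unfolding vec_last_def by (intro eq_vecI) auto

lemma append_vec_cases:
  assumes "x \<in> carrier_vec (d + e)"
  obtains v w where "x = v @\<^sub>v w" "v \<in> carrier_vec d" "w \<in> carrier_vec e"
  using vec_first_last_append[OF assms] by (metis vec_first_carrier vec_last_carrier)

lemma equivariant_vec_first:
  assumes "matrices_in_dim t n U" "matrices_in_dim t n (direct_sum Us)"
  shows "equivariant t n (direct_sum (U # Us)) U (\<lambda>v. vec_first v (fst U))"
proof -
  have eq: "vec_first (snd (direct_sum (U # Us)) g *\<^sub>v x) (fst U) = snd U g *\<^sub>v vec_first x (fst U)"
    if g: "g \<in> classical_group t n" and x: "x \<in> carrier_vec (fst U + fst (direct_sum Us))" for g x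
  proof -
    obtain v w where vw: "x = v @\<^sub>v w" "v \<in> carrier_vec (fst U)" "w \<in> carrier_vec (fst (direct_sum Us))"
      by (rule append_vec_cases[OF x])
    have "snd U g *\<^sub>v v \<in> carrier_vec (fst U)"
      using assms(1) g vw by (auto simp: matrices_in_dim_def)
    then show ?thesis using snd_direct_sum_Cons[OF assms g vw(2,3)] vw by (simp add: vec_first_append)
  qed
  have add: "vec_first (x + y) (fst U) = vec_first x (fst U) + vec_first y (fst U)"
    if "x \<in> carrier_vec (fst U + e)" "y \<in> carrier_vec (fst U + e)" for x y :: "complex vec" and e
    using that by (intro eq_vecI) (auto simp: vec_first_def)
  have smult: "vec_first (c \<cdot>\<^sub>v x) (fst U) = c \<cdot>\<^sub>v vec_first x (fst U)"
    if "x \<in> carrier_vec (fst U + e)" for x :: "complex vec" and c e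
    using that by (intro eq_vecI) (auto simp: vec_first_def)
  show ?thesis unfolding equivariant_def fst_direct_sum_Cons using eq add smult by auto
qed

lemma equivariant_vec_last:
  assumes "matrices_in_dim t n U" "matrices_in_dim t n (direct_sum Us)"
  shows "equivariant t n (direct_sum (U # Us)) (direct_sum Us) (\<lambda>v. vec_last v (fst (direct_sum Us)))"
proof -
  let ?e = "fst (direct_sum Us)"
  have eq: "vec_last (snd (direct_sum (U # Us)) g *\<^sub>v x) ?e = snd (direct_sum Us) g *\<^sub>v vec_last x ?e"
    if g: "g \<in> classical_group t n" and x: "x \<in> carrier_vec (fst U + ?e)" for g x
  proof -
    obtain v w where vw: "x = v @\<^sub>v w" "v \<in> carrier_vec (fst U)" "w \<in> carrier_vec ?e"
      by (rule append_vec_cases[OF x])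
    have "snd (direct_sum Us) g *\<^sub>v w \<in> carrier_vec ?e"
      using assms(2) g vw by (auto simp: matrices_in_dim_def)
    then show ?thesis using snd_direct_sum_Cons[OF assms g vw(2,3)] vw by (simp add: vec_last_append)
  qed
  have add: "vec_last (x + y) e = vec_last x e + vec_last y e"
    if "x \<in> carrier_vec (fst U + e)" "y \<in> carrier_vec (fst U + e)" for x y :: "complex vec" and e
    using that by (intro eq_vecI) (auto simp: vec_last_def)
  have smult: "vec_last (c \<cdot>\<^sub>v x) e = c \<cdot>\<^sub>v vec_last x e"
    if "x \<in> carrier_vec (fst U + e)" for x :: "complex vec" and c e
    using that by (intro eq_vecI) (auto simp: vec_last_def)
  show ?thesis unfolding equivariant_def fst_direct_sum_Cons using eq add smult by auto
qed

lemma equivariant_append_zero: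
  assumes "matrices_in_dim t n U" "matrices_in_dim t n (direct_sum Us)"
  shows "equivariant t n U (direct_sum (U # Us)) (\<lambda>v. v @\<^sub>v 0\<^sub>v (fst (direct_sum Us)))"
proof -
  let ?e = "fst (direct_sum Us)"
  have "snd (direct_sum (U # Us)) g *\<^sub>v (v @\<^sub>v 0\<^sub>v ?e) = snd U g *\<^sub>v v @\<^sub>v 0\<^sub>v ?e"
    if "g \<in> classical_group t n" "v \<in> carrier_vec (fst U)" for g v
  proof -
    have "snd (direct_sum Us) g \<in> carrier_mat ?e ?e" using that assms by (auto simp: matrices_in_dim_def)
    then have "snd (direct_sum Us) g *\<^sub>v 0\<^sub>v ?e = 0\<^sub>v ?e" by auto
    then show ?thesis using snd_direct_sum_Cons[OF assms that, of "0\<^sub>v ?e"] by simp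
  qed
  moreover have "(v + w) @\<^sub>v 0\<^sub>v ?e = (v @\<^sub>v 0\<^sub>v ?e) + (w @\<^sub>v 0\<^sub>v ?e)"
    if "v \<in> carrier_vec (fst U)" "w \<in> carrier_vec (fst U)" for v w :: "complex vec"
    using that by (intro eq_vecI) (auto simp: append_vec_def Let_def)
  moreover have "(c \<cdot>\<^sub>v v) @\<^sub>v 0\<^sub>v ?e = c \<cdot>\<^sub>v (v @\<^sub>v 0\<^sub>v ?e)" for c and v :: "complex vec"
    by (intro eq_vecI) (auto simp: append_vec_def Let_def)
  ultimately show ?thesis by (auto simp: equivariant_def fst_direct_sum_Cons)
qed

text \<open>A nonzero vector of a direct sum has a nonzero component; composing with that projection
  yields the map.\<close>

lemma equivariant_to_direct_sum:
  assumes "equivariant t n U (direct_sum Us) \<phi>" "v \<in> carrier_vec (fst U)" "\<phi> v \<noteq> 0\<^sub>v (fst (direct_sum Us))"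
    "\<And>W. W \<in> set Us \<Longrightarrow> matrices_in_dim t n W"
  obtains W \<psi> where "W \<in> set Us" "equivariant t n U W \<psi>" "\<psi> v \<noteq> 0\<^sub>v (fst W)"
  using assms
proof (induction Us arbitrary: \<phi> thesis)
  case Nil
  have "\<phi> v \<in> carrier_vec 0" using equivariantD(1)[OF Nil.prems(2,3)] by (simp add: direct_sum_Nil)
  then show ?case using Nil.prems(4) by (auto simp: direct_sum_Nil)
next
  case (Cons W Us)
  have mW: "matrices_in_dim t n W" and mUs: "matrices_in_dim t n (direct_sum Us)"
    using Cons.prems(5) by (auto intro: matrices_in_dim_direct_sum)
  let ?e = "fst (direct_sum Us)"
  have first: "equivariant t n U W (\<lambda>v. vec_first (\<phi> v) (fst W))"
    by (rule equivariant_comp[OF Cons.prems(2) equivariant_vec_first[OF mW mUs]])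
  have last: "equivariant t n U (direct_sum Us) (\<lambda>v. vec_last (\<phi> v) ?e)"
    by (rule equivariant_comp[OF Cons.prems(2) equivariant_vec_last[OF mW mUs]])
  have c: "\<phi> v \<in> carrier_vec (fst W + ?e)"
    using equivariantD(1)[OF Cons.prems(2,3)] by (simp add: fst_direct_sum_Cons)
  show ?case
  proof (cases "vec_first (\<phi> v) (fst W) = 0\<^sub>v (fst W)")
    case True
    have "vec_last (\<phi> v) ?e \<noteq> 0\<^sub>v ?e"
    proof
      assume "vec_last (\<phi> v) ?e = 0\<^sub>v ?e"
      then have "\<phi> v = 0\<^sub>v (fst W) @\<^sub>v 0\<^sub>v ?e" using True vec_first_last_append[OF c] by simp
      also have "\<dots> = 0\<^sub>v (fst W + ?e)" by auto
      finally show False using Cons.prems(4) by (simp add: fst_direct_sum_Cons)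
    qed
    then obtain W' \<psi> where "W' \<in> set Us" "equivariant t n U W' \<psi>" "\<psi> v \<noteq> 0\<^sub>v (fst W')"
      using Cons.IH[OF _ last Cons.prems(3)] Cons.prems(5) by auto
    then show ?thesis using Cons.prems(1)[of W' \<psi>] by simp
  next
    case False
    then show ?thesis using Cons.prems(1)[of W] first by simp
  qed
qed

section \<open>Irreducibility and Schur's lemma\<close>

lemma subspaceI:
  assumes "S \<subseteq> carrier_vec d" "0\<^sub>v d \<in> S" "\<And>v w. v \<in> S \<Longrightarrow> w \<in> S \<Longrightarrow> v + w \<in> S" "\<And>c v. v \<in> S \<Longrightarrow> c \<cdot>\<^sub>v v \<in> S"
  shows "VectorSpace.subspace class_ring S (module_vec TYPE(complex) d)"
proof -
  interpret vec_space "TYPE(complex)" d .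
  have "module class_ring (module_vec TYPE(complex) d)" by (rule module_axioms)
  then have "submodule class_ring S (module_vec TYPE(complex) d)"
    using assms by (simp add: submodule_def module_vec_simps)
  then show ?thesis using vectorspace_axioms by (simp add: VectorSpace.subspace_def)
qed

lemma irreducible_repD:
  assumes "irreducible_rep t n U"
  shows "matrices_in_dim t n U" "fst U > 0"
    "S \<subseteq> carrier_vec (fst U) \<Longrightarrow> 0\<^sub>v (fst U) \<in> S \<Longrightarrow> (\<And>v w. v \<in> S \<Longrightarrow> w \<in> S \<Longrightarrow> v + w \<in> S) \<Longrightarrow>
      (\<And>c v. v \<in> S \<Longrightarrow> c \<cdot>\<^sub>v v \<in> S) \<Longrightarrow> (\<And>g v. g \<in> classical_group t n \<Longrightarrow> v \<in> S \<Longrightarrow> snd U g *\<^sub>v v \<in> S) \<Longrightarrow>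
      S = {0\<^sub>v (fst U)} \<or> S = carrier_vec (fst U)"
proof -
  show "matrices_in_dim t n U" "fst U > 0"
    using assms by (auto simp: irreducible_rep_def is_rep_def matrices_in_dim_def split: prod.splits)
  assume S: "S \<subseteq> carrier_vec (fst U)" "0\<^sub>v (fst U) \<in> S" "\<And>v w. v \<in> S \<Longrightarrow> w \<in> S \<Longrightarrow> v + w \<in> S"
      "\<And>c v. v \<in> S \<Longrightarrow> c \<cdot>\<^sub>v v \<in> S"
    and inv: "\<And>g v. g \<in> classical_group t n \<Longrightarrow> v \<in> S \<Longrightarrow> snd U g *\<^sub>v v \<in> S"
  have "VectorSpace.subspace class_ring S (module_vec TYPE(complex) (fst U))" by (rule subspaceI[OF S])
  then show "S = {0\<^sub>v (fst U)} \<or> S = carrier_vec (fst U)"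
    using assms inv unfolding irreducible_rep_def by (auto split: prod.splits)
qed

text \<open>Kernel and image are invariant subspaces. The one nonzero value excludes a full kernel
  and a zero image, so irreducibility leaves a zero kernel and a full image.\<close>

lemma schur_lemma:
  assumes U: "irreducible_rep t n U" and W: "irreducible_rep t n W"
    and \<phi>: "equivariant t n U W \<phi>" and v: "v \<in> carrier_vec (fst U)" "\<phi> v \<noteq> 0\<^sub>v (fst W)"
  shows "\<And>u. u \<in> carrier_vec (fst U) \<Longrightarrow> \<phi> u = 0\<^sub>v (fst W) \<Longrightarrow> u = 0\<^sub>v (fst U)"
    and "\<phi> ` carrier_vec (fst U) = carrier_vec (fst W)"
proof -
  note \<phi>D = equivariantD[OF \<phi>]
  have gU: "snd U g *\<^sub>v u \<in> carrier_vec (fst U)" if "g \<in> classical_group t n" "u \<in> carrier_vec (fst U)" for g u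
    using irreducible_repD(1)[OF U] that by (auto simp: matrices_in_dim_def)
  have gW: "snd W g *\<^sub>v 0\<^sub>v (fst W) = 0\<^sub>v (fst W)" if "g \<in> classical_group t n" for g
  proof -
    have "snd W g \<in> carrier_mat (fst W) (fst W)"
      using irreducible_repD(1)[OF W] that by (auto simp: matrices_in_dim_def)
    then show ?thesis by auto
  qed
  have ker: "{u \<in> carrier_vec (fst U). \<phi> u = 0\<^sub>v (fst W)} = {0\<^sub>v (fst U)} \<or>
      {u \<in> carrier_vec (fst U). \<phi> u = 0\<^sub>v (fst W)} = carrier_vec (fst U)"
    by (rule irreducible_repD(3)[OF U]) (auto simp: \<phi>D equivariant_zero[OF \<phi>] gU gW)
  show "u = 0\<^sub>v (fst U)" if "u \<in> carrier_vec (fst U)" "\<phi> u = 0\<^sub>v (fst W)" for u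
    using ker that v by blast
  have im: "\<phi> ` carrier_vec (fst U) = {0\<^sub>v (fst W)} \<or> \<phi> ` carrier_vec (fst U) = carrier_vec (fst W)"
  proof (rule irreducible_repD(3)[OF W])
    show "\<phi> ` carrier_vec (fst U) \<subseteq> carrier_vec (fst W)" using \<phi>D(1) by auto
    show "0\<^sub>v (fst W) \<in> \<phi> ` carrier_vec (fst U)" using equivariant_zero[OF \<phi>] by (metis imageI zero_carrier_vec)
    show "x + y \<in> \<phi> ` carrier_vec (fst U)" if "x \<in> \<phi> ` carrier_vec (fst U)" "y \<in> \<phi> ` carrier_vec (fst U)" for x y
    proof -
      from that obtain u u' where u: "u \<in> carrier_vec (fst U)" "u' \<in> carrier_vec (fst U)" "x = \<phi> u" "y = \<phi> u'" by auto
      then have "x + y = \<phi> (u + u')" using \<phi>D(2) by simp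
      then show ?thesis using u by auto
    qed
    show "c \<cdot>\<^sub>v x \<in> \<phi> ` carrier_vec (fst U)" if "x \<in> \<phi> ` carrier_vec (fst U)" for c x
    proof -
      from that obtain u where u: "u \<in> carrier_vec (fst U)" "x = \<phi> u" by auto
      then have "c \<cdot>\<^sub>v x = \<phi> (c \<cdot>\<^sub>v u)" using \<phi>D(3) by simp
      then show ?thesis using u by auto
    qed
    show "snd W g *\<^sub>v x \<in> \<phi> ` carrier_vec (fst U)"
      if "g \<in> classical_group t n" "x \<in> \<phi> ` carrier_vec (fst U)" for g x
    proof -
      from that obtain u where u: "u \<in> carrier_vec (fst U)" "x = \<phi> u" by auto
      then have "snd W g *\<^sub>v x = \<phi> (snd U g *\<^sub>v u)" using \<phi>D(4) that by simp
      then show ?thesis using u gU[OF that(1)] by auto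
    qed
  qed
  then show "\<phi> ` carrier_vec (fst U) = carrier_vec (fst W)" using v by blast
qed

text \<open>If a > b, replacing A by a square matrix padded with zero rows gives a singular matrix,
  and a kernel vector of it is a kernel vector of A.\<close>

lemma injective_dim_le:
  fixes A :: "complex mat"
  assumes A: "A \<in> carrier_mat b a" and inj: "inj_on (\<lambda>v. A *\<^sub>v v) (carrier_vec a)"
  shows "a \<le> b"
proof (rule ccontr)
  assume "\<not> a \<le> b"
  then have ab: "b < a" by simp
  define B where "B = mat a a (\<lambda>(i, j). if i < b then A $$ (i, j) else 0)"
  have B: "B \<in> carrier_mat a a" by (simp add: B_def)
  \<comment> \<open>Row b of B is zero, so the transpose kills the unit vector with index b; this is
    where b < a enters.\<close>
  have "transpose_mat B *\<^sub>v unit_vec a b = 0\<^sub>v a"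
  proof (rule eq_vecI)
    fix i assume i: "i < dim_vec (0\<^sub>v a :: complex vec)"
    then have "row (transpose_mat B) i \<bullet> unit_vec a b = col B i $ b"
      using B ab by (simp add: scalar_prod_right_unit)
    also have "\<dots> = 0" using i ab by (simp add: B_def)
    finally show "(transpose_mat B *\<^sub>v unit_vec a b) $ i = 0\<^sub>v a $ i" using i B by simp
  qed (use B in simp)
  moreover have "unit_vec a b \<noteq> (0\<^sub>v a :: complex vec)" using ab by (simp add: unit_vec_nonzero)
  ultimately have "\<exists>v. v \<in> carrier_vec a \<and> v \<noteq> 0\<^sub>v a \<and> transpose_mat B *\<^sub>v v = 0\<^sub>v a"
    by (intro exI[of _ "unit_vec a b"]) simp
  then have "det (transpose_mat B) = 0"
    using det_0_iff_vec_prod_zero_field[of "transpose_mat B" a] B by simp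
  then have "det B = 0" using det_transpose[OF B] by simp
  then obtain v where v: "v \<in> carrier_vec a" "v \<noteq> 0\<^sub>v a" "B *\<^sub>v v = 0\<^sub>v a"
    using det_0_iff_vec_prod_zero_field[OF B] by auto
  have "A *\<^sub>v v = 0\<^sub>v b"
  proof (rule eq_vecI)
    fix i assume "i < dim_vec (0\<^sub>v b :: complex vec)"
    then have i: "i < b" by simp
    have "row A i = row B i" using A i ab by (intro eq_vecI) (auto simp: B_def)
    then have "(A *\<^sub>v v) $ i = (B *\<^sub>v v) $ i" using A B i ab by simp
    then show "(A *\<^sub>v v) $ i = 0\<^sub>v b $ i" using v(3) i ab by simp
  qed (use A in simp)
  moreover have "A *\<^sub>v 0\<^sub>v a = 0\<^sub>v b" using A by auto
  ultimately have "v = 0\<^sub>v a" using inj_onD[OF inj, of v "0\<^sub>v a"] v(1) by simp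
  then show False using v(2) by simp
qed

text \<open>Paired coordinates carry inverse eigenvalues, so every nonzero entry of the form is
  multiplied by 1 and the determinant cancels in pairs; the extra vector in odd size has eigenvalue
  1.\<close>

lemma torus_element_in_group:
  assumes "\<forall>j \<in> {1..n}. z j \<noteq> 0"
  shows "torus_element t n z \<in> classical_group t n"
proof -
  let ?N = "matrix_size t n"
  let ?d = "\<lambda>i. if i < n then z (i + 1) else if i < 2 * n then inverse (z (i - n + 1)) else 1"
  have N: "?N = (if t = SO_odd then 2 * n + 1 else 2 * n)" by (cases t) auto
  have D: "torus_element t n z = mat_diag ?N ?d" by (simp add: torus_element_def)
  have tr: "transpose_mat (mat_diag ?N ?d) = mat_diag ?N ?d"
    by (intro eq_matI) (auto simp: mat_diag_def)
  have J: "form_matrix t n \<in> carrier_mat ?N ?N" by (simp add: form_matrix_def)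
  have "mat_diag ?N ?d * form_matrix t n * mat_diag ?N ?d = form_matrix t n"
  proof (rule eq_matI)
    fix i j assume ij: "i < dim_row (form_matrix t n)" "j < dim_col (form_matrix t n)"
    have "mat_diag ?N ?d * form_matrix t n * mat_diag ?N ?d =
        mat ?N ?N (\<lambda>(i, j). (?d i * form_matrix t n $$ (i, j)) * ?d j)"
      using J by (subst mat_diag_mult_left[OF J], subst mat_diag_mult_right[of _ ?N ?N])
        (auto intro!: eq_matI)
    then have "(mat_diag ?N ?d * form_matrix t n * mat_diag ?N ?d) $$ (i, j) =
        (?d i * form_matrix t n $$ (i, j)) * ?d j" using ij J by simp
    also have "\<dots> = form_matrix t n $$ (i, j)"
      using ij assms by (auto simp: form_matrix_def)
    finally show "(mat_diag ?N ?d * form_matrix t n * mat_diag ?N ?d) $$ (i, j) = form_matrix t n $$ (i, j)" .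
  qed (use J in \<open>auto simp: mat_diag_def\<close>)
  moreover have "det (mat_diag ?N ?d) = 1"
  proof -
    have "det (mat_diag ?N ?d) = (\<Prod>i<?N. ?d i)"
      by (subst det_upper_triangular[of _ ?N])
        (auto simp: mat_diag_def prod_list_diag_prod lessThan_atLeast0 intro!: upper_triangularI prod.cong)
    also have "\<dots> = (\<Prod>i<2 * n. ?d i)" by (auto simp: N)
    also have "{..<2 * n} = {..<n} \<union> {n..<n + n}" by auto
    also have "(\<Prod>i\<in>{..<n} \<union> {n..<n + n}. ?d i) = (\<Prod>i<n. ?d i) * (\<Prod>i\<in>{n..<n + n}. ?d i)"
      by (rule prod.union_disjoint) auto
    also have "(\<Prod>i\<in>{n..<n + n}. ?d i) = (\<Prod>i<n. ?d (i + n))"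
      using prod.shift_bounds_nat_ivl[of ?d 0 n n] by (simp add: lessThan_atLeast0)
    also have "(\<Prod>i<n. ?d i) * (\<Prod>i<n. ?d (i + n)) = (\<Prod>i<n. ?d i * ?d (i + n))"
      by (simp only: prod.distrib)
    also have "\<dots> = 1" by (rule prod.neutral) (use assms in auto)
    finally show ?thesis .
  qed
  ultimately show ?thesis by (simp add: classical_group_def D tr)
qed

section \<open>Weights\<close>

lemma equivariant_inj_on:
  assumes "equivariant t n U W \<phi>"
    "\<And>u. u \<in> carrier_vec (fst U) \<Longrightarrow> \<phi> u = 0\<^sub>v (fst W) \<Longrightarrow> u = 0\<^sub>v (fst U)"
  shows "inj_on \<phi> (carrier_vec (fst U))"
proof (rule inj_onI)
  fix u u' assume u: "u \<in> carrier_vec (fst U)" "u' \<in> carrier_vec (fst U)" and eq: "\<phi> u = \<phi> u'"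
  have c: "(-1) \<cdot>\<^sub>v u' \<in> carrier_vec (fst U)" using u by simp
  have "\<phi> (u + (-1) \<cdot>\<^sub>v u') = \<phi> u' + (-1) \<cdot>\<^sub>v \<phi> u'"
    using equivariantD(2)[OF assms(1) u(1) c] equivariantD(3)[OF assms(1) u(2), of "-1"] eq by simp
  also have "\<dots> = 0\<^sub>v (fst W)"
    using equivariantD(1)[OF assms(1) u(2)] by (intro eq_vecI) auto
  finally have zero: "u + (-1) \<cdot>\<^sub>v u' = 0\<^sub>v (fst U)" using assms(2) u c by simp
  show "u = u'"
  proof (rule eq_vecI)
    fix i assume i: "i < dim_vec u'"
    have "(u + (-1) \<cdot>\<^sub>v u') $ i = 0" using zero i u by simp
    then show "u $ i = u' $ i" using i u by simp
  qed (use u in auto)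
qed

lemma has_weight_image:
  assumes \<phi>: "equivariant t n U W \<phi>"
    and ker: "\<And>u. u \<in> carrier_vec (fst U) \<Longrightarrow> \<phi> u = 0\<^sub>v (fst W) \<Longrightarrow> u = 0\<^sub>v (fst U)"
    and x: "has_weight t n U x"
  shows "has_weight t n W x"
proof -
  obtain a v where a: "\<forall>j \<in> {1..n}. x j = of_int (a j)" and v: "v \<in> carrier_vec (fst U)" "v \<noteq> 0\<^sub>v (fst U)"
    and eig: "\<forall>z. (\<forall>j \<in> {1..n}. z j \<noteq> 0) \<longrightarrow>
        snd U (torus_element t n z) *\<^sub>v v = (\<Prod>j = 1..n. z j powi a j) \<cdot>\<^sub>v v"
    using x unfolding has_weight_def by blast
  have "snd W (torus_element t n z) *\<^sub>v \<phi> v = (\<Prod>j = 1..n. z j powi a j) \<cdot>\<^sub>v \<phi> v"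
    if z: "\<forall>j \<in> {1..n}. z j \<noteq> 0" for z
  proof -
    have "snd W (torus_element t n z) *\<^sub>v \<phi> v = \<phi> (snd U (torus_element t n z) *\<^sub>v v)"
      using equivariantD(4)[OF \<phi> torus_element_in_group[OF z] v(1)] by simp
    then show ?thesis using eig z equivariantD(3)[OF \<phi> v(1)] by simp
  qed
  moreover have "\<phi> v \<noteq> 0\<^sub>v (fst W)" using ker v by auto
  ultimately show ?thesis unfolding has_weight_def using a equivariantD(1)[OF \<phi> v(1)] by blast
qed

lemma has_weight_preimage:
  assumes \<phi>: "equivariant t n U W \<phi>" and inj: "inj_on \<phi> (carrier_vec (fst U))"
    and surj: "\<phi> ` carrier_vec (fst U) = carrier_vec (fst W)"
    and U: "matrices_in_dim t n U" and x: "has_weight t n W x"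
  shows "has_weight t n U x"
proof -
  obtain a w where a: "\<forall>j \<in> {1..n}. x j = of_int (a j)" and w: "w \<in> carrier_vec (fst W)" "w \<noteq> 0\<^sub>v (fst W)"
    and eig: "\<forall>z. (\<forall>j \<in> {1..n}. z j \<noteq> 0) \<longrightarrow>
        snd W (torus_element t n z) *\<^sub>v w = (\<Prod>j = 1..n. z j powi a j) \<cdot>\<^sub>v w"
    using x unfolding has_weight_def by blast
  from w(1) surj obtain v where v: "v \<in> carrier_vec (fst U)" "w = \<phi> v" by auto
  have "snd U (torus_element t n z) *\<^sub>v v = (\<Prod>j = 1..n. z j powi a j) \<cdot>\<^sub>v v"
    if z: "\<forall>j \<in> {1..n}. z j \<noteq> 0" for z
  proof (rule inj_onD[OF inj])
    note g = torus_element_in_group[OF z, of t]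
    show "\<phi> (snd U (torus_element t n z) *\<^sub>v v) = \<phi> ((\<Prod>j = 1..n. z j powi a j) \<cdot>\<^sub>v v)"
      using equivariantD(4)[OF \<phi> g v(1)] equivariantD(3)[OF \<phi> v(1)] v(2) eig z by simp
    show "snd U (torus_element t n z) *\<^sub>v v \<in> carrier_vec (fst U)"
      using U g v by (auto simp: matrices_in_dim_def)
  qed (use v in simp)
  moreover have "v \<noteq> 0\<^sub>v (fst U)" using w(2) v(2) equivariant_zero[OF \<phi>] by auto
  ultimately show ?thesis unfolding has_weight_def using a v(1) by blast
qed

lemma sum_epsilon: "(\<Sum>j = 1..n. w j * epsilon i j) = (if i \<in> {1..n} then w i else 0)"
  unfolding epsilon_def by (simp add: if_distrib[of "(*) _"] cong: if_cong)

text \<open>The functional with values n, n - 1, ..., 1 on the coordinates takes the value 1 on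
  consecutive differences, and 2, 1 or 3 on the last root for \<open>Sp\<close>,
  \<open>SO_odd\<close>, \<open>SO_even\<close>.\<close>

lemma simple_root_height_pos:
  assumes "k \<in> {1..n}" "t = SO_even \<Longrightarrow> n \<ge> 2"
  shows "(\<Sum>j = 1..n. (of_nat (n + 1) - of_nat j) * simple_root t n k j) > 0"
proof -
  let ?w = "\<lambda>j. of_nat (n + 1) - of_nat j :: rat"
  consider "k < n" | "k = n" "t = Sp" | "k = n" "t = SO_odd" | "k = n" "t = SO_even"
    using assms(1) by (cases t; cases "k = n") auto
  then show ?thesis
  proof cases
    case 1
    then have "(\<Sum>j = 1..n. ?w j * simple_root t n k j) =
        (\<Sum>j = 1..n. ?w j * epsilon k j) - (\<Sum>j = 1..n. ?w j * epsilon (k + 1) j)"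
      by (simp add: simple_root_def right_diff_distrib sum_subtractf)
    then show ?thesis using 1 assms(1) unfolding sum_epsilon by simp
  next
    case 2
    then have "(\<Sum>j = 1..n. ?w j * simple_root t n k j) = 2 * (\<Sum>j = 1..n. ?w j * epsilon n j)"
      by (simp add: simple_root_def sum_distrib_left mult_ac)
    then show ?thesis using 2 assms(1) unfolding sum_epsilon by simp
  next
    case 3
    then have "(\<Sum>j = 1..n. ?w j * simple_root t n k j) = (\<Sum>j = 1..n. ?w j * epsilon n j)"
      by (simp add: simple_root_def)
    then show ?thesis using 3 assms(1) unfolding sum_epsilon by simp
  next
    case 4
    then have "(\<Sum>j = 1..n. ?w j * simple_root t n k j) =
        (\<Sum>j = 1..n. ?w j * epsilon (n - 1) j) + (\<Sum>j = 1..n. ?w j * epsilon n j)"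
      by (simp add: simple_root_def distrib_left sum.distrib)
    then show ?thesis using 4 assms unfolding sum_epsilon by (auto simp: of_nat_diff)
  qed
qed

text \<open>A nonzero equivariant map is bijective and carries weights both ways, so x - y and y - x
  are both nonnegative combinations of simple roots. The combinations sum to 0, and the positive
  functional of \<open>simple_root_height_pos\<close> forces all their coefficients to
  vanish.\<close>

lemma highest_weight_unique:
  assumes "t = SO_even \<Longrightarrow> n \<ge> 2" and U: "irreducible_rep t n U" and W: "irreducible_rep t n W"
    and \<phi>: "equivariant t n U W \<phi>" and v: "v \<in> carrier_vec (fst U)" "\<phi> v \<noteq> 0\<^sub>v (fst W)"
    and x: "highest_weight t n U x" and y: "highest_weight t n W y" and j: "j \<in> {1..n}"
  shows "x j = y j"
proof -
  note ker = schur_lemma(1)[OF U W \<phi> v] and surj = schur_lemma(2)[OF U W \<phi> v]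
  have "has_weight t n W x" by (rule has_weight_image[OF \<phi> ker]) (use x in \<open>auto simp: highest_weight_def\<close>)
  then obtain c where c: "\<forall>j \<in> {1..n}. y j - x j = (\<Sum>k = 1..n. of_nat (c k) * simple_root t n k j)"
    using y unfolding highest_weight_def by blast
  have "has_weight t n U y"
    by (rule has_weight_preimage[OF \<phi> equivariant_inj_on[OF \<phi> ker] surj irreducible_repD(1)[OF U]])
      (use y in \<open>auto simp: highest_weight_def\<close>)
  then obtain d where d: "\<forall>j \<in> {1..n}. x j - y j = (\<Sum>k = 1..n. of_nat (d k) * simple_root t n k j)"
    using x unfolding highest_weight_def by blast
  define h where "h k = (\<Sum>j = 1..n. (of_nat (n + 1) - of_nat j) * simple_root t n k j)" for k
  have h: "h k > 0" if "k \<in> {1..n}" for k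
    unfolding h_def using simple_root_height_pos[of k n t] that assms(1) by blast
  have "0 = (\<Sum>j = 1..n. (of_nat (n + 1) - of_nat j) * ((y j - x j) + (x j - y j)))" by simp
  also have "\<dots> = (\<Sum>j = 1..n. (of_nat (n + 1) - of_nat j) * (\<Sum>k = 1..n. of_nat (c k + d k) * simple_root t n k j))"
  proof (rule sum.cong)
    fix j assume j: "j \<in> {1..n}"
    have "(y j - x j) + (x j - y j) =
        (\<Sum>k = 1..n. of_nat (c k) * simple_root t n k j) + (\<Sum>k = 1..n. of_nat (d k) * simple_root t n k j)"
      by (simp only: c[rule_format, OF j] d[rule_format, OF j])
    also have "\<dots> = (\<Sum>k = 1..n. of_nat (c k + d k) * simple_root t n k j)"
      by (simp only: of_nat_add distrib_right sum.distrib)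
    finally show "(of_nat (n + 1) - of_nat j) * ((y j - x j) + (x j - y j)) =
        (of_nat (n + 1) - of_nat j) * (\<Sum>k = 1..n. of_nat (c k + d k) * simple_root t n k j)"
      by (simp only:)
  qed simp
  also have "\<dots> = (\<Sum>k = 1..n. \<Sum>j = 1..n. (of_nat (n + 1) - of_nat j) * (of_nat (c k + d k) * simple_root t n k j))"
    unfolding sum_distrib_left by (rule sum.swap)
  also have "\<dots> = (\<Sum>k = 1..n. of_nat (c k + d k) * h k)"
    unfolding h_def sum_distrib_left by (simp only: mult.left_commute)
  finally have zero: "(\<Sum>k = 1..n. of_nat (c k + d k) * h k) = 0" by simp
  have nonneg: "of_nat (c k + d k) * h k \<ge> 0" if "k \<in> {1..n}" for k
    using h[OF that] by (intro mult_nonneg_nonneg) simp_all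
  have "c k = 0" if k: "k \<in> {1..n}" for k
  proof -
    have "of_nat (c k + d k) * h k = 0"
      using zero sum_nonneg_eq_0_iff[of "{1..n}" "\<lambda>k. of_nat (c k + d k) * h k"] nonneg k by blast
    then have "of_nat (c k + d k) = (0 :: rat)" using h[OF k] by simp
    then show ?thesis unfolding of_nat_eq_0_iff by simp
  qed
  then have "y j - x j = 0" using c j by simp
  then show ?thesis by simp
qed

section \<open>Partitions as weights\<close>

lemma sum_telescope_le:
  fixes p :: "nat \<Rightarrow> rat"
  assumes "j \<ge> 1"
  shows "(\<Sum>k = 1..n. (p (k - 1) - p k) * (if j \<le> k then 1 else 0)) = (if j \<le> n then p (j - 1) - p n else 0)"
proof (induction n)
  case (Suc n)
  then show ?case using assms by (cases "j \<le> n"; cases "j = Suc n") auto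
qed (use assms in auto)

text \<open>In the orthogonal cases, having few parts makes the coefficients of the spin weights
  vanish; the remaining fundamental weights are 1 on an initial segment of coordinates, so the sum
  telescopes.\<close>

lemma partition_weight_eq_part:
  assumes "num_parts \<mu> + (if t = Sp then 0 else if t = SO_even then 2 else 1) \<le> n" "j \<in> {1..n}"
  shows "partition_weight t n \<mu> j = of_nat (part \<mu> (j - 1))"
proof -
  have zero: "part \<mu> i = 0" if "n \<le> i + (if t = Sp then 0 else if t = SO_even then 2 else 1)" for i
    using that assms(1) by (intro part_eq_0) auto
  have "partition_weight t n \<mu> j =
      (\<Sum>k = 1..n. (of_nat (part \<mu> (k - 1)) - of_nat (part \<mu> k)) * (if j \<le> k then 1 else 0))"
    unfolding partition_weight_def
  proof (rule sum.cong)
    fix k assume k: "k \<in> {1..n}"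
    show "(of_nat (part \<mu> (k - 1)) - of_nat (part \<mu> k)) * fundamental_weight t n k j =
        (of_nat (part \<mu> (k - 1)) - of_nat (part \<mu> k)) * (if j \<le> k then 1 else 0)"
    proof (cases "t = SO_odd \<and> k = n \<or> t = SO_even \<and> (k = n \<or> k = n - 1)")
      case True
      then have "part \<mu> (k - 1) = 0" "part \<mu> k = 0" using k by (auto intro!: zero)
      then show ?thesis by simp
    next
      case False
      then show ?thesis by (auto simp: fundamental_weight_def)
    qed
  qed simp
  also have "\<dots> = of_nat (part \<mu> (j - 1))"
    using assms(2) zero[of n] by (subst sum_telescope_le) auto
  finally show ?thesis .
qed

text \<open>Here \<mu> may have up to n parts, and its orthogonal weight may then involve spin
  weights. One coordinate excludes this: where \<kappa> has 0, \<mu> has half a part.\<close>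

lemma partition_weight_inject:
  assumes \<mu>: "num_parts \<mu> \<le> n" and \<kappa>: "num_parts \<kappa> + (if t = SO_even then 2 else 1) \<le> n"
    and eq: "\<And>j. j \<in> {1..n} \<Longrightarrow> partition_weight t n \<mu> j = partition_weight t n \<kappa> j"
  shows "\<mu> = \<kappa>"
proof -
  have w\<kappa>: "partition_weight t n \<kappa> j = of_nat (part \<kappa> (j - 1))" if "j \<in> {1..n}" for j
    using \<kappa> that by (intro partition_weight_eq_part) auto
  have few: "num_parts \<mu> + (if t = Sp then 0 else if t = SO_even then 2 else 1) \<le> n"
  proof (cases t)
    case Sp
    then show ?thesis using \<mu> by simp
  next
    case SO_odd
    then obtain m where m: "n = Suc m" using \<kappa> by (cases n) auto
    \<comment> \<open>Among the fundamental weights only the last is nonzero in coordinate n, with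
      value 1/2.\<close>
    have "partition_weight t n \<mu> n = of_nat (part \<mu> m) / 2"
    proof -
      have "(\<Sum>k = 1..m. (of_nat (part \<mu> (k - 1)) - of_nat (part \<mu> k)) * fundamental_weight t n k n) = 0"
        by (rule sum.neutral) (auto simp: fundamental_weight_def SO_odd m)
      moreover have "part \<mu> n = 0" using \<mu> by (simp add: num_parts_le_iff)
      ultimately show ?thesis
        unfolding partition_weight_def by (simp add: m fundamental_weight_def SO_odd)
    qed
    moreover have "part \<kappa> m = 0" using \<kappa> by (intro part_eq_0) (simp add: m SO_odd)
    ultimately have "part \<mu> m = 0" using eq[of n] w\<kappa>[of n] by (simp add: m)
    then show ?thesis using SO_odd by (simp add: m num_parts_le_iff)
  next
    case SO_even
    then obtain m where m: "n = Suc (Suc m)" using \<kappa> by (cases n; cases "n - 1") auto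
    \<comment> \<open>Coordinate n - 1 is used because both spin weights are 1/2 there, so their
      coefficients telescope; in coordinate n they have opposite signs.\<close>
    have "partition_weight t n \<mu> (Suc m) = of_nat (part \<mu> m) / 2"
    proof -
      have "(\<Sum>k = 1..m. (of_nat (part \<mu> (k - 1)) - of_nat (part \<mu> k)) * fundamental_weight t n k (Suc m)) = 0"
        by (rule sum.neutral) (auto simp: fundamental_weight_def SO_even m)
      moreover have "part \<mu> (Suc (Suc m)) = 0" using \<mu> by (simp add: num_parts_le_iff m)
      ultimately show ?thesis
        unfolding partition_weight_def by (simp add: m fundamental_weight_def SO_even diff_divide_distrib)
    qed
    moreover have "part \<kappa> m = 0" using \<kappa> by (intro part_eq_0) (simp add: m SO_even)
    ultimately have "part \<mu> m = 0" using eq[of "Suc m"] w\<kappa>[of "Suc m"] by (simp add: m)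
    then show ?thesis using SO_even by (simp add: m num_parts_le_iff)
  qed
  show ?thesis
  proof (rule partition_eqI)
    fix i
    show "part \<mu> i = part \<kappa> i"
    proof (cases "i < n")
      case True
      then show ?thesis using eq[of "Suc i"] w\<kappa>[of "Suc i"] partition_weight_eq_part[OF few, of "Suc i"] by simp
    next
      case False
      then show ?thesis using \<mu> \<kappa> part_eq_0[of \<mu> i] part_eq_0[of \<kappa> i] by simp
    qed
  qed
qed

lemma group_weight_few_parts:
  assumes "num_parts \<kappa> + (if t = SO_even then 2 else 1) \<le> n"
  shows "group_weight t n \<kappa>"
proof -
  have "partition_weight t n \<kappa> j \<in> \<int>" if "j \<in> {1..n}" for j
    by (subst partition_weight_eq_part) (use assms that in \<open>auto split: if_splits\<close>)
  then show ?thesis using assms by (simp add: group_weight_def)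
qed

text \<open>The two partitions play different roles: \<kappa> comes from a summand of W and has few
  parts, while \<mu> is any weight of the group.\<close>

lemma irrep_family_equivariant_eq:
  assumes V: "irrep_family t n V" and \<mu>: "group_weight t n \<mu>"
    and \<kappa>: "num_parts \<kappa> + (if t = SO_even then 2 else 1) \<le> n"
    and \<phi>: "equivariant t n (V \<mu>) (V \<kappa>) \<phi>" "v \<in> carrier_vec (fst (V \<mu>))" "\<phi> v \<noteq> 0\<^sub>v (fst (V \<kappa>))"
  shows "\<mu> = \<kappa>"
proof (rule partition_weight_inject[OF _ \<kappa>])
  show "num_parts \<mu> \<le> n" using \<mu> by (simp add: group_weight_def)
  show "partition_weight t n \<mu> j = partition_weight t n \<kappa> j" if "j \<in> {1..n}" for j
  proof (rule highest_weight_unique[OF _ _ _ \<phi>])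
    show "n \<ge> 2" if "t = SO_even" using \<kappa> that by simp
  qed (use V \<mu> group_weight_few_parts[OF \<kappa>] that in \<open>auto simp: irrep_family_def\<close>)
qed

section \<open>Multiplicities\<close>

definition invariants :: "classical_type \<Rightarrow> nat \<Rightarrow> rep \<Rightarrow> complex vec set" where
  "invariants t n W = {w \<in> carrier_vec (fst W). \<forall>g \<in> classical_group t n. snd W g *\<^sub>v w = w}"

lemma equivariant_invariants:
  assumes "equivariant t n U W \<phi>" "u \<in> invariants t n U"
  shows "\<phi> u \<in> invariants t n W"
proof -
  have u: "u \<in> carrier_vec (fst U)" and inv: "snd U g *\<^sub>v u = u" if "g \<in> classical_group t n" for g
    using assms(2) that by (auto simp: invariants_def)
  have "snd W g *\<^sub>v \<phi> u = \<phi> u" if "g \<in> classical_group t n" for g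
    using equivariantD(4)[OF assms(1) that u[OF that]] inv[OF that] by simp
  moreover have "\<phi> u \<in> carrier_vec (fst W)"
    using equivariantD(1)[OF assms(1)] assms(2) by (simp add: invariants_def)
  ultimately show ?thesis by (simp add: invariants_def)
qed

lemma append_invariants:
  assumes "matrices_in_dim t n U" "matrices_in_dim t n (direct_sum Us)"
    "v \<in> invariants t n U" "w \<in> invariants t n (direct_sum Us)"
  shows "v @\<^sub>v w \<in> invariants t n (direct_sum (U # Us))"
  using assms snd_direct_sum_Cons[OF assms(1,2)]
  by (auto simp: invariants_def fst_direct_sum_Cons)

lemma zero_invariants:
  assumes "matrices_in_dim t n U"
  shows "0\<^sub>v (fst U) \<in> invariants t n U"
proof -
  have "snd U g *\<^sub>v 0\<^sub>v (fst U) = 0\<^sub>v (fst U)" if "g \<in> classical_group t n" for g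
  proof -
    have "snd U g \<in> carrier_mat (fst U) (fst U)" using assms that by (simp add: matrices_in_dim_def)
    then show ?thesis by auto
  qed
  then show ?thesis by (simp add: invariants_def)
qed

text \<open>Injectivity of the given isomorphism bounds the dimension by 1 and pulls the trivial
  action back; irreducibility makes the dimension positive.\<close>

lemma irrep_family_empty:
  assumes V: "irrep_family t n V"
  shows "fst (V empty_partition) = 1"
    and "invariants t n (V empty_partition) = carrier_vec 1"
proof -
  let ?U = "V empty_partition"
  have gw: "group_weight t n empty_partition"
  proof -
    have "num_parts empty_partition = 0" using num_parts_le_iff[of empty_partition 0] by simp
    then show ?thesis by (simp add: group_weight_def partition_weight_def)
  qed
  then have irr: "irreducible_rep t n ?U" using V by (simp add: irrep_family_def)
  obtain A where A: "intertwiner t n ?U trivial_rep A"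
    and bij: "bij_betw (\<lambda>v. A *\<^sub>v v) (carrier_vec (fst ?U)) (carrier_vec 1)"
    using V by (auto simp: irrep_family_def rep_iso_def trivial_rep_def)
  have A1: "A \<in> carrier_mat 1 (fst ?U)" using A by (simp add: intertwiner_def trivial_rep_def)
  have inj: "inj_on (\<lambda>v. A *\<^sub>v v) (carrier_vec (fst ?U))" using bij by (simp add: bij_betw_def)
  show d: "fst ?U = 1"
    using injective_dim_le[OF A1 inj] irreducible_repD(2)[OF irr] by simp
  have "snd ?U g *\<^sub>v v = v" if g: "g \<in> classical_group t n" and v: "v \<in> carrier_vec 1" for g v
  proof (rule inj_onD[OF inj])
    have gm: "snd ?U g \<in> carrier_mat (fst ?U) (fst ?U)"
      using irreducible_repD(1)[OF irr] g by (simp add: matrices_in_dim_def)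
    have "A * snd ?U g = A" using A g A1 by (simp add: intertwiner_def trivial_rep_def)
    then show "A *\<^sub>v (snd ?U g *\<^sub>v v) = A *\<^sub>v v"
      using assoc_mult_mat_vec[OF A1 gm, of v] v d by simp
    show "snd ?U g *\<^sub>v v \<in> carrier_vec (fst ?U)" using mult_mat_vec_carrier[OF gm, of v] v d by simp
  qed (use v d in simp)
  then show "invariants t n ?U = carrier_vec 1" by (auto simp: invariants_def d)
qed

text \<open>An invariant vector w gives the equivariant map that sends a scalar c in V(0) to c w; if
  w were nonzero, the highest weights would agree.\<close>

lemma invariants_nontrivial_irrep:
  assumes V: "irrep_family t n V" and \<kappa>: "num_parts \<kappa> + (if t = SO_even then 2 else 1) \<le> n"
    and ne: "\<kappa> \<noteq> empty_partition" and w: "w \<in> invariants t n (V \<kappa>)"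
  shows "w = 0\<^sub>v (fst (V \<kappa>))"
proof (rule ccontr)
  assume "w \<noteq> 0\<^sub>v (fst (V \<kappa>))"
  let ?U = "V empty_partition"
  note E = irrep_family_empty[OF V]
  have gw: "group_weight t n empty_partition"
  proof (rule group_weight_few_parts)
    have "num_parts empty_partition = 0" using num_parts_le_iff[of empty_partition 0] by simp
    then show "num_parts empty_partition + (if t = SO_even then 2 else 1) \<le> n" using \<kappa> by simp
  qed
  have wc: "w \<in> carrier_vec (fst (V \<kappa>))" and wi: "\<And>g. g \<in> classical_group t n \<Longrightarrow> snd (V \<kappa>) g *\<^sub>v w = w"
    using w by (auto simp: invariants_def)
  have m: "matrices_in_dim t n (V \<kappa>)"
    using V group_weight_few_parts[OF \<kappa>] by (auto simp: irrep_family_def intro: irreducible_repD)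
  have \<phi>: "equivariant t n ?U (V \<kappa>) (\<lambda>v. v $ 0 \<cdot>\<^sub>v w)"
  proof -
    have "snd ?U g *\<^sub>v v = v" if "g \<in> classical_group t n" "v \<in> carrier_vec 1" for g v
      using E that by (auto simp: invariants_def)
    moreover have "snd (V \<kappa>) g *\<^sub>v (c \<cdot>\<^sub>v w) = c \<cdot>\<^sub>v w" if g: "g \<in> classical_group t n" for g c
    proof -
      have "snd (V \<kappa>) g \<in> carrier_mat (fst (V \<kappa>)) (fst (V \<kappa>))" using m g by (simp add: matrices_in_dim_def)
      then show ?thesis using mult_mat_vec[of "snd (V \<kappa>) g" _ _ w c] wc wi[OF g] by simp
    qed
    moreover have "(a + b) \<cdot>\<^sub>v w = a \<cdot>\<^sub>v w + b \<cdot>\<^sub>v w" for a b by (rule add_smult_distrib_vec)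
    ultimately show ?thesis using wc E(1) by (simp add: equivariant_def smult_smult_assoc)
  qed
  have "empty_partition = \<kappa>"
    by (rule irrep_family_equivariant_eq[OF V gw \<kappa> \<phi>, of "unit_vec 1 0"])
      (use E(1) \<open>w \<noteq> _\<close> in auto)
  then show False using ne by simp
qed

text \<open>Says that the invariants have dimension at most one, in the form of a single coordinate
  that detects 0. Components in nontrivial summands vanish, so this is the coordinate of the trivial
  summand.\<close>

lemma direct_sum_invariants_coordinate:
  assumes V: "irrep_family t n V"
    and ps: "\<And>\<kappa>. \<kappa> \<in> set ps \<Longrightarrow> num_parts \<kappa> + (if t = SO_even then 2 else 1) \<le> n"
  shows "count_list ps empty_partition = 0 \<Longrightarrow> w \<in> invariants t n (direct_sum (map V ps)) \<Longrightarrow>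
      w = 0\<^sub>v (fst (direct_sum (map V ps)))"
    and "count_list ps empty_partition = 1 \<Longrightarrow> \<exists>i < fst (direct_sum (map V ps)).
      \<forall>w \<in> invariants t n (direct_sum (map V ps)). w $ i = 0 \<longrightarrow> w = 0\<^sub>v (fst (direct_sum (map V ps)))"
  using ps
proof (induction ps arbitrary: w)
  case Nil
  {
    case 1
    then show ?case by (auto simp: invariants_def direct_sum_Nil)
  next
    case 2
    then show ?case by simp
  }
next
  case (Cons \<kappa> ps)
  let ?Us = "map V ps" and ?D = "direct_sum (map V (\<kappa> # ps))"
  let ?d = "fst (V \<kappa>)" and ?e = "fst (direct_sum ?Us)"
  have irr: "matrices_in_dim t n (V \<kappa>')"
    if "num_parts \<kappa>' + (if t = SO_even then 2 else 1) \<le> n" for \<kappa>'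
    using V group_weight_few_parts[OF that] by (auto simp: irrep_family_def intro: irreducible_repD)
  have split: "vec_first w ?d \<in> invariants t n (V \<kappa>)" "vec_last w ?e \<in> invariants t n (direct_sum ?Us)"
      "w = vec_first w ?d @\<^sub>v vec_last w ?e"
    if few: "\<And>\<kappa>'. \<kappa>' \<in> set (\<kappa> # ps) \<Longrightarrow> num_parts \<kappa>' + (if t = SO_even then 2 else 1) \<le> n"
      and w: "w \<in> invariants t n ?D" for w
  proof -
    have m: "matrices_in_dim t n (V \<kappa>)" "matrices_in_dim t n (direct_sum ?Us)"
      using few by (auto intro!: irr matrices_in_dim_direct_sum)
    show "vec_first w ?d \<in> invariants t n (V \<kappa>)" "vec_last w ?e \<in> invariants t n (direct_sum ?Us)"
      using equivariant_invariants[OF equivariant_vec_first[OF m]] equivariant_invariants[OF equivariant_vec_last[OF m]] w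
      by auto
    have "w \<in> carrier_vec (?d + ?e)" using w by (simp add: invariants_def fst_direct_sum_Cons)
    then show "w = vec_first w ?d @\<^sub>v vec_last w ?e" by simp
  qed
  have zero: "(0\<^sub>v ?d @\<^sub>v 0\<^sub>v ?e :: complex vec) = 0\<^sub>v (fst ?D)"
    by (auto simp: fst_direct_sum_Cons)
  {
    case 1
    have ne: "\<kappa> \<noteq> empty_partition" and c: "count_list ps empty_partition = 0"
      using 1(1) by (auto split: if_splits)
    have "vec_first w ?d = 0\<^sub>v ?d"
      by (rule invariants_nontrivial_irrep[OF V _ ne split(1)[OF 1(3,2)]]) (use 1(3) in auto)
    moreover have "vec_last w ?e = 0\<^sub>v ?e"
      using Cons.IH(1)[OF c split(2)[OF 1(3,2)]] 1(3) by auto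
    ultimately show ?case using split(3)[OF 1(3,2)] zero by simp
  next
    case 2
    show ?case
    proof (cases "\<kappa> = empty_partition")
      case True
      then have c: "count_list ps empty_partition = 0" using 2(1) by simp
      have d: "?d = 1" using irrep_family_empty(1)[OF V] True by simp
      have "w = 0\<^sub>v (fst ?D)" if w: "w \<in> invariants t n ?D" "w $ 0 = 0" for w
      proof -
        have "vec_first w ?d = 0\<^sub>v ?d"
          using w(2) by (intro eq_vecI) (auto simp: vec_first_def d)
        moreover have "vec_last w ?e = 0\<^sub>v ?e"
          using Cons.IH(1)[OF c split(2)[OF 2(2) w(1)]] 2(2) by auto
        ultimately show ?thesis using split(3)[OF 2(2) w(1)] zero by simp
      qed
      then show ?thesis using d by (intro exI[of _ 0]) (auto simp: fst_direct_sum_Cons)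
    next
      case False
      then have "count_list ps empty_partition = 1" using 2(1) by simp
      then obtain i where i: "i < ?e"
        "\<And>w. w \<in> invariants t n (direct_sum ?Us) \<Longrightarrow> w $ i = 0 \<Longrightarrow> w = 0\<^sub>v ?e"
        using Cons.IH(2) 2(2) by auto
      have "w = 0\<^sub>v (fst ?D)" if w: "w \<in> invariants t n ?D" "w $ (?d + i) = 0" for w
      proof -
        have "vec_first w ?d = 0\<^sub>v ?d"
          by (rule invariants_nontrivial_irrep[OF V _ False split(1)[OF 2(2) w(1)]]) (use 2(2) in auto)
        moreover have "dim_vec w = ?d + ?e" using w(1) by (simp add: invariants_def fst_direct_sum_Cons)
        then have "vec_last w ?e $ i = 0" using w(2) i(1) by (simp add: vec_last_def)
        then have "vec_last w ?e = 0\<^sub>v ?e" using i(2) split(2)[OF 2(2) w(1)] by simp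
        ultimately show ?thesis using split(3)[OF 2(2) w(1)] zero by simp
      qed
      then show ?thesis using i(1) by (intro exI[of _ "?d + i"]) (auto simp: fst_direct_sum_Cons)
    qed
  }
qed

lemma direct_sum_invariants_nonzero:
  assumes V: "irrep_family t n V" and "empty_partition \<in> set ps"
    and ps: "\<And>\<kappa>. \<kappa> \<in> set ps \<Longrightarrow> matrices_in_dim t n (V \<kappa>)"
  obtains w where "w \<in> invariants t n (direct_sum (map V ps))" "w \<noteq> 0\<^sub>v (fst (direct_sum (map V ps)))"
  using assms(2-)
proof (induction ps arbitrary: thesis)
  case Nil
  then show ?case by simp
next
  case (Cons \<kappa> ps)
  let ?Us = "map V ps"
  let ?d = "fst (V \<kappa>)" and ?e = "fst (direct_sum ?Us)"
  have m: "matrices_in_dim t n (V \<kappa>)" "matrices_in_dim t n (direct_sum ?Us)"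
    using Cons.prems(3) by (auto intro!: matrices_in_dim_direct_sum)
  have zero: "0\<^sub>v (?d + ?e) = (0\<^sub>v ?d @\<^sub>v 0\<^sub>v ?e :: complex vec)" by auto
  show ?case
  proof (cases "\<kappa> = empty_partition")
    case True
    then have d: "?d = 1" and inv: "unit_vec 1 0 \<in> invariants t n (V \<kappa>)"
      using irrep_family_empty[OF V] by auto
    have "unit_vec 1 0 @\<^sub>v 0\<^sub>v ?e \<noteq> (0\<^sub>v (?d + ?e) :: complex vec)"
    proof
      assume "unit_vec 1 0 @\<^sub>v 0\<^sub>v ?e = (0\<^sub>v (?d + ?e) :: complex vec)"
      from arg_cong[OF this, of "\<lambda>v. v $ 0"] show False by (simp add: d)
    qed
    then show ?thesis
      using Cons.prems(1) append_invariants[OF m inv zero_invariants[OF m(2)]] by (simp add: fst_direct_sum_Cons)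
  next
    case False
    then have "empty_partition \<in> set ps" using Cons.prems(2) by simp
    then obtain w where w: "w \<in> invariants t n (direct_sum ?Us)" "w \<noteq> 0\<^sub>v ?e"
      using Cons.IH Cons.prems(3) by auto
    have "0\<^sub>v ?d @\<^sub>v w \<noteq> 0\<^sub>v (?d + ?e)"
      unfolding zero using w(2) append_vec_eq[of "0\<^sub>v ?d" ?d "0\<^sub>v ?d" w "0\<^sub>v ?e"] by simp
    then show ?thesis
      using Cons.prems(1) append_invariants[OF m zero_invariants[OF m(1)] w(1)] by (simp add: fst_direct_sum_Cons)
  qed
qed

section \<open>Multiplicity as a maximum over embeddings\<close>

lemma direct_sum_replicate_trivial: "direct_sum (replicate m trivial_rep) = (m, \<lambda>_. 1\<^sub>m m)"
proof -
  have "diag_block_mat (replicate m (1\<^sub>m 1)) = (1\<^sub>m m :: complex mat)"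
    by (induction m) (auto simp: Let_def intro!: eq_matI)
  then show ?thesis by (simp add: direct_sum_def trivial_rep_def sum_list_replicate)
qed

text \<open>Zero copies always embed, so the set whose maximum is the multiplicity is
  nonempty.\<close>

lemma rep_embeds_zero:
  assumes "matrices_in_dim t n W"
  shows "rep_embeds t n (direct_sum (replicate 0 U)) W"
proof -
  have "intertwiner t n (direct_sum []) W (0\<^sub>m (fst W) 0)"
    using assms unfolding intertwiner_def direct_sum_Nil matrices_in_dim_def by (auto intro!: eq_matI)
  moreover have "inj_on (\<lambda>v. 0\<^sub>m (fst W) 0 *\<^sub>v v :: complex vec) (carrier_vec 0)"
    by (rule inj_onI) (metis carrier_vecD vec_of_dim_0)
  ultimately show ?thesis unfolding rep_embeds_def by (auto simp: direct_sum_Nil)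
qed

text \<open>An embedding of m trivial copies has its image among the invariants, which bounds m by
  the number of trivial summands; conversely a nonzero invariant vector embeds one copy.\<close>

lemma multiplicity_trivial:
  assumes V: "irrep_family t n V"
    and ps: "\<And>\<kappa>. \<kappa> \<in> set ps \<Longrightarrow> num_parts \<kappa> + (if t = SO_even then 2 else 1) \<le> n"
    and c: "count_list ps empty_partition \<le> 1"
  shows "multiplicity_in t n trivial_rep (direct_sum (map V ps)) = count_list ps empty_partition"
proof -
  let ?W = "direct_sum (map V ps)" and ?c = "count_list ps empty_partition"
  let ?M = "{m. rep_embeds t n (direct_sum (replicate m trivial_rep)) ?W}"
  have mV: "matrices_in_dim t n (V \<kappa>)" if "\<kappa> \<in> set ps" for \<kappa>
    using V group_weight_few_parts[OF ps[OF that]] by (auto simp: irrep_family_def intro: irreducible_repD)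
  then have mW: "matrices_in_dim t n ?W" by (intro matrices_in_dim_direct_sum) auto
  have le: "m \<le> ?c" if "m \<in> ?M" for m
  proof (rule ccontr)
    assume "\<not> m \<le> ?c"
    from that obtain A where "intertwiner t n (m, \<lambda>_. 1\<^sub>m m) ?W A"
      and "inj_on (\<lambda>v. A *\<^sub>v v) (carrier_vec (fst (m, \<lambda>_ :: complex mat. 1\<^sub>m m :: complex mat)))"
      unfolding mem_Collect_eq rep_embeds_def direct_sum_replicate_trivial by blast
    then have A: "A \<in> carrier_mat (fst ?W) m" "\<And>g. g \<in> classical_group t n \<Longrightarrow> A * 1\<^sub>m m = snd ?W g * A"
      and inj: "inj_on (\<lambda>v. A *\<^sub>v v) (carrier_vec m)"
      by (simp_all only: intertwiner_def fst_conv snd_conv)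
    have inv: "A *\<^sub>v v \<in> invariants t n ?W" if v: "v \<in> carrier_vec m" for v
    proof -
      have "snd ?W g *\<^sub>v (A *\<^sub>v v) = A *\<^sub>v v" if g: "g \<in> classical_group t n" for g
      proof -
        have "snd ?W g \<in> carrier_mat (fst ?W) (fst ?W)" using mW g by (simp add: matrices_in_dim_def)
        then have "snd ?W g *\<^sub>v (A *\<^sub>v v) = (snd ?W g * A) *\<^sub>v v"
          using A(1) v by (simp add: assoc_mult_mat_vec[of _ "fst ?W" "fst ?W" _ m])
        also have "snd ?W g * A = A" using A(2)[OF g] A(1) by simp
        finally show ?thesis .
      qed
      then show ?thesis using A(1) v by (auto simp: invariants_def)
    qed
    have A0: "A *\<^sub>v 0\<^sub>v m = 0\<^sub>v (fst ?W)" using A(1) by auto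
    have nz: "v = 0\<^sub>v m" if "v \<in> carrier_vec m" "A *\<^sub>v v = 0\<^sub>v (fst ?W)" for v
      using inj_onD[OF inj, of v "0\<^sub>v m"] that A0 by simp
    have e: "unit_vec m j \<noteq> (0\<^sub>v m :: complex vec)" if "j < m" for j
      using that by (simp add: unit_vec_nonzero)
    consider "?c = 0" "m \<ge> 1" | "?c = 1" "m \<ge> 2" using c \<open>\<not> m \<le> ?c\<close> by linarith
    then show False
    proof cases
      case 1
      then have "A *\<^sub>v unit_vec m 0 = 0\<^sub>v (fst ?W)"
        using direct_sum_invariants_coordinate(1)[OF V ps _ inv] by simp
      then show False using nz e[of 0] 1 by simp
    next
      case 2
      obtain i where i: "i < fst ?W" "\<And>w. w \<in> invariants t n ?W \<Longrightarrow> w $ i = 0 \<Longrightarrow> w = 0\<^sub>v (fst ?W)"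
        using direct_sum_invariants_coordinate(2)[OF V ps 2(1)] by blast
      define a where "a = (A *\<^sub>v unit_vec m 0) $ i"
      define b where "b = (A *\<^sub>v unit_vec m 1) $ i"
      \<comment> \<open>The combination is chosen so that coordinate i of its image is b a - a b =
        0.\<close>
      define v where "v = b \<cdot>\<^sub>v unit_vec m 0 + (- a) \<cdot>\<^sub>v unit_vec m 1"
      have v: "v \<in> carrier_vec m" by (simp add: v_def)
      have "A *\<^sub>v v = b \<cdot>\<^sub>v (A *\<^sub>v unit_vec m 0) + (- a) \<cdot>\<^sub>v (A *\<^sub>v unit_vec m 1)"
        unfolding v_def using A(1)
        by (simp add: mult_add_distrib_mat_vec[of _ "fst ?W" m] mult_mat_vec[of _ "fst ?W" m])
      then have "(A *\<^sub>v v) $ i = b * a + (- a) * b"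
        using A(1) i(1) by (simp add: a_def b_def del: index_mult_mat_vec)
      then have "A *\<^sub>v v = 0\<^sub>v (fst ?W)" using i(2) inv[OF v] by simp
      then have v0: "v = 0\<^sub>v m" using nz v by simp
      \<comment> \<open>Entry 1 of v is - a. Once a = 0, coordinate i shows that A kills the first
        unit vector, against injectivity.\<close>
      have "a = 0" using arg_cong[OF v0, of "\<lambda>v. v $ 1"] 2(2) by (simp add: v_def)
      then have "A *\<^sub>v unit_vec m 0 = 0\<^sub>v (fst ?W)" using i(2) inv[of "unit_vec m 0"] by (simp add: a_def)
      then show False using nz e[of 0] 2 by simp
    qed
  qed
  have "?c \<in> ?M"
  proof (cases "?c = 0")
    case True
    then show ?thesis using rep_embeds_zero[OF mW] by simp
  next
    case False
    then have "empty_partition \<in> set ps" by (metis count_notin)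
    then obtain w where w: "w \<in> invariants t n ?W" "w \<noteq> 0\<^sub>v (fst ?W)"
      using direct_sum_invariants_nonzero[OF V _ mV] by blast
    have wc: "w \<in> carrier_vec (fst ?W)" using w(1) by (simp add: invariants_def)
    define A where "A = mat_of_cols (fst ?W) [w]"
    have A: "A \<in> carrier_mat (fst ?W) 1" using mat_of_cols_carrier(1)[of "fst ?W" "[w]"] by (simp add: A_def)
    have col: "col A 0 = w" using wc by (simp add: A_def)
    have entry: "A $$ (i, 0) = w $ i" if "i < fst ?W" for i
      using that by (simp add: A_def mat_of_cols_def)
    have "A * 1\<^sub>m 1 = snd ?W g * A" if g: "g \<in> classical_group t n" for g
    proof (rule eq_matI)
      have gm: "snd ?W g \<in> carrier_mat (fst ?W) (fst ?W)" using mW g by (simp add: matrices_in_dim_def)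
      show "dim_row (A * 1\<^sub>m 1) = dim_row (snd ?W g * A)" "dim_col (A * 1\<^sub>m 1) = dim_col (snd ?W g * A)"
        using A gm by auto
      fix i j assume "i < dim_row (snd ?W g * A)" "j < dim_col (snd ?W g * A)"
      then have ij: "i < fst ?W" "j = 0" using A gm by auto
      have "(snd ?W g * A) $$ (i, j) = (snd ?W g *\<^sub>v w) $ i" using ij A gm col by simp
      also have "snd ?W g *\<^sub>v w = w" using w(1) g by (simp add: invariants_def)
      also have "w $ i = A $$ (i, j)" using ij entry by simp
      finally show "(A * 1\<^sub>m 1) $$ (i, j) = (snd ?W g * A) $$ (i, j)" using A by simp
    qed
    then have "intertwiner t n (direct_sum (replicate 1 trivial_rep)) ?W A"
      using A unfolding intertwiner_def direct_sum_replicate_trivial by simp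
    moreover have "inj_on (\<lambda>v. A *\<^sub>v v) (carrier_vec 1)"
    proof (rule inj_onI)
      fix u v :: "complex vec" assume uv: "u \<in> carrier_vec 1" "v \<in> carrier_vec 1" and eq: "A *\<^sub>v u = A *\<^sub>v v"
      obtain i where i: "i < fst ?W" "w $ i \<noteq> 0"
      proof (rule ccontr)
        assume "\<not> thesis"
        then have "w = 0\<^sub>v (fst ?W)" using that wc by (intro eq_vecI) auto
        then show False using w(2) by simp
      qed
      have Ax: "(A *\<^sub>v x) $ i = w $ i * x $ 0" if "x \<in> carrier_vec 1" for x
      proof -
        have "A $$ (i, 0) = w $ i" by (rule entry[OF i(1)])
        then show ?thesis using A i(1) that by (simp add: scalar_prod_def)
      qed
      have "u $ 0 = v $ 0" using Ax[OF uv(1)] Ax[OF uv(2)] eq i(2) by simp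
      then show "u = v" using uv by (intro eq_vecI) auto
    qed
    moreover have "?c = 1" using False c by linarith
    ultimately show ?thesis
      unfolding mem_Collect_eq rep_embeds_def direct_sum_replicate_trivial by (intro exI[of _ A]) simp
  qed
  moreover have "finite ?M" using le by (auto simp: finite_nat_set_iff_bounded_le)
  ultimately show ?thesis unfolding multiplicity_in_def using le by (intro Max_eqI) auto
qed

text \<open>A maximum over a finite nonempty set is attained, so a nonzero multiplicity yields an
  actual embedding. Restricting it to the first copy and projecting to a suitable summand gives a
  nonzero map between irreducibles.\<close>

lemma appears_in_direct_sum:
  assumes V: "irrep_family t n V"
    and ps: "\<And>\<kappa>. \<kappa> \<in> set ps \<Longrightarrow> num_parts \<kappa> + (if t = SO_even then 2 else 1) \<le> n"
    and \<mu>: "group_weight t n \<mu>" and app: "appears_in t n (V \<mu>) (direct_sum (map V ps))"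
  shows "\<mu> \<in> set ps"
proof -
  let ?W = "direct_sum (map V ps)" and ?d = "fst (V \<mu>)"
  let ?M = "{m. rep_embeds t n (direct_sum (replicate m (V \<mu>))) ?W}"
  have irr: "irreducible_rep t n (V \<mu>)" using V \<mu> by (simp add: irrep_family_def)
  note mU = irreducible_repD(1)[OF irr] and d = irreducible_repD(2)[OF irr]
  have mV: "matrices_in_dim t n (V \<kappa>)" if "\<kappa> \<in> set ps" for \<kappa>
    using V group_weight_few_parts[OF ps[OF that]] by (auto simp: irrep_family_def intro: irreducible_repD)
  then have mW: "matrices_in_dim t n ?W" by (intro matrices_in_dim_direct_sum) auto
  have dim: "fst (direct_sum (replicate m (V \<mu>))) = m * ?d" for m
    by (simp add: direct_sum_def sum_list_replicate)
  \<comment> \<open>Without a bound on the number of copies \<open>Max\<close> would carry no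
    information; injectivity and positive dimension supply one.\<close>
  have "m \<le> fst ?W" if "m \<in> ?M" for m
  proof -
    from that obtain A :: "complex mat" where "A \<in> carrier_mat (fst ?W) (m * ?d)" "inj_on (\<lambda>v. A *\<^sub>v v) (carrier_vec (m * ?d))"
      unfolding mem_Collect_eq rep_embeds_def intertwiner_def dim by blast
    then have "m * ?d \<le> fst ?W" by (rule injective_dim_le)
    moreover have "m \<le> m * ?d" using d by simp
    ultimately show ?thesis by linarith
  qed
  then have "finite ?M" by (auto simp: finite_nat_set_iff_bounded_le)
  moreover have "0 \<in> ?M" using rep_embeds_zero[OF mW] by blast
  ultimately have "Max ?M \<in> ?M" using Max_in[of ?M] by blast
  moreover have "Max ?M \<noteq> 0" using app by (simp only: appears_in_def multiplicity_in_def simp_thms)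
  then obtain m where "Max ?M = Suc m" using not0_implies_Suc by blast
  ultimately have "rep_embeds t n (direct_sum (V \<mu> # replicate m (V \<mu>))) ?W" by simp
  then obtain A where A: "intertwiner t n (direct_sum (V \<mu> # replicate m (V \<mu>))) ?W A"
    and inj: "inj_on (\<lambda>v. A *\<^sub>v v) (carrier_vec (fst (direct_sum (V \<mu> # replicate m (V \<mu>)))))"
    by (auto simp: rep_embeds_def)
  let ?Us = "replicate m (V \<mu>)"
  have mUs: "matrices_in_dim t n (direct_sum ?Us)" "matrices_in_dim t n (direct_sum (V \<mu> # ?Us))"
    by (rule matrices_in_dim_direct_sum; use mU in auto)+
  have \<phi>: "equivariant t n (V \<mu>) ?W (\<lambda>v. A *\<^sub>v (v @\<^sub>v 0\<^sub>v (fst (direct_sum ?Us))))"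
    by (rule equivariant_comp[OF equivariant_append_zero[OF mU mUs(1)] intertwiner_equivariant[OF A mUs(2) mW]])
  let ?u = "unit_vec ?d 0 :: complex vec" and ?z = "0\<^sub>v (fst (direct_sum ?Us)) :: complex vec"
  have nz: "A *\<^sub>v (?u @\<^sub>v ?z) \<noteq> 0\<^sub>v (fst ?W)"
  proof
    assume "A *\<^sub>v (?u @\<^sub>v ?z) = 0\<^sub>v (fst ?W)"
    also have "\<dots> = A *\<^sub>v (0\<^sub>v ?d @\<^sub>v ?z)"
      using equivariant_zero[OF \<phi>] by simp
    finally have "?u @\<^sub>v ?z = 0\<^sub>v ?d @\<^sub>v ?z"
      by (rule inj_onD[OF inj]) (auto simp: fst_direct_sum_Cons)
    then have "?u = 0\<^sub>v ?d" by (subst (asm) append_vec_eq[of _ ?d]) auto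
    then show False using d by (simp add: unit_vec_nonzero)
  qed
  have mX: "matrices_in_dim t n X" if "X \<in> set (map V ps)" for X using that mV by auto
  obtain X \<psi> where X: "X \<in> set (map V ps)" "equivariant t n (V \<mu>) X \<psi>" "\<psi> ?u \<noteq> 0\<^sub>v (fst X)"
    by (rule equivariant_to_direct_sum[OF \<phi> unit_vec_carrier nz mX])
  then obtain \<kappa> where \<kappa>: "\<kappa> \<in> set ps" "X = V \<kappa>" by auto
  have "\<mu> = \<kappa>"
    by (rule irrep_family_equivariant_eq[OF V \<mu> ps[OF \<kappa>(1)], of \<psi> ?u]) (use X \<kappa> in auto)
  then show ?thesis using \<kappa> by simp
qed

section \<open>Simple root coefficients\<close>

text \<open>Coordinate j meets only the roots j - 1 and j, apart from the last root, which is kept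
  separate because its form depends on the type.\<close>

lemma sum_simple_roots:
  assumes "j \<in> {1..n}"
  shows "(\<Sum>k = 1..n. c k * simple_root t n k j) =
    (if j < n then c j else 0) - (if j \<ge> 2 then c (j - 1) else 0) + c n * simple_root t n n j"
proof -
  have "{1..n} = insert n {1..<n}" using assms by auto
  then have "(\<Sum>k = 1..n. c k * simple_root t n k j) =
      c n * simple_root t n n j + (\<Sum>k = 1..<n. c k * simple_root t n k j)" by simp
  also have "(\<Sum>k = 1..<n. c k * simple_root t n k j) = (\<Sum>k = 1..<n. c k * epsilon k j - c k * epsilon (k + 1) j)"
    by (intro sum.cong) (auto simp: simple_root_def right_diff_distrib)
  also have "\<dots> = (\<Sum>k = 1..<n. c k * epsilon k j) - (\<Sum>k = 1..<n. c k * epsilon (k + 1) j)"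
    by (rule sum_subtractf)
  also have "(\<Sum>k = 1..<n. c k * epsilon k j) = (\<Sum>k = 1..<n. if k = j then c k else 0)"
    by (intro sum.cong) (auto simp: epsilon_def)
  also have "(\<Sum>k = 1..<n. c k * epsilon (k + 1) j) = (\<Sum>k = 1..<n. if k = j - 1 then c k else 0)"
    using assms by (intro sum.cong) (auto simp: epsilon_def)
  finally show ?thesis using assms by (auto simp: not_less)
qed

text \<open>The sum of coordinates vanishes on every simple root but the last, where it is 1 or 2,
  so it isolates \<open>c n\<close>. For \<open>SO_even\<close> the last coordinate sees only the
  two spin nodes, with opposite signs.\<close>

lemma root_coefficients_last:
  assumes "root_coefficients t n x c" "n \<ge> (if t = SO_even then 2 else 1)"
  shows "(\<Sum>j = 1..n. x j) = (if t = SO_odd then 1 else 2) * c n"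
    and "t = SO_even \<Longrightarrow> x n = c n - c (n - 1)"
proof -
  have x: "x j = (\<Sum>k = 1..n. c k * simple_root t n k j)" if "j \<in> {1..n}" for j
    using assms(1) that by (simp add: root_coefficients_def)
  have "(\<Sum>j = 1..n. x j) = (\<Sum>k = 1..n. c k * (\<Sum>j = 1..n. simple_root t n k j))"
  proof -
    have "(\<Sum>j = 1..n. x j) = (\<Sum>j = 1..n. \<Sum>k = 1..n. c k * simple_root t n k j)"
      using x by (intro sum.cong) auto
    then show ?thesis unfolding sum_distrib_left by (subst sum.swap)
  qed
  also have "\<dots> = (\<Sum>k = 1..n. if k = n then (if t = SO_odd then 1 else 2) * c n else 0)"
  proof (rule sum.cong)
    fix k assume k: "k \<in> {1..n}"
    have e: "(\<Sum>j = 1..n. epsilon i j) = (if i \<in> {1..n} then 1 else 0)" for i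
      using sum_epsilon[of "\<lambda>_. 1" i n] by simp
    have "(\<Sum>j = 1..n. simple_root t n k j) = (if k = n then if t = SO_odd then 1 else 2 else 0)"
    proof (cases "k = n")
      case True
      then show ?thesis using k assms(2) e[of n] e[of "n - 1"]
        by (cases t) (auto simp: simple_root_def sum.distrib sum_distrib_left[symmetric])
    next
      case False
      then show ?thesis using k e[of k] e[of "k + 1"] by (simp add: simple_root_def sum_subtractf)
    qed
    then show "c k * (\<Sum>j = 1..n. simple_root t n k j) = (if k = n then (if t = SO_odd then 1 else 2) * c n else 0)"
      by simp
  qed simp
  also have "\<dots> = (if t = SO_odd then 1 else 2) * c n"
    using assms(2) by (simp split: if_splits)
  finally show "(\<Sum>j = 1..n. x j) = (if t = SO_odd then 1 else 2) * c n" .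
  assume t: "t = SO_even"
  then have n: "n \<ge> 2" using assms(2) by simp
  then have "simple_root t n n n = 1" by (simp add: simple_root_def epsilon_def t)
  then show "x n = c n - c (n - 1)"
    using n x[of n] sum_simple_roots[of n n c t] by simp
qed

lemma root_coefficients_exist:
  assumes "n \<ge> (if t = SO_even then 2 else 1)" "t = SO_even \<Longrightarrow> x n = 0 \<and> x (n - 1) = 0"
  shows "\<exists>c. root_coefficients t n x c"
proof -
  define S where "S k = (\<Sum>j = 1..k. x j)" for k
  have S: "S j - (if j \<ge> 2 then S (j - 1) else 0) = x j" if "j \<ge> 1" for j
    using that by (cases j) (auto simp: S_def not_le)
  \<comment> \<open>Partial sums solve the system of consecutive differences. The last root counts
    twice in the coordinate sum for \<open>Sp\<close> and \<open>SO_even\<close>, hence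
    \<open>S n / 2\<close>; for \<open>SO_even\<close> the vanishing last coordinate splits
    \<open>S n\<close> evenly between the two spin nodes.\<close>
  define c where "c k = (if k = n \<and> t \<noteq> SO_odd \<or> t = SO_even \<and> k = n - 1 then S n / 2 else S k)" for k
  have "x j = (\<Sum>k = 1..n. c k * simple_root t n k j)" if j: "j \<in> {1..n}" for j
  proof (cases t)
    case Sp
    then show ?thesis unfolding sum_simple_roots[OF j] using S[of j] j
      by (cases "j = n") (auto simp: c_def simple_root_def epsilon_def)
  next
    case SO_odd
    then show ?thesis unfolding sum_simple_roots[OF j] using S[of j] j
      by (cases "j = n") (auto simp: c_def simple_root_def epsilon_def)
  next
    case SO_even
    have "n \<ge> 2" using assms(1) SO_even by simp
    then obtain m where "n = 2 + m" using le_Suc_ex by blast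
    then have n: "n = Suc (Suc m)" by simp
    have x0: "x (Suc (Suc m)) = 0" "x (Suc m) = 0" using assms(2)[OF SO_even] by (simp_all add: n)
    have Sm: "S (Suc m) = S m" "S (Suc (Suc m)) = S m" using x0 by (simp_all add: S_def)
    have S0: "m = 0 \<Longrightarrow> S m = 0" by (simp add: S_def)
    consider "j = Suc (Suc m)" | "j = Suc m" | "j \<le> m" using j by (auto simp: n le_Suc_eq)
    then show ?thesis
    proof cases
      case 1
      then show ?thesis unfolding sum_simple_roots[OF j] using x0
        by (simp add: c_def simple_root_def epsilon_def SO_even n)
    next
      case 2
      then show ?thesis unfolding sum_simple_roots[OF j] using x0 Sm S0
        by (cases "m = 0") (simp_all add: c_def simple_root_def epsilon_def SO_even n)
    next
      case 3
      then have "j - Suc 0 \<noteq> Suc (Suc m)" "j - Suc 0 \<noteq> Suc m" by auto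
      then show ?thesis unfolding sum_simple_roots[OF j] using 3 j S[of j]
        by (cases "j \<ge> 2") (simp_all add: c_def simple_root_def epsilon_def SO_even n)
    qed
  qed
  then show ?thesis unfolding root_coefficients_def by blast
qed

lemma num_parts_mono: "diagram \<mu> \<subseteq> diagram \<nu> \<Longrightarrow> num_parts \<mu> \<le> num_parts \<nu>"
  using part_eq_0[of \<nu> "num_parts \<nu>"] spec[of "\<lambda>i. part \<mu> i \<le> part \<nu> i" "num_parts \<nu>"]
  by (simp add: num_parts_le_iff diagram_subset_iff)

text \<open>Under containment a strict size inequality just means different sizes, and the sum of
  coordinates of x is the size difference, a nonzero multiple of \<open>c n\<close>. For
  \<open>SO_even\<close> the last coordinate of x is 0, which makes the two spin coefficients
  equal.\<close>

lemma weight_difference_roots: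
  assumes lam: "num_parts lam + (if t = SO_even then 2 else 1) \<le> n" and sub: "diagram \<mu> \<subseteq> diagram lam"
  defines "x \<equiv> \<lambda>j. partition_weight t n lam j - partition_weight t n \<mu> j"
  shows "\<exists>c. root_coefficients t n x c"
    and "root_coefficients t n x c \<Longrightarrow>
      partition_size \<mu> < partition_size lam \<longleftrightarrow> c n \<noteq> 0 \<and> (t = SO_even \<longrightarrow> c (n - 1) \<noteq> 0)"
proof -
  have n: "n \<ge> (if t = SO_even then 2 else 1)" using lam by auto
  have \<mu>: "num_parts \<mu> + (if t = SO_even then 2 else 1) \<le> n"
    using lam num_parts_mono[OF sub] by simp
  have x: "x j = of_nat (part lam (j - 1)) - of_nat (part \<mu> (j - 1))" if "j \<in> {1..n}" for j
    unfolding x_def using lam \<mu> that by (subst (1 2) partition_weight_eq_part) auto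
  have x0: "x n = 0" "x (n - 1) = 0" if "t = SO_even"
    using that n lam \<mu> x[of n] x[of "n - 1"] part_eq_0[of lam] part_eq_0[of \<mu>] by auto
  show "\<exists>c. root_coefficients t n x c"
    by (rule root_coefficients_exist[OF n]) (use x0 in auto)
  assume c: "root_coefficients t n x c"
  have size: "(\<Sum>j = 1..n. of_nat (part \<nu> (j - 1))) = (of_nat (partition_size \<nu>) :: rat)"
    if "num_parts \<nu> \<le> n" for \<nu>
  proof -
    have "(\<Sum>j = 1..n. part \<nu> (j - 1)) = (\<Sum>i<n. part \<nu> i)"
      by (rule sum.reindex_bij_witness[of _ Suc "\<lambda>j. j - 1"]) auto
    also have "\<dots> = partition_size \<nu>"
      by (rule partition_size_eq_sum[symmetric]) (use that part_eq_0 in auto)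
    finally show ?thesis by (simp only: of_nat_sum[symmetric])
  qed
  have "(\<Sum>j = 1..n. x j) = of_nat (partition_size lam) - of_nat (partition_size \<mu>)"
    using size[of lam] size[of \<mu>] lam \<mu> by (simp add: x sum_subtractf)
  then have "(if t = SO_odd then 1 else 2) * c n = of_nat (partition_size lam) - of_nat (partition_size \<mu>)"
    using root_coefficients_last(1)[OF c n] by simp
  then have "c n \<noteq> 0 \<longleftrightarrow> partition_size \<mu> \<noteq> partition_size lam" by (auto split: if_splits)
  moreover have "t = SO_even \<Longrightarrow> c n = c (n - 1)"
    using root_coefficients_last(2)[OF c n] x0(1) by simp
  ultimately show "partition_size \<mu> < partition_size lam \<longleftrightarrow> c n \<noteq> 0 \<and> (t = SO_even \<longrightarrow> c (n - 1) \<noteq> 0)"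
    using partition_size_mono[OF sub] by auto
qed

text \<open>Appearance is read in both senses, as embedding into W and as a nonzero coefficient;
  \<open>group_weight\<close> singles out the partitions for which \<open>V\<close> is prescribed.
  Existence of root coefficients is asserted as well, so that the claim about all of them is not
  vacuous.\<close>

theorem proposition1p7:
  fixes t :: classical_type and n :: nat and lam :: partition
    and V :: "partition \<Rightarrow> rep" and W :: rep
  assumes "num_parts lam + (if t = SO_even then 2 else 1) \<le> n"
    and "irrep_family t n V"
    and "is_W t V lam W"
  shows
    "(\<forall>\<mu>. (group_weight t n \<mu> \<and> appears_in t n (V \<mu>) W) \<or> W_coefficient t lam \<mu> \<noteq> 0 \<longrightarrow>
       diagram \<mu> \<subseteq> diagram lam \<and>
       (\<mu> \<noteq> lam \<longrightarrow> partition_size \<mu> < partition_size lam)) \<and>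
     (\<forall>\<mu>. diagram \<mu> \<subseteq> diagram lam \<longrightarrow>
       (let x = (\<lambda>j. partition_weight t n lam j - partition_weight t n \<mu> j) in
         (\<exists>c. root_coefficients t n x c) \<and>
         (\<forall>c. root_coefficients t n x c \<longrightarrow>
            (partition_size \<mu> < partition_size lam \<longleftrightarrow>
               c n \<noteq> 0 \<and> (t = SO_even \<longrightarrow> c (n - 1) \<noteq> 0))))) \<and>
     (t \<noteq> Sp \<longrightarrow> (appears_in t n trivial_rep W \<longleftrightarrow> even_columns lam)) \<and>
     (t = Sp \<longrightarrow> (appears_in t n trivial_rep W \<longleftrightarrow> even_rows lam)) \<and>
     (appears_in t n trivial_rep W \<longrightarrow> multiplicity_in t n trivial_rep W = 1)"
proof -
  obtain ps where count: "\<And>\<mu>. int (count_list ps \<mu>) = W_coefficient t lam \<mu>" and W: "W = direct_sum (map V ps)"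
    using assms(3) by (auto simp: is_W_def)
  have sub: "diagram \<mu> \<subseteq> diagram lam" if "\<mu> \<in> set ps" for \<mu>
  proof (rule W_coefficient_nonzero_subset)
    show "W_coefficient t lam \<mu> \<noteq> 0" using that count[of \<mu>] by (metis count_list_0_iff of_nat_eq_0_iff)
  qed
  have few: "num_parts \<mu> + (if t = SO_even then 2 else 1) \<le> n" if "\<mu> \<in> set ps" for \<mu>
    using num_parts_mono[OF sub[OF that]] assms(1) by simp
  \<comment> \<open>The coefficient at the empty partition is 0 or 1, which is the bound on the
    count that \<open>multiplicity_trivial\<close> asks for.\<close>
  have "multiplicity_in t n trivial_rep W = count_list ps empty_partition"
    unfolding W using count[of empty_partition]
    by (intro multiplicity_trivial[OF assms(2) few]) (auto simp: W_coefficient_empty split: if_splits)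
  then have mult: "int (multiplicity_in t n trivial_rep W) =
      (if (if t = Sp then even_rows lam else even_columns lam) then 1 else 0)"
    using count[of empty_partition] by (simp only: W_coefficient_empty)
  have contained: "diagram \<mu> \<subseteq> diagram lam"
    if "(group_weight t n \<mu> \<and> appears_in t n (V \<mu>) W) \<or> W_coefficient t lam \<mu> \<noteq> 0" for \<mu>
    using that
  proof
    assume "group_weight t n \<mu> \<and> appears_in t n (V \<mu>) W"
    then have gw: "group_weight t n \<mu>" and app: "appears_in t n (V \<mu>) (direct_sum (map V ps))"
      by (simp_all add: W)
    have "\<mu> \<in> set ps" by (rule appears_in_direct_sum[OF assms(2) few gw app])
    then show ?thesis by (rule sub)
  qed (rule W_coefficient_nonzero_subset)
  show ?thesis
    unfolding Let_def
  proof (intro conjI allI impI)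
    fix \<mu> assume "(group_weight t n \<mu> \<and> appears_in t n (V \<mu>) W) \<or> W_coefficient t lam \<mu> \<noteq> 0"
    note sub\<mu> = contained[OF this]
    show "diagram \<mu> \<subseteq> diagram lam" by (rule sub\<mu>)
    show "partition_size \<mu> < partition_size lam" if "\<mu> \<noteq> lam"
      using sub\<mu> that by (rule partition_size_strict_mono)
  next
    fix \<mu> assume \<mu>: "diagram \<mu> \<subseteq> diagram lam"
    show "\<exists>c. root_coefficients t n (\<lambda>j. partition_weight t n lam j - partition_weight t n \<mu> j) c"
      by (rule weight_difference_roots(1)[OF assms(1) \<mu>])
    show "partition_size \<mu> < partition_size lam \<longleftrightarrow> c n \<noteq> 0 \<and> (t = SO_even \<longrightarrow> c (n - 1) \<noteq> 0)"
      if "root_coefficients t n (\<lambda>j. partition_weight t n lam j - partition_weight t n \<mu> j) c" for c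
      by (rule weight_difference_roots(2)[OF assms(1) \<mu> that])
  qed (use mult in \<open>auto simp: appears_in_def split: if_splits\<close>)
qed

end
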